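(* Let $T$ be a complete NIP theory, $M$ a saturated model, and $G$ a definable fsg group; let $\mu$ be the unique left-invariant global Keisler measure on $G$. Suppose $\mu$ is smooth (e.g. if $T$ is distal) and $G/G^{00}$ is profinite. Fix a definable set $X\subseteq G$ and $\epsilon>0$. Then there are (a) a definable finite-index normal subgroup $H$ of $G$, and (b) a set $Z\subseteq G$, which is a union of cosets of $H$, with $\mu(Z)<\epsilon$, satisfying: (i) (structure) $X\setminus Z$ is a union of cosets of $H$; (ii) (regularity) for any $g\in G\setminus Z$, either $gH\cap X=\emptyset$ or $gH\subseteq X$.
   Context: A global Keisler measure on a definable set is a finitely additive probability measure on its definable subsets. It is generically stable over a small model $M_0$ if it is definable over $M_0$ and finitely satisfiable in $M_0$. In an NIP theory, a definable group $G$ is fsg if it admits a generically stable left-invariant global Keisler measure, in which case such a measure is unique. A global measure $\mu$ is smooth if for some small model $M_0$, $\mu|_{M_0}$ has a unique extension to a global Keisler measure. $T$ is distal if it is NIP and every global generically stable Keisler measure is smooth. $G^{00}$ is the smallest type-definable (bounded intersection of definable sets) subgroup of $G$ of bounded index; it is normal, and $G/G^{00}$ is a compact Hausdorff group under the logic topology (closed sets are those whose preimage is type-definable). *)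

theory Defs
  imports "HOL-Analysis.Analysis" "HOL-Algebra.Coset" "HOL-Library.Equipollence"
begin

section \<open>First-order logic\<close>

record ('f, 'r) language =
  fun_symbols :: "'f set"
  fun_arity :: "'f \<Rightarrow> nat"
  rel_symbols :: "'r set"
  rel_arity :: "'r \<Rightarrow> nat"

datatype 'f fo_term = Var nat | App 'f "'f fo_term list"

datatype ('f, 'r) formula =
    Eq "'f fo_term" "'f fo_term"
  | Rel 'r "'f fo_term list"
  | Neg "('f, 'r) formula"
  | Conj "('f, 'r) formula" "('f, 'r) formula"
  | Exists nat "('f, 'r) formula"

fun wf_term :: "('f, 'r) language \<Rightarrow> 'f fo_term \<Rightarrow> bool" where
  "wf_term L (Var i) \<longleftrightarrow> True"
| "wf_term L (App f ts) \<longleftrightarrow>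
     f \<in> fun_symbols L \<and> length ts = fun_arity L f \<and> (\<forall>t\<in>set ts. wf_term L t)"

fun wf_formula :: "('f, 'r) language \<Rightarrow> ('f, 'r) formula \<Rightarrow> bool" where
  "wf_formula L (Eq s t) \<longleftrightarrow> wf_term L s \<and> wf_term L t"
| "wf_formula L (Rel r ts) \<longleftrightarrow>
     r \<in> rel_symbols L \<and> length ts = rel_arity L r \<and> (\<forall>t\<in>set ts. wf_term L t)"
| "wf_formula L (Neg p) \<longleftrightarrow> wf_formula L p"
| "wf_formula L (Conj p q) \<longleftrightarrow> wf_formula L p \<and> wf_formula L q"
| "wf_formula L (Exists i p) \<longleftrightarrow> wf_formula L p"

fun term_vars :: "'f fo_term \<Rightarrow> nat set" where
  "term_vars (Var i) = {i}"
| "term_vars (App f ts) = (\<Union>t\<in>set ts. term_vars t)"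

fun free_vars :: "('f, 'r) formula \<Rightarrow> nat set" where
  "free_vars (Eq s t) = term_vars s \<union> term_vars t"
| "free_vars (Rel r ts) = (\<Union>t\<in>set ts. term_vars t)"
| "free_vars (Neg p) = free_vars p"
| "free_vars (Conj p q) = free_vars p \<union> free_vars q"
| "free_vars (Exists i p) = free_vars p - {i}"

text \<open>The well-formed formulas whose free variables are among the first \<open>k\<close> variables.\<close>

definition formulas :: "('f, 'r) language \<Rightarrow> nat \<Rightarrow> ('f, 'r) formula set" where
  "formulas L k = {p. wf_formula L p \<and> free_vars p \<subseteq> {..<k}}"

abbreviation sentences :: "('f, 'r) language \<Rightarrow> ('f, 'r) formula set" where
  "sentences L \<equiv> formulas L 0"

record ('f, 'r, 'a) fo_struct =
  universe :: "'a set"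
  fun_interp :: "'f \<Rightarrow> 'a list \<Rightarrow> 'a"
  rel_interp :: "'r \<Rightarrow> 'a list \<Rightarrow> bool"

definition tuples :: "('f, 'r, 'a) fo_struct \<Rightarrow> nat \<Rightarrow> 'a list set" where
  "tuples M n = {xs. length xs = n \<and> set xs \<subseteq> universe M}"

definition is_struct :: "('f, 'r) language \<Rightarrow> ('f, 'r, 'a) fo_struct \<Rightarrow> bool" where
  "is_struct L M \<longleftrightarrow> universe M \<noteq> {} \<and>
     (\<forall>f\<in>fun_symbols L. \<forall>xs\<in>tuples M (fun_arity L f). fun_interp M f xs \<in> universe M)"

fun eval_term :: "('f, 'r, 'a) fo_struct \<Rightarrow> (nat \<Rightarrow> 'a) \<Rightarrow> 'f fo_term \<Rightarrow> 'a" where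
  "eval_term M v (Var i) = v i"
| "eval_term M v (App f ts) = fun_interp M f (map (eval_term M v) ts)"

fun sat :: "('f, 'r, 'a) fo_struct \<Rightarrow> (nat \<Rightarrow> 'a) \<Rightarrow> ('f, 'r) formula \<Rightarrow> bool" where
  "sat M v (Eq s t) \<longleftrightarrow> eval_term M v s = eval_term M v t"
| "sat M v (Rel r ts) \<longleftrightarrow> rel_interp M r (map (eval_term M v) ts)"
| "sat M v (Neg p) \<longleftrightarrow> \<not> sat M v p"
| "sat M v (Conj p q) \<longleftrightarrow> sat M v p \<and> sat M v q"
| "sat M v (Exists i p) \<longleftrightarrow> (\<exists>a\<in>universe M. sat M (v(i := a)) p)"

text \<open>\<open>holds M p xs\<close> assigns the entries of \<open>xs\<close> to the first \<open>length xs\<close> variables; it is only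
  used for \<open>p \<in> formulas L (length xs)\<close>, so the default value is never inspected.
  A partitioned formula \<open>p(x;y)\<close> with tuples \<open>x\<close>, \<open>y\<close> of lengths \<open>n\<close>, \<open>m\<close> is an element of
  \<open>formulas L (n + m)\<close>, evaluated at \<open>x @ y\<close>.\<close>

definition holds :: "('f, 'r, 'a) fo_struct \<Rightarrow> ('f, 'r) formula \<Rightarrow> 'a list \<Rightarrow> bool" where
  "holds M p xs \<longleftrightarrow> sat M (\<lambda>i. if i < length xs then xs ! i else undefined) p"

definition models ::
  "('f, 'r) language \<Rightarrow> ('f, 'r) formula set \<Rightarrow> ('f, 'r, 'a) fo_struct \<Rightarrow> bool" where
  "models L T M \<longleftrightarrow> is_struct L M \<and> (\<forall>p\<in>T. holds M p [])"

text \<open>HOL cannot quantify over types, so the next two definitions, which speak of all models of a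
  theory, consider those whose universe is contained in a given type \<open>'a\<close>. If the cardinality
  of \<open>'a\<close> is at least $2^{\aleph_0}$ and at least that of the language, as it is
  wherever they are used below, this is no restriction, by the Loewenheim-Skolem theorem.\<close>

definition complete_theory ::
  "'a itself \<Rightarrow> ('f, 'r) language \<Rightarrow> ('f, 'r) formula set \<Rightarrow> bool" where
  "complete_theory _ L T \<longleftrightarrow> T \<subseteq> sentences L \<and>
     (\<exists>N :: ('f, 'r, 'a) fo_struct. models L T N) \<and>
     (\<forall>p\<in>sentences L.
        (\<forall>N :: ('f, 'r, 'a) fo_struct. models L T N \<longrightarrow> holds N p []) \<or>
        (\<forall>N :: ('f, 'r, 'a) fo_struct. models L T N \<longrightarrow> holds N (Neg p) []))"

definition NIP :: "'a itself \<Rightarrow> ('f, 'r) language \<Rightarrow> ('f, 'r) formula set \<Rightarrow> bool" where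
  "NIP _ L T \<longleftrightarrow>
     (\<forall>n m. \<forall>p\<in>formulas L (n + m).
        \<not> (\<exists>(N :: ('f, 'r, 'a) fo_struct) a b. models L T N \<and>
              range a \<subseteq> tuples N n \<and> range b \<subseteq> tuples N m \<and>
              (\<forall>(i::nat) (S::nat set). holds N p (a i @ b S) \<longleftrightarrow> i \<in> S)))"

definition elementary_substruct ::
  "('f, 'r) language \<Rightarrow> ('f, 'r, 'a) fo_struct \<Rightarrow> ('f, 'r, 'a) fo_struct \<Rightarrow> bool" where
  "elementary_substruct L N M \<longleftrightarrow>
     is_struct L N \<and> universe N \<subseteq> universe M \<and>
     (\<forall>f\<in>fun_symbols L. \<forall>xs\<in>tuples N (fun_arity L f). fun_interp N f xs = fun_interp M f xs) \<and>
     (\<forall>r\<in>rel_symbols L. \<forall>xs\<in>tuples N (rel_arity L r). rel_interp N r xs \<longleftrightarrow> rel_interp M r xs) \<and>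
     (\<forall>k. \<forall>p\<in>formulas L k. \<forall>xs\<in>tuples N k. holds N p xs \<longleftrightarrow> holds M p xs)"


section \<open>Saturation and definability\<close>

text \<open>``Small'' and ``bounded'' mean: of cardinality less than that of the saturated model.\<close>

definition small :: "('f, 'r, 'a) fo_struct \<Rightarrow> 'b set \<Rightarrow> bool" where
  "small M A \<longleftrightarrow> A \<prec> universe M"

text \<open>A formula with parameters is represented by a formula paired with the tuple of parameters.\<close>

definition partial_type ::
  "('f, 'r) language \<Rightarrow> ('f, 'r, 'a) fo_struct \<Rightarrow> 'a set \<Rightarrow> (('f, 'r) formula \<times> 'a list) set \<Rightarrow> bool" where
  "partial_type L M A \<Phi> \<longleftrightarrow>
     (\<forall>(p, c)\<in>\<Phi>. p \<in> formulas L (1 + length c) \<and> set c \<subseteq> A) \<and>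
     (\<forall>\<Psi>. finite \<Psi> \<and> \<Psi> \<subseteq> \<Phi> \<longrightarrow> (\<exists>x\<in>universe M. \<forall>(p, c)\<in>\<Psi>. holds M p ([x] @ c)))"

definition saturated :: "('f, 'r) language \<Rightarrow> ('f, 'r, 'a) fo_struct \<Rightarrow> bool" where
  "saturated L M \<longleftrightarrow>
     (\<forall>A \<Phi>. A \<subseteq> universe M \<and> small M A \<and> partial_type L M A \<Phi> \<longrightarrow>
        (\<exists>x\<in>universe M. \<forall>(p, c)\<in>\<Phi>. holds M p ([x] @ c)))"

text \<open>The cardinality of the model is assumed to exceed $2^{|L|+\aleph_0}$. Every strongly
  inaccessible cardinal greater than $|L|$ has this property, so this covers the usual monster
  models. Without a largeness assumption, subgroups of index at most $2^{|L|+\aleph_0}$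
  need not be of bounded index in the above sense.\<close>

definition large :: "('f, 'r) language \<Rightarrow> ('f, 'r, 'a) fo_struct \<Rightarrow> bool" where
  "large L M \<longleftrightarrow> Pow ((fun_symbols L <+> rel_symbols L) <+> (UNIV :: nat set)) \<prec> universe M"

definition solutions ::
  "('f, 'r, 'a) fo_struct \<Rightarrow> nat \<Rightarrow> ('f, 'r) formula \<Rightarrow> 'a list \<Rightarrow> 'a list set" where
  "solutions M n p c = {x \<in> tuples M n. holds M p (x @ c)}"

definition definable_over ::
  "('f, 'r) language \<Rightarrow> ('f, 'r, 'a) fo_struct \<Rightarrow> 'a set \<Rightarrow> nat \<Rightarrow> 'a list set \<Rightarrow> bool" where
  "definable_over L M A n X \<longleftrightarrow>
     (\<exists>c p. set c \<subseteq> A \<and> p \<in> formulas L (n + length c) \<and> X = solutions M n p c)"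

abbreviation definable ::
  "('f, 'r) language \<Rightarrow> ('f, 'r, 'a) fo_struct \<Rightarrow> nat \<Rightarrow> 'a list set \<Rightarrow> bool" where
  "definable L M \<equiv> definable_over L M (universe M)"

definition type_definable_over ::
  "('f, 'r) language \<Rightarrow> ('f, 'r, 'a) fo_struct \<Rightarrow> 'a set \<Rightarrow> nat \<Rightarrow> 'a list set \<Rightarrow> bool" where
  "type_definable_over L M A n Y \<longleftrightarrow>
     (\<exists>\<D>. small M \<D> \<and> (\<forall>D\<in>\<D>. definable_over L M A n D) \<and> Y = tuples M n \<inter> \<Inter>\<D>)"

abbreviation type_definable ::
  "('f, 'r) language \<Rightarrow> ('f, 'r, 'a) fo_struct \<Rightarrow> nat \<Rightarrow> 'a list set \<Rightarrow> bool" where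
  "type_definable L M \<equiv> type_definable_over L M (universe M)"

definition small_model ::
  "('f, 'r) language \<Rightarrow> ('f, 'r, 'a) fo_struct \<Rightarrow> ('f, 'r, 'a) fo_struct \<Rightarrow> bool" where
  "small_model L M N \<longleftrightarrow> elementary_substruct L N M \<and> small M (universe N)"


section \<open>Keisler measures\<close>

text \<open>A global Keisler measure on the definable set \<open>S\<close> is a real-valued set function of which only
  the values on the definable (with parameters from \<open>M\<close>) subsets of \<open>S\<close> are relevant.\<close>

definition keisler_measure ::
  "('f, 'r) language \<Rightarrow> ('f, 'r, 'a) fo_struct \<Rightarrow> nat \<Rightarrow> 'a list set \<Rightarrow> ('a list set \<Rightarrow> real) \<Rightarrow> bool" where
  "keisler_measure L M n S \<mu> \<longleftrightarrow>
     (\<forall>X. definable L M n X \<and> X \<subseteq> S \<longrightarrow> 0 \<le> \<mu> X) \<and>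
     \<mu> S = 1 \<and>
     (\<forall>X Y. definable L M n X \<and> X \<subseteq> S \<and> definable L M n Y \<and> Y \<subseteq> S \<and> X \<inter> Y = {} \<longrightarrow>
        \<mu> (X \<union> Y) = \<mu> X + \<mu> Y)"

definition measure_definable_over ::
  "('f, 'r) language \<Rightarrow> ('f, 'r, 'a) fo_struct \<Rightarrow> nat \<Rightarrow> 'a list set \<Rightarrow> ('a list set \<Rightarrow> real) \<Rightarrow>
     'a set \<Rightarrow> bool" where
  "measure_definable_over L M n S \<mu> A \<longleftrightarrow>
     (\<forall>m. \<forall>p\<in>formulas L (n + m). \<forall>C. closed C \<and> C \<subseteq> {0..1} \<longrightarrow>
        type_definable_over L M A m {b \<in> tuples M m. \<mu> (solutions M n p b \<inter> S) \<in> C})"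

definition finitely_satisfiable_in ::
  "('f, 'r) language \<Rightarrow> ('f, 'r, 'a) fo_struct \<Rightarrow> nat \<Rightarrow> 'a list set \<Rightarrow> ('a list set \<Rightarrow> real) \<Rightarrow>
     'a set \<Rightarrow> bool" where
  "finitely_satisfiable_in L M n S \<mu> A \<longleftrightarrow>
     (\<forall>X. definable L M n X \<and> X \<subseteq> S \<and> \<mu> X > 0 \<longrightarrow> (\<exists>x\<in>X. set x \<subseteq> A))"

text \<open>The small model in the next two definitions has to contain parameters defining \<open>S\<close>, so that
  the measure has a restriction to it.\<close>

definition generically_stable ::
  "('f, 'r) language \<Rightarrow> ('f, 'r, 'a) fo_struct \<Rightarrow> nat \<Rightarrow> 'a list set \<Rightarrow> ('a list set \<Rightarrow> real) \<Rightarrow> bool" where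
  "generically_stable L M n S \<mu> \<longleftrightarrow>
     (\<exists>M0. small_model L M M0 \<and> definable_over L M (universe M0) n S \<and>
        measure_definable_over L M n S \<mu> (universe M0) \<and>
        finitely_satisfiable_in L M n S \<mu> (universe M0))"

definition smooth ::
  "('f, 'r) language \<Rightarrow> ('f, 'r, 'a) fo_struct \<Rightarrow> nat \<Rightarrow> 'a list set \<Rightarrow> ('a list set \<Rightarrow> real) \<Rightarrow> bool" where
  "smooth L M n S \<mu> \<longleftrightarrow>
     (\<exists>M0. small_model L M M0 \<and> definable_over L M (universe M0) n S \<and>
        (\<forall>\<nu>. keisler_measure L M n S \<nu> \<and>
              (\<forall>X. definable_over L M (universe M0) n X \<and> X \<subseteq> S \<longrightarrow> \<nu> X = \<mu> X) \<longrightarrow>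
              (\<forall>X. definable L M n X \<and> X \<subseteq> S \<longrightarrow> \<nu> X = \<mu> X)))"

definition distal ::
  "('f, 'r) language \<Rightarrow> ('f, 'r) formula set \<Rightarrow> ('f, 'r, 'a) fo_struct \<Rightarrow> bool" where
  "distal L T M \<longleftrightarrow> NIP TYPE('a) L T \<and>
     (\<forall>n S \<mu>. definable L M n S \<and> keisler_measure L M n S \<mu> \<and> generically_stable L M n S \<mu> \<longrightarrow>
        smooth L M n S \<mu>)"


section \<open>Definable groups\<close>

definition definable_group ::
  "('f, 'r) language \<Rightarrow> ('f, 'r, 'a) fo_struct \<Rightarrow> nat \<Rightarrow> 'a list monoid \<Rightarrow> bool" where
  "definable_group L M n G \<longleftrightarrow> group G \<and> definable L M n (carrier G) \<and>
     definable L M (n + n + n)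
       {x @ y @ (x \<otimes>\<^bsub>G\<^esub> y) | x y. x \<in> carrier G \<and> y \<in> carrier G}"

definition left_invariant ::
  "('f, 'r) language \<Rightarrow> ('f, 'r, 'a) fo_struct \<Rightarrow> nat \<Rightarrow> 'a list monoid \<Rightarrow> ('a list set \<Rightarrow> real) \<Rightarrow> bool" where
  "left_invariant L M n G \<mu> \<longleftrightarrow>
     (\<forall>g\<in>carrier G. \<forall>X. definable L M n X \<and> X \<subseteq> carrier G \<longrightarrow> \<mu> (g <#\<^bsub>G\<^esub> X) = \<mu> X)"

definition fsg ::
  "('f, 'r) language \<Rightarrow> ('f, 'r, 'a) fo_struct \<Rightarrow> nat \<Rightarrow> 'a list monoid \<Rightarrow> bool" where
  "fsg L M n G \<longleftrightarrow> definable_group L M n G \<and>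
     (\<exists>\<mu>. keisler_measure L M n (carrier G) \<mu> \<and> generically_stable L M n (carrier G) \<mu> \<and>
          left_invariant L M n G \<mu>)"

definition G00 ::
  "('f, 'r) language \<Rightarrow> ('f, 'r, 'a) fo_struct \<Rightarrow> nat \<Rightarrow> 'a list monoid \<Rightarrow> 'a list set" where
  "G00 L M n G =
     (LEAST H. subgroup H G \<and> type_definable L M n H \<and> small M (rcosets\<^bsub>G\<^esub> H))"

definition logic_topology ::
  "('f, 'r) language \<Rightarrow> ('f, 'r, 'a) fo_struct \<Rightarrow> nat \<Rightarrow> 'a list monoid \<Rightarrow> 'a list set \<Rightarrow>
     'a list set topology" where
  "logic_topology L M n G N =
     topology (\<lambda>U. U \<subseteq> carrier (G Mod N) \<and> type_definable L M n (\<Union>(carrier (G Mod N) - U)))"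

definition profinite_group :: "'b monoid \<Rightarrow> 'b topology \<Rightarrow> bool" where
  "profinite_group K \<tau> \<longleftrightarrow> group K \<and> topspace \<tau> = carrier K \<and>
     continuous_map (prod_topology \<tau> \<tau>) \<tau> (\<lambda>(x, y). x \<otimes>\<^bsub>K\<^esub> y) \<and>
     continuous_map \<tau> \<tau> (\<lambda>x. inv\<^bsub>K\<^esub> x) \<and>
     compact_space \<tau> \<and> Hausdorff_space \<tau> \<and>
     (\<forall>x\<in>topspace \<tau>. connected_component_of_set \<tau> x = {x})"

definition union_of_cosets :: "'b monoid \<Rightarrow> 'b set \<Rightarrow> 'b set \<Rightarrow> bool" where
  "union_of_cosets G H Y \<longleftrightarrow> (\<exists>A\<subseteq>carrier G. Y = (\<Union>g\<in>A. g <#\<^bsub>G\<^esub> H))"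

end

theory Submission
  imports Defs
begin

text \<open>A smooth measure sandwiches every definable set, up to \<open>\<epsilon>\<close> in measure, between two sets from a
  fixed small family: otherwise the inner and outer measures of the set would differ and the
  restriction to the small model would have two extensions. By compactness, finitely many
  sandwiches serve all members of a definable family at once.

  Let the stabilizer consist of all \<open>g\<close> such that \<open>g B\<close> and \<open>B\<close> differ by measure 0 for all definable
  \<open>B\<close>. By the sandwiches it is type-definable of bounded index. It is contained in
  every type-definable subgroup \<open>K\<close> of bounded index, because a definable \<open>D \<supseteq> K\<close> contains some
  \<open>E E\<^sup>-\<^sup>1\<close> with \<open>E \<supseteq> K\<close> definable of positive measure. So it is \<open>G\<^sup>0\<^sup>0\<close>.

  Sandwiching the sets \<open>g\<^sup>-\<^sup>1 X\<close> and then the translates of the error sets splits \<open>G\<close> into finitely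
  many definable pieces \<open>B\<close>, for each of which all differences of \<open>X\<close> and \<open>h X\<close>, with
  \<open>h \<in> B B\<^sup>-\<^sup>1\<close>, lie in one set of measure less than \<open>\<epsilon>\<close>. If \<open>B\<close> has positive measure, then
  \<open>B B\<^sup>-\<^sup>1\<close> contains the stabilizer, hence by profiniteness and compactness a definable normal
  subgroup \<open>H\<close> of finite index, and \<open>Z\<close> is the union of the cosets of \<open>H\<close> that meet both \<open>X\<close> and its
  complement.\<close>

section \<open>Cardinalities\<close>

unbundle cardinal_syntax

text \<open>Small means of cardinality below that of \<open>M\<close>, and the power set of a small
  set need not be small. Modulo the stabilizer, an element of \<open>G\<close> is recorded by which
  members of an approximating family lie close to its translates, hence by a subset of a set of the
  family's size. Sandwiches over an arbitrary small model thus do not bound the index; the family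
  must have the size of the language, whose power set lies below \<open>M\<close> by
  \<open>large\<close>. Quotients are always produced by one device: if \<open>h B\<close> and
  \<open>B\<close> were disjoint, their symmetric difference would have measure
  \<open>2 * \<mu> B\<close>, so a smaller distance yields a common point and \<open>h\<close> lies
  in \<open>B B\<^sup>-\<^sup>1\<close>. If \<open>\<mu> B > 0\<close>, this covers the stabilizer
  and, by sandwiches, a definable set around it. Distality makes the generically stable measure
  furnished by \<open>fsg\<close> smooth, while the statement bounds the given invariant \<mu>. The
  construction therefore runs with some smooth invariant \<nu>; as \<open>Z\<close> is a union of
  cosets of a subgroup of finite index, all invariant measures agree on it and the bound passes to
  \<mu>.\<close>

lemma lepoll_iff_card_of: "A \<lesssim> B \<longleftrightarrow> |A| \<le>o |B|"
  by (simp add: lepoll_def card_of_ordLeq)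

lemma lesspoll_iff_card_of: "A \<prec> B \<longleftrightarrow> |A| <o |B|"
  unfolding lesspoll_def eqpoll_iff_card_of_ordIso lepoll_iff_card_of
  using ordLeq_iff_ordLess_or_ordIso not_ordLess_ordIso by blast

lemma lesspoll_iff_not_lepoll: "A \<prec> B \<longleftrightarrow> \<not> B \<lesssim> A"
  using not_ordLess_iff_ordLeq[OF card_of_Well_order[of B] card_of_Well_order[of A]]
  unfolding lepoll_iff_card_of lesspoll_iff_card_of by blast

lemma Times_lepoll_infinite:
  assumes "infinite C" "A \<lesssim> C" "B \<lesssim> C"
  shows "A \<times> B \<lesssim> C"
proof -
  have "A \<times> B \<lesssim> C \<times> C"
    by (rule times_lepoll_mono[OF assms(2,3)])
  also have "C \<times> C \<approx> C"
    using card_of_Times_same_infinite[OF assms(1)] by (simp add: eqpoll_iff_card_of_ordIso)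
  finally show ?thesis .
qed

lemma UN_lepoll_infinite:
  assumes "infinite C" "I \<lesssim> C" "\<And>i. i \<in> I \<Longrightarrow> A i \<lesssim> C"
  shows "(\<Union>i\<in>I. A i) \<lesssim> C"
  using card_of_UNION_ordLeq_infinite[OF assms(1), of I A] assms(2,3)
  unfolding lepoll_iff_card_of by blast

lemma Un_lepoll_infinite:
  assumes "infinite C" "A \<lesssim> C" "B \<lesssim> C"
  shows "A \<union> B \<lesssim> C"
proof -
  have "A \<union> B = (\<Union>b\<in>UNIV. if b then A else B)" by (auto split: if_splits)
  also have "\<dots> \<lesssim> C"
    using assms by (intro UN_lepoll_infinite) (auto simp: finite_lepoll_infinite)
  finally show ?thesis .
qed

lemma lists_lepoll_infinite:
  assumes "infinite C" "A \<lesssim> C"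
  shows "lists A \<lesssim> C"
proof -
  have len: "{xs \<in> lists A. length xs = k} \<lesssim> C" for k
  proof (induction k)
    case 0
    have "{xs \<in> lists A. length xs = 0} = {[]}" by auto
    then show ?case using assms(1) by (simp add: finite_lepoll_infinite)
  next
    case (Suc k)
    have "{xs \<in> lists A. length xs = Suc k}
        \<subseteq> (\<lambda>(x, xs). x # xs) ` (A \<times> {xs \<in> lists A. length xs = k})"
      by (auto simp: length_Suc_conv)
    then show ?case
      by (rule lepoll_trans[OF subset_image_lepoll Times_lepoll_infinite[OF assms Suc.IH]])
  qed
  have "lists A = (\<Union>k. {xs \<in> lists A. length xs = k})" by auto
  also have "\<dots> \<lesssim> C"
    using len assms(1) by (intro UN_lepoll_infinite) (auto simp flip: infinite_le_lepoll)
  finally show ?thesis .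
qed

text \<open>The cardinal of \<open>U\<close> may be singular, so closure properties of smallness are
  obtained from a single infinite set \<open>C\<close> strictly below \<open>U\<close> that bounds
  the given sets. The summand of natural numbers makes \<open>C\<close> infinite.\<close>

lemma lesspoll_max:
  fixes A :: "'a set" and B :: "'b set"
  assumes "uncountable U" "A \<prec> U" "B \<prec> U"
  obtains C :: "('a + 'b + nat) set" where "infinite C" "A \<lesssim> C" "B \<lesssim> C" "C \<prec> U"
proof -
  define C where "C = A <+> B <+> (UNIV :: nat set)"
  have nat: "(UNIV :: nat set) \<prec> U"
    using assms(1) by (auto simp: lesspoll_iff_not_lepoll dest: countable_lepoll[rotated])
  have inf: "infinite U" using assms(1) countable_finite by blast
  have "C \<prec> U"
    using assms(2,3) nat unfolding C_def lesspoll_iff_card_of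
    by (intro card_of_Plus_ordLess_infinite[OF inf])
  moreover have "A \<lesssim> C" "B \<lesssim> C"
    unfolding C_def lepoll_def by (rule exI[of _ "Inl"], force simp: inj_on_def)
      (rule exI[of _ "Inr \<circ> Inl"], force simp: inj_on_def)
  moreover have "infinite C" by (simp add: C_def)
  ultimately show ?thesis using that by blast
qed

context
  fixes U :: "'u set"
  assumes uncountable: "uncountable U"
begin

lemma Times_lesspoll:
  fixes A :: "'i set" and B :: "'j set"
  assumes "A \<prec> U" "B \<prec> U"
  shows "A \<times> B \<prec> U"
proof -
  obtain C :: "('i + 'j + nat) set" where C: "infinite C" "A \<lesssim> C" "B \<lesssim> C" "C \<prec> U"
    using lesspoll_max[OF uncountable assms(1,2)] by blast
  show ?thesis
    by (rule lesspoll_trans1[OF Times_lepoll_infinite C(4)]) (use C in auto)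
qed

lemma Un_lesspoll:
  fixes A :: "'i set"
  assumes "A \<prec> U" "B \<prec> U"
  shows "A \<union> B \<prec> U"
proof -
  obtain C :: "('i + 'i + nat) set" where C: "infinite C" "A \<lesssim> C" "B \<lesssim> C" "C \<prec> U"
    using lesspoll_max[OF uncountable assms(1,2)] by blast
  show ?thesis
    by (rule lesspoll_trans1[OF Un_lepoll_infinite C(4)]) (use C in auto)
qed

lemma lists_lesspoll:
  fixes A :: "'i set"
  assumes "A \<prec> U"
  shows "lists A \<prec> U"
proof -
  obtain C :: "('i + 'i + nat) set" where C: "infinite C" "A \<lesssim> C" "A \<lesssim> C" "C \<prec> U"
    using lesspoll_max[OF uncountable assms(1,1)] by blast
  show ?thesis
    by (rule lesspoll_trans1[OF lists_lepoll_infinite C(4)]) (use C in auto)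
qed

lemma image_lesspoll: "A \<prec> U \<Longrightarrow> f ` A \<prec> U"
  by (rule lesspoll_trans1[OF image_lepoll])

lemma countable_lesspoll_uncountable: "countable A \<Longrightarrow> A \<prec> U"
  using uncountable by (auto simp: lesspoll_iff_not_lepoll dest: countable_lepoll)

text \<open>Members must be countable: if \<open>U\<close> is singular, a union of fewer than
  \<open>U\<close> many sets, each smaller than \<open>U\<close>, can be as large as
  \<open>U\<close>.\<close>

lemma UN_countable_lesspoll:
  fixes I :: "'i set"
  assumes "I \<prec> U" "\<And>i. i \<in> I \<Longrightarrow> countable (A i)"
  shows "(\<Union>i\<in>I. A i) \<prec> U"
proof -
  obtain C :: "('i + 'i + nat) set" where C: "infinite C" "I \<lesssim> C" "C \<prec> U"
    using lesspoll_max[OF uncountable assms(1,1)] by blast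
  have "A i \<lesssim> C" if "i \<in> I" for i
    using assms(2)[OF that] C(1) lepoll_trans[of "A i" "UNIV :: nat set" C]
    by (auto simp: infinite_le_lepoll lepoll_def countable_def)
  then show ?thesis
    by (intro lesspoll_trans1[OF UN_lepoll_infinite[OF C(1,2)] C(3)])
qed

lemma Fpow_lesspoll: "A \<prec> U \<Longrightarrow> {F. finite F \<and> F \<subseteq> A} \<prec> U"
proof -
  assume "A \<prec> U"
  have "{F. finite F \<and> F \<subseteq> A} \<subseteq> set ` lists A"
  proof
    fix F assume "F \<in> {F. finite F \<and> F \<subseteq> A}"
    moreover from this obtain xs where "set xs = F" using finite_list by blast
    ultimately show "F \<in> set ` lists A" by auto
  qed
  then show ?thesis
    by (rule lesspoll_trans1[OF subset_image_lepoll lists_lesspoll[OF \<open>A \<prec> U\<close>]])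
qed

end

section \<open>Cardinality of the sets of terms and formulas\<close>

lemma wf_terms_lepoll:
  assumes "infinite C" "fun_symbols L \<lesssim> C"
  shows "{t. wf_term L t} \<lesssim> C"
proof -
  \<comment> \<open>Stage \<open>k\<close> holds the terms built in at most \<open>k\<close> rounds.
    The arguments of a function symbol form a finite list and hence have a common stage, so
    countably many stages exhaust the terms.\<close>
  define W where "W = rec_nat {} (\<lambda>_ W. range Var \<union> (\<lambda>(f, ts). App f ts) ` (fun_symbols L \<times> lists W))"
  have W0: "W 0 = {}" and WS: "W (Suc k) = range Var \<union> (\<lambda>(f, ts). App f ts) ` (fun_symbols L \<times> lists (W k))" for k
    by (auto simp: W_def)
  have W: "W k \<lesssim> C" for k
  proof (induction k)
    case 0 show ?case by (simp add: W0)
  next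
    case (Suc k)
    have "range Var \<lesssim> C"
      using assms(1) by (intro lepoll_trans[OF image_lepoll]) (simp flip: infinite_le_lepoll)
    moreover have "(\<lambda>(f, ts). App f ts) ` (fun_symbols L \<times> lists (W k)) \<lesssim> C"
      using Times_lepoll_infinite[OF assms lists_lepoll_infinite[OF assms(1) Suc.IH]]
      by (rule lepoll_trans[OF image_lepoll])
    ultimately show ?case unfolding WS by (rule Un_lepoll_infinite[OF assms(1)])
  qed
  have mono: "W k \<subseteq> W (Suc k)" for k
  proof (induction k)
    case 0 show ?case by (simp add: W0)
  next
    case (Suc k)
    then have "lists (W k) \<subseteq> lists (W (Suc k))" by (rule lists_mono)
    then show ?case unfolding WS[of k] WS[of "Suc k"] by auto
  qed
  have ex: "\<exists>k. t \<in> W k" if "wf_term L t" for t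
    using that
  proof (induction t)
    case (Var x)
    have "Var x \<in> W 1" using WS[of 0] by auto
    then show ?case by blast
  next
    case (App f ts)
    then have "\<forall>t\<in>set ts. \<exists>k. t \<in> W k" by auto
    then obtain k where k: "\<And>t. t \<in> set ts \<Longrightarrow> t \<in> W (k t)" by metis
    define K where "K = Max (insert 0 (k ` set ts))"
    have "t \<in> W K" if "t \<in> set ts" for t
      using lift_Suc_mono_le[of W, OF mono, of "k t" K] k[OF that] that by (auto simp: K_def)
    then have "App f ts \<in> W (Suc K)" using App.prems unfolding WS by auto
    then show ?case by blast
  qed
  have "{t. wf_term L t} \<subseteq> (\<Union>k. W k)" using ex by auto
  moreover have "(\<Union>k. W k) \<lesssim> C"
    using W assms(1) by (intro UN_lepoll_infinite) (auto simp flip: infinite_le_lepoll)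
  ultimately show ?thesis by (rule lepoll_trans[OF subset_imp_lepoll])
qed

lemma wf_formulas_lepoll:
  assumes "infinite C" "fun_symbols L \<lesssim> C" "rel_symbols L \<lesssim> C"
  shows "{p. wf_formula L p} \<lesssim> C"
proof -
  let ?T = "{t. wf_term L t}"
  \<comment> \<open>One round of formula building. All terms are available at once, so only the
    connectives and quantifiers are iterated.\<close>
  define S where "S W = (\<lambda>(s, t). Eq s t) ` (?T \<times> ?T) \<union> ((\<lambda>(r, ts). Rel r ts) ` (rel_symbols L \<times> lists ?T)
      \<union> (Neg ` W \<union> ((\<lambda>(p, q). Conj p q) ` (W \<times> W) \<union> (\<lambda>(i, p). Exists i p) ` ((UNIV :: nat set) \<times> W))))" for W
  define W where "W = rec_nat {} (\<lambda>_. S)"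
  have W0: "W 0 = {}" and WS: "W (Suc k) = S (W k)" for k
    by (auto simp: W_def)
  have T: "?T \<lesssim> C" by (rule wf_terms_lepoll[OF assms(1,2)])
  have nat: "(UNIV :: nat set) \<lesssim> C" using assms(1) by (simp flip: infinite_le_lepoll)
  have W: "W k \<lesssim> C" for k
  proof (induction k)
    case 0 show ?case by (simp add: W0)
  next
    case (Suc k)
    show ?case unfolding WS S_def
      by (intro Un_lepoll_infinite assms lepoll_trans[OF image_lepoll] Times_lepoll_infinite
          lists_lepoll_infinite T nat Suc.IH)
  qed
  have S_mono: "S A \<subseteq> S B" if "A \<subseteq> B" for A B using that unfolding S_def by blast
  have mono: "W k \<subseteq> W (Suc k)" for k
  proof (induction k)
    case 0 show ?case by (simp add: W0)
  next
    case (Suc k)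
    then show ?case unfolding WS[of k] WS[of "Suc k"] by (rule S_mono)
  qed
  have mono': "W i \<subseteq> W j" if "i \<le> j" for i j using lift_Suc_mono_le[of W, OF mono that] .
  have ex: "\<exists>k. p \<in> W k" if "wf_formula L p" for p
    using that
  proof (induction p)
    case (Eq s t)
    then have "Eq s t \<in> W (Suc 0)" unfolding WS S_def by force
    then show ?case by blast
  next
    case (Rel r ts)
    then have "Rel r ts \<in> W (Suc 0)" unfolding WS S_def by force
    then show ?case by blast
  next
    case (Neg p)
    then obtain k where "p \<in> W k" by auto
    then have "Neg p \<in> W (Suc k)" unfolding WS S_def by blast
    then show ?case by blast
  next
    case (Conj p q)
    then obtain i j where "p \<in> W i" "q \<in> W j" by auto
    then have "p \<in> W (max i j)" "q \<in> W (max i j)" using mono'[of i "max i j"] mono'[of j "max i j"] by auto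
    then have "Conj p q \<in> W (Suc (max i j))" unfolding WS S_def by force
    then show ?case by blast
  next
    case (Exists i p)
    then obtain k where "p \<in> W k" by auto
    then have "Exists i p \<in> W (Suc k)" unfolding WS S_def by force
    then show ?case by blast
  qed
  have "{p. wf_formula L p} \<subseteq> (\<Union>k. W k)" using ex by auto
  moreover have "(\<Union>k. W k) \<lesssim> C"
    using W assms(1) nat by (intro UN_lepoll_infinite) auto
  ultimately show ?thesis by (rule lepoll_trans[OF subset_imp_lepoll])
qed

section \<open>Extensions of finitely additive measures\<close>

text \<open>Normalized monotone submodular set functions. The class contains outer measures and is
  closed under infima of chains, so it has minimal elements below any given one; equality in the
  last clause is what additivity requires.\<close>

definition strongly_subadditive :: "'a set \<Rightarrow> ('a set \<Rightarrow> real) \<Rightarrow> bool" where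
  "strongly_subadditive S m \<longleftrightarrow>
     (\<forall>Y. 0 \<le> m Y) \<and> m {} = 0 \<and> m S = 1 \<and> (\<forall>Y Z. Y \<subseteq> Z \<longrightarrow> m Y \<le> m Z) \<and>
     (\<forall>Y Z. m (Y \<union> Z) + m (Y \<inter> Z) \<le> m Y + m Z)"

lemma strongly_subadditiveD:
  assumes "strongly_subadditive S m"
  shows "0 \<le> m Y" "m {} = 0" "m S = 1" "Y \<subseteq> Z \<Longrightarrow> m Y \<le> m Z"
    "m (Y \<union> Z) + m (Y \<inter> Z) \<le> m Y + m Z"
  using assms unfolding strongly_subadditive_def by blast+

text \<open>The contraction of \<open>m\<close> by \<open>B\<close> plus the restriction of
  \<open>m\<close> to \<open>B\<close>. For \<open>B \<subseteq> S\<close> it keeps the value at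
  \<open>B\<close> and lowers that at \<open>S - B\<close> to the complementary value
  \<open>1 - m B\<close>; this is how the value of an extension at \<open>B\<close> gets
  prescribed.\<close>

definition shift :: "'a set \<Rightarrow> ('a set \<Rightarrow> real) \<Rightarrow> 'a set \<Rightarrow> real" where
  "shift B m Y = m (Y \<union> B) - m B + m (Y \<inter> B)"

lemma shift_le: "strongly_subadditive S m \<Longrightarrow> shift B m \<le> m"
  by (rule le_funI) (use strongly_subadditiveD(5)[of S m _ B] in \<open>simp add: shift_def algebra_simps\<close>)

lemma strongly_subadditive_shift:
  assumes m: "strongly_subadditive S m" and "B \<subseteq> S"
  shows "strongly_subadditive S (shift B m)"
proof -
  note D = strongly_subadditiveD[OF m]
  have "0 \<le> shift B m Y" for Y
    using D(4)[of B "Y \<union> B"] D(1)[of "Y \<inter> B"] by (simp add: shift_def)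
  moreover have "shift B m S = 1"
    using \<open>B \<subseteq> S\<close> D(3) by (simp add: shift_def Un_absorb2 Int_absorb1)
  moreover have "shift B m Y \<le> shift B m Z" if "Y \<subseteq> Z" for Y Z
    using D(4)[OF Un_mono[OF that order_refl], of B] D(4)[OF Int_mono[OF that order_refl], of B]
    by (simp add: shift_def)
  moreover have "shift B m (Y \<union> Z) + shift B m (Y \<inter> Z) \<le> shift B m Y + shift B m Z" for Y Z
  proof -
    have eq: "Y \<union> Z \<union> B = (Y \<union> B) \<union> (Z \<union> B)" "Y \<inter> Z \<union> B = (Y \<union> B) \<inter> (Z \<union> B)"
      "(Y \<union> Z) \<inter> B = (Y \<inter> B) \<union> (Z \<inter> B)" "Y \<inter> Z \<inter> B = (Y \<inter> B) \<inter> (Z \<inter> B)" by auto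
    then show ?thesis
      using D(5)[of "Y \<union> B" "Z \<union> B"] D(5)[of "Y \<inter> B" "Z \<inter> B"] unfolding shift_def eq by linarith
  qed
  ultimately show ?thesis by (simp add: strongly_subadditive_def shift_def D(2))
qed

lemma strongly_subadditive_chain:
  assumes C: "C \<noteq> {}" "\<And>m. m \<in> C \<Longrightarrow> strongly_subadditive S m"
    and chain: "\<And>m m'. m \<in> C \<Longrightarrow> m' \<in> C \<Longrightarrow> m \<le> m' \<or> m' \<le> m"
  shows "strongly_subadditive S (\<lambda>Y. INF m\<in>C. m Y)"
proof -
  define u where "u Y = (INF m\<in>C. m Y)" for Y
  note D = strongly_subadditiveD[OF C(2)]
  have bdd: "bdd_below ((\<lambda>m. m Y) ` C)" for Y
    using D(1) by (intro bdd_belowI[of _ 0]) auto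
  have low: "u Y \<le> m Y" if "m \<in> C" for m Y
    unfolding u_def by (rule cINF_lower[OF bdd that])
  have great: "r \<le> u Y" if "\<And>m. m \<in> C \<Longrightarrow> r \<le> m Y" for r Y
    unfolding u_def by (rule cINF_greatest[OF C(1) that])
  have "u Y = c" if "\<And>m. m \<in> C \<Longrightarrow> m Y = c" for Y c
  proof -
    have "(\<lambda>m. m Y) ` C = {c}" using C(1) that by auto
    then show ?thesis by (simp add: u_def)
  qed
  then have "u {} = 0" "u S = 1" using D(2,3) by auto
  moreover have "0 \<le> u Y" for Y using D(1) by (intro great)
  moreover have "u Y \<le> u Z" if "Y \<subseteq> Z" for Y Z
    by (intro great) (use low D(4) that order_trans in blast)
  moreover have "u (Y \<union> Z) + u (Y \<inter> Z) \<le> u Y + u Z" for Y Z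
  proof -
    \<comment> \<open>The infima at \<open>Y\<close> and \<open>Z\<close> may be approached along
      different members of the chain; submodularity is applied to a member below both.\<close>
    have *: "u (Y \<union> Z) + u (Y \<inter> Z) \<le> c1 Y + c2 Z" if c: "c1 \<in> C" "c2 \<in> C" for c1 c2
    proof -
      obtain c where "c \<in> C" "c \<le> c1" "c \<le> c2" using chain[OF c] c by blast
      then show ?thesis
        using low[of c "Y \<union> Z"] low[of c "Y \<inter> Z"] D(5)[of c Y Z] le_funD[of c c1 Y] le_funD[of c c2 Z]
        by linarith
    qed
    have "u (Y \<union> Z) + u (Y \<inter> Z) - c1 Y \<le> u Z" if "c1 \<in> C" for c1
      by (intro great) (use *[OF that] in \<open>simp add: algebra_simps\<close>)
    then have "u (Y \<union> Z) + u (Y \<inter> Z) - u Z \<le> u Y"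
      by (intro great) (simp add: algebra_simps)
    then show ?thesis by simp
  qed
  ultimately show ?thesis unfolding strongly_subadditive_def u_def by blast
qed

text \<open>A set function that is minimal among the strongly subadditive ones coincides with all of its
  shifts, which says that it is modular.\<close>

lemma additive_below:
  assumes m: "strongly_subadditive S m"
  obtains \<nu> where "strongly_subadditive S \<nu>" "\<nu> \<le> m"
    "\<And>Y B. B \<subseteq> S \<Longrightarrow> \<nu> (Y \<union> B) + \<nu> (Y \<inter> B) = \<nu> Y + \<nu> B"
proof -
  define A where "A = {m'. strongly_subadditive S m' \<and> m' \<le> m}"
  have "\<exists>\<nu>\<in>A. \<forall>a\<in>A. \<nu> \<ge> a \<longrightarrow> a = \<nu>"
  \<comment> \<open>Zorn is used for the reversed order, so that its maximal element is a minimal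
    set function and the bound of a chain is its pointwise infimum.\<close>
  proof (rule predicate_Zorn)
    show "partial_order_on A (relation_of (\<ge>) A)"
      by (rule partial_order_on_relation_ofI) auto
    fix C assume C: "C \<in> Chains (relation_of (\<ge>) A)"
    then have CA: "C \<subseteq> A" and chain: "\<And>c c'. c \<in> C \<Longrightarrow> c' \<in> C \<Longrightarrow> c \<le> c' \<or> c' \<le> c"
      unfolding Chains_def relation_of_def by auto
    show "\<exists>u\<in>A. \<forall>a\<in>C. a \<ge> u"
    proof (cases "C = {}")
      case True
      then show ?thesis using m by (auto simp: A_def)
    next
      case False
      define u where "u Y = (INF c\<in>C. c Y)" for Y
      have ss: "strongly_subadditive S c" if "c \<in> C" for c using that CA by (auto simp: A_def)
      have "bdd_below ((\<lambda>c. c Y) ` C)" for Y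
        using strongly_subadditiveD(1)[OF ss] by (intro bdd_belowI[of _ 0]) auto
      then have low: "u \<le> c" if "c \<in> C" for c
        unfolding u_def by (intro le_funI cINF_lower that)
      moreover have "strongly_subadditive S u"
        using strongly_subadditive_chain[OF False ss chain] by (simp add: u_def[abs_def])
      moreover have "u \<le> m"
        using False CA low order_trans unfolding A_def by blast
      ultimately show ?thesis unfolding A_def by blast
    qed
  qed
  then obtain \<nu> where \<nu>: "strongly_subadditive S \<nu>" "\<nu> \<le> m"
    and min: "\<And>a. strongly_subadditive S a \<Longrightarrow> a \<le> \<nu> \<Longrightarrow> a = \<nu>"
    unfolding A_def by (auto dest: order_trans)
  have shift: "shift B \<nu> = \<nu>" if "B \<subseteq> S" for B
    by (rule min[OF strongly_subadditive_shift[OF \<nu>(1) that] shift_le[OF \<nu>(1)]])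
  have "\<nu> (Y \<union> B) + \<nu> (Y \<inter> B) = \<nu> Y + \<nu> B" if "B \<subseteq> S" for Y B
    using fun_cong[OF shift[OF that], of Y] by (simp add: shift_def)
  then show ?thesis by (rule that[OF \<nu>])
qed

text \<open>The algebra is a parameter because the smooth measure is considered on two of them: all
  definable subsets of \<open>S\<close>, and those definable over the small model, whose outer
  measure detects different extensions.\<close>

locale set_algebra_charge =
  fixes S :: "'a set" and \<A> :: "'a set set" and \<mu> :: "'a set \<Rightarrow> real"
  assumes top: "S \<in> \<A>"
    and sub: "A \<in> \<A> \<Longrightarrow> A \<subseteq> S"
    and Int: "A \<in> \<A> \<Longrightarrow> B \<in> \<A> \<Longrightarrow> A \<inter> B \<in> \<A>"
    and compl: "A \<in> \<A> \<Longrightarrow> S - A \<in> \<A>"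
    and nonneg: "A \<in> \<A> \<Longrightarrow> 0 \<le> \<mu> A"
    and total: "\<mu> S = 1"
    and add: "A \<in> \<A> \<Longrightarrow> B \<in> \<A> \<Longrightarrow> A \<inter> B = {} \<Longrightarrow> \<mu> (A \<union> B) = \<mu> A + \<mu> B"
begin

lemma Un: "A \<in> \<A> \<Longrightarrow> B \<in> \<A> \<Longrightarrow> A \<union> B \<in> \<A>"
proof -
  assume A: "A \<in> \<A>" "B \<in> \<A>"
  have "A \<union> B = S - (S - A) \<inter> (S - B)" using A[THEN sub] by auto
  then show ?thesis using A Int compl by metis
qed

lemma Diff: "A \<in> \<A> \<Longrightarrow> B \<in> \<A> \<Longrightarrow> A - B \<in> \<A>"
proof -
  assume A: "A \<in> \<A>" "B \<in> \<A>"
  have "A - B = A \<inter> (S - B)" using A[THEN sub] by auto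
  then show ?thesis using A Int compl by metis
qed

lemma empty: "{} \<in> \<A>"
  using compl[OF top] by simp

lemma measure_split: "A \<in> \<A> \<Longrightarrow> B \<in> \<A> \<Longrightarrow> \<mu> A = \<mu> (A \<inter> B) + \<mu> (A - B)"
  using add[OF Int Diff, of A B A B] by (simp add: Int_Diff_Un Int_Diff_disjoint)

lemma measure_empty: "\<mu> {} = 0"
  using measure_split[OF empty empty] by simp

lemma measure_mono: "A \<in> \<A> \<Longrightarrow> B \<in> \<A> \<Longrightarrow> A \<subseteq> B \<Longrightarrow> \<mu> A \<le> \<mu> B"
  using measure_split[of B A] nonneg[OF Diff, of B A] by (simp add: Int_absorb1)

lemma measure_Diff: "A \<in> \<A> \<Longrightarrow> B \<in> \<A> \<Longrightarrow> A \<subseteq> B \<Longrightarrow> \<mu> (B - A) = \<mu> B - \<mu> A"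
  using measure_split[of B A] by (simp add: Int_absorb1)

lemma measure_modular: "A \<in> \<A> \<Longrightarrow> B \<in> \<A> \<Longrightarrow> \<mu> (A \<union> B) + \<mu> (A \<inter> B) = \<mu> A + \<mu> B"
  using measure_split[of A B] add[OF Diff, of A B B] by auto

lemma measure_Un_le: "A \<in> \<A> \<Longrightarrow> B \<in> \<A> \<Longrightarrow> \<mu> (A \<union> B) \<le> \<mu> A + \<mu> B"
  using measure_modular[of A B] nonneg[OF Int, of A B] by auto

lemma UN_in: "finite I \<Longrightarrow> (\<And>i. i \<in> I \<Longrightarrow> A i \<in> \<A>) \<Longrightarrow> (\<Union>i\<in>I. A i) \<in> \<A>"
  by (induction I rule: finite_induct) (auto simp: empty Un)

lemma measure_UN_le:
  "finite I \<Longrightarrow> (\<And>i. i \<in> I \<Longrightarrow> A i \<in> \<A>) \<Longrightarrow> \<mu> (\<Union>i\<in>I. A i) \<le> (\<Sum>i\<in>I. \<mu> (A i))"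
proof (induction I rule: finite_induct)
  case empty
  then show ?case by (simp add: measure_empty)
next
  case (insert i I)
  then show ?case using measure_Un_le[of "A i" "\<Union>i\<in>I. A i"] UN_in[of I A] by simp
qed

lemma measure_UN_disjoint:
  "finite I \<Longrightarrow> (\<And>i. i \<in> I \<Longrightarrow> A i \<in> \<A>) \<Longrightarrow> (\<And>i j. i \<in> I \<Longrightarrow> j \<in> I \<Longrightarrow> i \<noteq> j \<Longrightarrow> A i \<inter> A j = {})
    \<Longrightarrow> \<mu> (\<Union>i\<in>I. A i) = (\<Sum>i\<in>I. \<mu> (A i))"
proof (induction I rule: finite_induct)
  case empty
  then show ?case by (simp add: measure_empty)
next
  case (insert i I)
  have "A i \<inter> (\<Union>i\<in>I. A i) = {}" using insert.hyps insert.prems(2)[of i] by (fastforce simp: disjoint_iff)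
  then show ?case using insert add[of "A i" "\<Union>i\<in>I. A i"] UN_in[of I A] by simp
qed

text \<open>The intersection with \<open>S\<close> gives a meaningful value at every set of the
  type, as \<open>strongly_subadditive\<close> demands; \<open>S\<close> itself is always among the
  covers.\<close>

definition outer :: "'a set \<Rightarrow> real" where
  "outer Y = Inf (\<mu> ` {W \<in> \<A>. Y \<inter> S \<subseteq> W})"

lemma outer_le: "W \<in> \<A> \<Longrightarrow> Y \<inter> S \<subseteq> W \<Longrightarrow> outer Y \<le> \<mu> W"
  unfolding outer_def by (rule cInf_lower) (auto intro!: bdd_belowI[of _ 0] nonneg)

lemma outer_ge: "(\<And>W. W \<in> \<A> \<Longrightarrow> Y \<inter> S \<subseteq> W \<Longrightarrow> r \<le> \<mu> W) \<Longrightarrow> r \<le> outer Y"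
  unfolding outer_def by (rule cInf_greatest) (use top in auto)

lemma outer_approx:
  assumes "0 < e"
  obtains W where "W \<in> \<A>" "Y \<inter> S \<subseteq> W" "\<mu> W < outer Y + e"
  using outer_ge[of Y "outer Y + e"] assms by force

lemma strongly_subadditive_outer: "strongly_subadditive S outer"
proof -
  have "0 \<le> outer Y" for Y by (intro outer_ge nonneg)
  moreover have "outer {} = 0"
    using outer_le[OF empty, of "{}"] calculation[of "{}"] measure_empty by simp
  moreover have "outer S = 1"
    using outer_le[OF top, of S] outer_ge[of S 1] sub total by force
  moreover have "outer Y \<le> outer Z" if "Y \<subseteq> Z" for Y Z
    by (intro outer_ge outer_le) (use that in auto)
  moreover have "outer (Y \<union> Z) + outer (Y \<inter> Z) \<le> outer Y + outer Z" for Y Z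
  proof (rule field_le_epsilon)
    fix e :: real assume e: "0 < e"
    obtain V where V: "V \<in> \<A>" "Y \<inter> S \<subseteq> V" "\<mu> V < outer Y + e / 2" using outer_approx[of "e / 2" Y] e by auto
    obtain W where W: "W \<in> \<A>" "Z \<inter> S \<subseteq> W" "\<mu> W < outer Z + e / 2" using outer_approx[of "e / 2" Z] e by auto
    have "outer (Y \<union> Z) \<le> \<mu> (V \<union> W)" "outer (Y \<inter> Z) \<le> \<mu> (V \<inter> W)"
      using V W by (auto intro!: outer_le Un Int)
    then show "outer (Y \<union> Z) + outer (Y \<inter> Z) \<le> outer Y + outer Z + e"
      using measure_modular[OF V(1) W(1)] V(3) W(3) by linarith
  qed
  ultimately show ?thesis unfolding strongly_subadditive_def by blast
qed

text \<open>An additive \<nu> is taken below \<open>shift X outer\<close> rather than below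
  \<open>outer\<close>. Then \<open>\<nu> X\<close> is at most \<open>outer X\<close> and
  \<open>\<nu> (S - X)\<close> at most \<open>1 - outer X\<close>; as the two values add up to 1,
  both bounds are attained. The same argument with a set of the algebra and its complement shows
  that \<nu> extends \<mu>.\<close>

theorem charge_extension:
  assumes "X \<subseteq> S"
  obtains \<nu> where "\<And>Y. 0 \<le> \<nu> Y" "\<nu> S = 1" "\<And>Y Z. Y \<subseteq> S \<Longrightarrow> Z \<subseteq> S \<Longrightarrow> Y \<inter> Z = {} \<Longrightarrow> \<nu> (Y \<union> Z) = \<nu> Y + \<nu> Z"
    "\<And>A. A \<in> \<A> \<Longrightarrow> \<nu> A = \<mu> A" "\<nu> X = outer X"
proof -
  note out = strongly_subadditive_outer
  obtain \<nu> where \<nu>: "strongly_subadditive S \<nu>" "\<nu> \<le> shift X outer"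
    and mod: "\<And>Y B. B \<subseteq> S \<Longrightarrow> \<nu> (Y \<union> B) + \<nu> (Y \<inter> B) = \<nu> Y + \<nu> B"
    using additive_below[OF strongly_subadditive_shift[OF out assms]] by blast
  note D = strongly_subadditiveD[OF \<nu>(1)]
  have le: "\<nu> Y \<le> shift X outer Y" for Y using \<nu>(2) by (simp add: le_fun_def)
  have add: "\<nu> (Y \<union> Z) = \<nu> Y + \<nu> Z" if "Z \<subseteq> S" "Y \<inter> Z = {}" for Y Z
    using mod[OF that(1), of Y] that(2) D(2) by simp
  have "\<nu> A = \<mu> A" if "A \<in> \<A>" for A
  proof -
    have le': "\<nu> B \<le> \<mu> B" if "B \<in> \<A>" for B
      using le[of B] le_funD[OF shift_le[OF out], of X B] outer_le[OF that, of B] by auto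
    have "\<nu> A + \<nu> (S - A) = 1" "\<mu> A + \<mu> (S - A) = 1"
      using add[of "S - A" A] measure_split[OF top that] sub[OF that] D(3) total
      by (auto simp: Un_absorb1 Int_absorb1)
    then show ?thesis using le'[OF that] le'[OF compl[OF that]] by linarith
  qed
  moreover have "\<nu> X = outer X"
  proof -
    have "\<nu> X + \<nu> (S - X) = 1" using add[of "S - X" X] assms D(3) by (auto simp: Un_absorb1)
    moreover have "shift X outer X = outer X" "shift X outer (S - X) = 1 - outer X"
      using strongly_subadditiveD(2,3)[OF out] assms
      by (auto simp: shift_def Un_absorb2 Un_absorb1 Int_commute[of _ X])
    ultimately show ?thesis using le[of X] le[of "S - X"] by simp
  qed
  ultimately show ?thesis using that[of \<nu>] D add by blast
qed

text \<open>One extension attains the outer measure of \<open>X\<close>, another that of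
  \<open>S - X\<close>. If every extension gives \<open>X\<close> the value \<open>c\<close>, the
  two outer measures add up to 1, and then a good cover of \<open>X\<close> and the complement of a
  good cover of \<open>S - X\<close> enclose \<open>X\<close> closely.\<close>

lemma unique_extension_sandwich:
  assumes unique: "\<And>\<nu>. \<lbrakk>\<And>Y. 0 \<le> \<nu> Y; \<nu> S = 1; \<And>Y Z. Y \<subseteq> S \<Longrightarrow> Z \<subseteq> S \<Longrightarrow> Y \<inter> Z = {} \<Longrightarrow> \<nu> (Y \<union> Z) = \<nu> Y + \<nu> Z;
      \<And>A. A \<in> \<A> \<Longrightarrow> \<nu> A = \<mu> A\<rbrakk> \<Longrightarrow> \<nu> X = c \<and> \<nu> (S - X) = 1 - c"
    and "X \<subseteq> S" "0 < e"
  obtains U W where "U \<in> \<A>" "W \<in> \<A>" "U \<subseteq> X" "X \<subseteq> W" "\<mu> W - \<mu> U < e"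
proof -
  have "outer X = c"
  proof -
    obtain \<nu> where "\<And>Y. 0 \<le> \<nu> Y" "\<nu> S = 1"
      "\<And>Y Z. Y \<subseteq> S \<Longrightarrow> Z \<subseteq> S \<Longrightarrow> Y \<inter> Z = {} \<Longrightarrow> \<nu> (Y \<union> Z) = \<nu> Y + \<nu> Z"
      "\<And>A. A \<in> \<A> \<Longrightarrow> \<nu> A = \<mu> A" "\<nu> X = outer X"
      using charge_extension[OF \<open>X \<subseteq> S\<close>] by blast
    then show ?thesis using unique[of \<nu>] by metis
  qed
  moreover have "outer (S - X) = 1 - c"
  proof -
    obtain \<nu> where "\<And>Y. 0 \<le> \<nu> Y" "\<nu> S = 1"
      "\<And>Y Z. Y \<subseteq> S \<Longrightarrow> Z \<subseteq> S \<Longrightarrow> Y \<inter> Z = {} \<Longrightarrow> \<nu> (Y \<union> Z) = \<nu> Y + \<nu> Z"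
      "\<And>A. A \<in> \<A> \<Longrightarrow> \<nu> A = \<mu> A" "\<nu> (S - X) = outer (S - X)"
      using charge_extension[of "S - X"] by blast
    then show ?thesis using unique[of \<nu>] by metis
  qed
  moreover obtain W where W: "W \<in> \<A>" "X \<inter> S \<subseteq> W" "\<mu> W < outer X + e / 2"
    using outer_approx[of "e / 2"] \<open>0 < e\<close> half_gt_zero by blast
  moreover obtain V where V: "V \<in> \<A>" "(S - X) \<inter> S \<subseteq> V" "\<mu> V < outer (S - X) + e / 2"
    using outer_approx[of "e / 2"] \<open>0 < e\<close> half_gt_zero by blast
  moreover have "\<mu> (S - V) = 1 - \<mu> V" using measure_Diff[OF V(1) top sub[OF V(1)]] total by simp
  ultimately show ?thesis
    using that[of "S - V" W] \<open>X \<subseteq> S\<close> compl[OF V(1)] by force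
qed

end

section \<open>Definable predicates\<close>

lemma finite_term_vars: "finite (term_vars t)"
  by (induction t) auto

lemma finite_free_vars: "finite (free_vars p)"
  by (induction p) (auto simp: finite_term_vars)

lemma eval_term_cong: "(\<And>i. i \<in> term_vars t \<Longrightarrow> v i = w i) \<Longrightarrow> eval_term M v t = eval_term M w t"
proof (induction t)
  case (App f ts)
  then have "map (eval_term M v) ts = map (eval_term M w) ts" by auto
  then show ?case by (simp only: eval_term.simps)
qed simp

lemma sat_cong: "(\<And>i. i \<in> free_vars p \<Longrightarrow> v i = w i) \<Longrightarrow> sat M v p \<longleftrightarrow> sat M w p"
proof (induction p arbitrary: v w)
  case (Eq s t)
  then show ?case using eval_term_cong[of s v w M] eval_term_cong[of t v w M] by auto
next
  case (Rel r ts)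
  then have "map (eval_term M v) ts = map (eval_term M w) ts" by (auto intro!: eval_term_cong)
  then show ?case by (simp only: sat.simps)
next
  case (Exists i p)
  have "sat M (v(i := a)) p \<longleftrightarrow> sat M (w(i := a)) p" for a
    by (rule Exists.IH) (use Exists.prems in auto)
  then show ?case by simp
next
  case (Conj p q)
  show ?case using Conj.IH(1)[of v w] Conj.IH(2)[of v w] Conj.prems by auto
next
  case (Neg p)
  show ?case using Neg.IH[of v w] Neg.prems by auto
qed

lemma rename_term:
  "wf_term L t \<Longrightarrow> \<exists>t'. wf_term L t' \<and> term_vars t' = f ` term_vars t \<and>
     (\<forall>v. eval_term M v t' = eval_term M (\<lambda>j. v (f j)) t)"
proof (induction t)
  case (Var i)
  show ?case by (rule exI[of _ "Var (f i)"]) simp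
next
  case (App g ts)
  then have "\<forall>t\<in>set ts. \<exists>t'. wf_term L t' \<and> term_vars t' = f ` term_vars t \<and>
     (\<forall>v. eval_term M v t' = eval_term M (\<lambda>j. v (f j)) t)" by auto
  then obtain h where h: "\<And>t. t \<in> set ts \<Longrightarrow> wf_term L (h t) \<and> term_vars (h t) = f ` term_vars t \<and>
     (\<forall>v. eval_term M v (h t) = eval_term M (\<lambda>j. v (f j)) t)" by metis
  have "map (eval_term M v) (map h ts) = map (eval_term M (\<lambda>j. v (f j))) ts" for v using h by simp
  then show ?case using h App.prems
    by (intro exI[of _ "App g (map h ts)"]) (auto simp del: map_map)
qed

text \<open>The map \<open>f\<close> may identify variables, as happens when several of them read
  the same entry of a tuple. A bound variable is therefore sent to a fresh one, outside the image of
  the free variables.\<close>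

lemma rename_formula:
  "wf_formula L p \<Longrightarrow> \<exists>q. wf_formula L q \<and> free_vars q = f ` free_vars p \<and>
     (\<forall>v. sat M v q \<longleftrightarrow> sat M (\<lambda>j. v (f j)) p)"
proof (induction p arbitrary: f)
  case (Eq s t)
  obtain s' t' where "wf_term L s'" "term_vars s' = f ` term_vars s" "\<And>v. eval_term M v s' = eval_term M (\<lambda>j. v (f j)) s"
    "wf_term L t'" "term_vars t' = f ` term_vars t" "\<And>v. eval_term M v t' = eval_term M (\<lambda>j. v (f j)) t"
    using rename_term[of L s f M] rename_term[of L t f M] Eq by auto
  then show ?case by (intro exI[of _ "Eq s' t'"]) auto
next
  case (Rel r ts)
  have "\<forall>t\<in>set ts. \<exists>t'. wf_term L t' \<and> term_vars t' = f ` term_vars t \<and>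
     (\<forall>v. eval_term M v t' = eval_term M (\<lambda>j. v (f j)) t)" using Rel by (auto intro!: rename_term)
  then obtain h where h: "\<And>t. t \<in> set ts \<Longrightarrow> wf_term L (h t) \<and> term_vars (h t) = f ` term_vars t \<and>
     (\<forall>v. eval_term M v (h t) = eval_term M (\<lambda>j. v (f j)) t)" by metis
  have "map (eval_term M v) (map h ts) = map (eval_term M (\<lambda>j. v (f j))) ts" for v using h by simp
  then show ?case using h Rel
    by (intro exI[of _ "Rel r (map h ts)"]) (auto simp del: map_map)
next
  case (Neg p)
  obtain q where "wf_formula L q" "free_vars q = f ` free_vars p" "\<And>v. sat M v q \<longleftrightarrow> sat M (\<lambda>j. v (f j)) p"
    using Neg.IH[of f] Neg.prems by auto
  then show ?case by (intro exI[of _ "Neg q"]) auto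
next
  case (Conj p1 p2)
  obtain q1 where "wf_formula L q1" "free_vars q1 = f ` free_vars p1" "\<And>v. sat M v q1 \<longleftrightarrow> sat M (\<lambda>j. v (f j)) p1"
    using Conj.IH(1)[of f] Conj.prems by auto
  moreover obtain q2 where "wf_formula L q2" "free_vars q2 = f ` free_vars p2" "\<And>v. sat M v q2 \<longleftrightarrow> sat M (\<lambda>j. v (f j)) p2"
    using Conj.IH(2)[of f] Conj.prems by auto
  ultimately show ?case by (intro exI[of _ "Conj q1 q2"]) auto
next
  case (Exists i p)
  obtain j where j: "j \<notin> f ` free_vars p"
    using finite_imageI[OF finite_free_vars] ex_new_if_finite infinite_UNIV_nat by metis
  obtain q where q: "wf_formula L q" "free_vars q = (f(i := j)) ` free_vars p"
    "\<And>v. sat M v q \<longleftrightarrow> sat M (\<lambda>k. v ((f(i := j)) k)) p"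
    using Exists.IH[of "f(i := j)"] Exists.prems by auto
  have "sat M (v(j := a)) q \<longleftrightarrow> sat M ((\<lambda>k. v (f k))(i := a)) p" for v a
    unfolding q(3) using j by (intro sat_cong) auto
  moreover have "free_vars (Exists j q) = f ` free_vars (Exists i p)" using j q(2) by auto
  ultimately show ?case using q(1) by (intro exI[of _ "Exists j q"]) auto
qed

fun block_exists :: "nat \<Rightarrow> ('f, 'r) formula \<Rightarrow> ('f, 'r) formula" where
  "block_exists 0 p = p"
| "block_exists (Suc m) p = Exists m (block_exists m p)"

lemma wf_block_exists: "wf_formula L (block_exists m p) \<longleftrightarrow> wf_formula L p"
  by (induction m) auto

lemma free_vars_block_exists: "free_vars (block_exists m p) = free_vars p - {..<m}"
proof (induction m)
  case 0
  show ?case by simp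
next
  case (Suc m)
  have "free_vars (block_exists (Suc m) p) = free_vars p - {..<m} - {m}" by (simp only: block_exists.simps free_vars.simps Suc)
  also have "\<dots> = free_vars p - {..<Suc m}" unfolding lessThan_Suc by blast
  finally show ?case .
qed

lemma sat_block_exists:
  "sat M v (block_exists m p) \<longleftrightarrow> (\<exists>xs\<in>tuples M m. sat M (\<lambda>j. if j < m then xs ! j else v j) p)"
proof (induction m arbitrary: v)
  case 0
  show ?case by (simp add: tuples_def)
next
  case (Suc m)
  have *: "(\<lambda>j. if j < m then xs ! j else (v(m := a)) j) = (\<lambda>j. if j < Suc m then (xs @ [a]) ! j else v j)"
    if "xs \<in> tuples M m" for xs a
    using that by (auto simp: tuples_def fun_eq_iff nth_append less_Suc_eq)
  have "tuples M (Suc m) = (\<lambda>(xs, a). xs @ [a]) ` (tuples M m \<times> universe M)"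
    by (force simp: tuples_def image_iff length_Suc_conv_rev)
  then show ?case using Suc * by auto
qed

text \<open>Tuples are assigned to blocks of variables: an environment \<open>e\<close> gives block \<open>k\<close> a tuple of
  length \<open>l k\<close>. A variable of a formula is interpreted by an entry of a block or by a parameter.\<close>

fun entry :: "(nat \<Rightarrow> 'a list) \<Rightarrow> nat \<times> nat + 'a \<Rightarrow> 'a" where
  "entry e (Inl (k, i)) = e k ! i"
| "entry e (Inr a) = a"

fun admissible :: "(nat \<Rightarrow> nat) \<Rightarrow> 'a set \<Rightarrow> nat \<times> nat + 'a \<Rightarrow> bool" where
  "admissible l A (Inl (k, i)) \<longleftrightarrow> i < l k"
| "admissible l A (Inr a) \<longleftrightarrow> a \<in> A"

lemma map_nth': "length xs = n \<Longrightarrow> map (\<lambda>i. xs ! i) [0..<n] = xs"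
  by (metis map_nth)

locale fo_structure =
  fixes L :: "('f, 'r) language" and M :: "('f, 'r, 'a) fo_struct"
  assumes struct: "is_struct L M"
begin

definition env :: "(nat \<Rightarrow> nat) \<Rightarrow> (nat \<Rightarrow> 'a list) set" where
  "env l = {e. \<forall>k. e k \<in> tuples M (l k)}"

text \<open>The naming \<open>s\<close> separates the numbering of the variables from the positions
  in the tuples, so that Boolean combinations and quantifiers can be formed without index arithmetic
  in later proofs. \<open>definable_overI\<close> returns to formulas with an explicit parameter
  tuple.\<close>

definition dfn :: "'a set \<Rightarrow> (nat \<Rightarrow> nat) \<Rightarrow> ((nat \<Rightarrow> 'a list) \<Rightarrow> bool) \<Rightarrow> bool" where
  "dfn A l P \<longleftrightarrow> (\<exists>p s. wf_formula L p \<and> (\<forall>j\<in>free_vars p. admissible l A (s j)) \<and>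
     (\<forall>e\<in>env l. P e \<longleftrightarrow> sat M (\<lambda>j. entry e (s j)) p))"

lemma env_length: "e \<in> env l \<Longrightarrow> length (e k) = l k"
  by (auto simp: env_def tuples_def)

lemma env_tuples: "e \<in> env l \<Longrightarrow> e k \<in> tuples M (l k)"
  by (auto simp: env_def)

lemma env_upd: "e \<in> env l \<Longrightarrow> x \<in> tuples M (l k) \<Longrightarrow> e(k := x) \<in> env l"
  by (auto simp: env_def)

lemma entry_universe:
  assumes "e \<in> env l" "A \<subseteq> universe M" "admissible l A x"
  shows "entry e x \<in> universe M"
proof (cases x)
  case (Inl ki)
  then obtain k i where x: "x = Inl (k, i)" by (cases ki) auto
  then have "e k ! i \<in> set (e k)" using assms(3) env_length[OF assms(1)] by simp
  moreover have "set (e k) \<subseteq> universe M" using assms(1) by (auto simp: env_def tuples_def)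
  ultimately show ?thesis using x by auto
qed (use assms in auto)

lemma dfn_cong: "dfn A l P \<Longrightarrow> (\<And>e. e \<in> env l \<Longrightarrow> Q e \<longleftrightarrow> P e) \<Longrightarrow> dfn A l Q"
  unfolding dfn_def by fastforce

lemma dfn_neg: "dfn A l P \<Longrightarrow> dfn A l (\<lambda>e. \<not> P e)"
proof -
  assume "dfn A l P"
  then obtain p s where "wf_formula L p" "\<forall>j\<in>free_vars p. admissible l A (s j)"
     "\<forall>e\<in>env l. P e \<longleftrightarrow> sat M (\<lambda>j. entry e (s j)) p" unfolding dfn_def by blast
  then show ?thesis unfolding dfn_def by (intro exI[of _ "Neg p"] exI[of _ s]) auto
qed

lemma dfn_conj:
  assumes "dfn A l P" "dfn A l Q"
  shows "dfn A l (\<lambda>e. P e \<and> Q e)"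
proof -
  obtain p s where p: "wf_formula L p" "\<forall>j\<in>free_vars p. admissible l A (s j)"
     "\<forall>e\<in>env l. P e \<longleftrightarrow> sat M (\<lambda>j. entry e (s j)) p" using assms(1) unfolding dfn_def by blast
  obtain q t where q: "wf_formula L q" "\<forall>j\<in>free_vars q. admissible l A (t j)"
     "\<forall>e\<in>env l. Q e \<longleftrightarrow> sat M (\<lambda>j. entry e (t j)) q" using assms(2) unfolding dfn_def by blast
  \<comment> \<open>The two namings may give one variable different meanings, so the variables of
    the formulas are first separated into even and odd ones.\<close>
  obtain p' where p': "wf_formula L p'" "free_vars p' = (\<lambda>j. 2 * j) ` free_vars p"
    "\<And>v. sat M v p' \<longleftrightarrow> sat M (\<lambda>j. v (2 * j)) p" using rename_formula[OF p(1)] by metis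
  obtain q' where q': "wf_formula L q'" "free_vars q' = (\<lambda>j. 2 * j + 1) ` free_vars q"
    "\<And>v. sat M v q' \<longleftrightarrow> sat M (\<lambda>j. v (2 * j + 1)) q" using rename_formula[OF q(1)] by metis
  define u where "u j = (if even j then s (j div 2) else t (j div 2))" for j
  have "u (2 * j) = s j" "u (2 * j + 1) = t j" for j by (auto simp: u_def)
  then show ?thesis using p q p' q' unfolding dfn_def
    by (intro exI[of _ "Conj p' q'"] exI[of _ u]) auto
qed

lemma dfn_imp: "dfn A l P \<Longrightarrow> dfn A l Q \<Longrightarrow> dfn A l (\<lambda>e. P e \<longrightarrow> Q e)"
  using dfn_neg[OF dfn_conj[OF _ dfn_neg], of A l P Q] by simp

lemma dfn_iff: "dfn A l P \<Longrightarrow> dfn A l Q \<Longrightarrow> dfn A l (\<lambda>e. P e \<longleftrightarrow> Q e)"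
  using dfn_conj[OF dfn_imp dfn_imp, of A l P Q Q P] by (simp add: iff_conv_conj_imp)

lemma dfn_True: "dfn A l (\<lambda>e. True)"
proof -
  obtain a where "a \<in> universe M" using struct by (auto simp: is_struct_def)
  then show ?thesis unfolding dfn_def
    by (intro exI[of _ "Exists 0 (Eq (Var 0) (Var 0))"]) auto
qed

lemma dfn_ex:
  assumes "dfn A l P"
  shows "dfn A l (\<lambda>e. \<exists>x\<in>tuples M (l k). P (e(k := x)))"
proof -
  obtain p s where p: "wf_formula L p" "\<forall>j\<in>free_vars p. admissible l A (s j)"
     "\<forall>e\<in>env l. P e \<longleftrightarrow> sat M (\<lambda>j. entry e (s j)) p" using assms unfolding dfn_def by blast
  \<comment> \<open>The entries of block \<open>k\<close> become the first \<open>l k\<close>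
    variables, the ones that \<open>block_exists\<close> binds; all other variables move past
    them.\<close>
  define f where "f j = (case s j of Inl (k', i) \<Rightarrow> if k' = k then i else l k + j | Inr a \<Rightarrow> l k + j)" for j
  define s' where "s' j = (if j < l k then Inl (k, j) else s (j - l k))" for j
  obtain q where q: "wf_formula L q" "free_vars q = f ` free_vars p" "\<And>v. sat M v q \<longleftrightarrow> sat M (\<lambda>j. v (f j)) p"
    using rename_formula[OF p(1)] by metis
  have s'f: "s' (f j) = s j" if "j \<in> free_vars p" for j
    using p(2) that by (auto simp: s'_def f_def split: sum.splits prod.splits)
  have "admissible l A (s' j)" if "j \<in> free_vars q" for j
    using that s'f p(2) q(2) by auto
  moreover have "P (e(k := x)) \<longleftrightarrow> sat M (\<lambda>j. if j < l k then x ! j else entry e (s' j)) q"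
    if "e \<in> env l" "x \<in> tuples M (l k)" for e x
  proof -
    have "entry (e(k := x)) (s j) = (if f j < l k then x ! f j else entry e (s' (f j)))"
      if "j \<in> free_vars p" for j
      using bspec[OF p(2) that] s'f[OF that] by (cases "s j") (auto simp: f_def)
    then show ?thesis
      using p(3) env_upd[OF that] unfolding q(3) by (auto intro!: sat_cong)
  qed
  ultimately show ?thesis using q(1)
    unfolding dfn_def
    by (intro exI[of _ "block_exists (l k) q"] exI[of _ s'])
      (auto simp: wf_block_exists free_vars_block_exists sat_block_exists)
qed

lemma dfn_subst:
  assumes "dfn A l P" "A \<subseteq> universe M" "\<And>k i. i < l k \<Longrightarrow> admissible l' A (\<sigma> k i)"
  shows "dfn A l' (\<lambda>e. P (\<lambda>k. map (\<lambda>i. entry e (\<sigma> k i)) [0..<l k]))"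
proof -
  obtain p s where p: "wf_formula L p" "\<forall>j\<in>free_vars p. admissible l A (s j)"
     "\<forall>e\<in>env l. P e \<longleftrightarrow> sat M (\<lambda>j. entry e (s j)) p" using assms(1) unfolding dfn_def by blast
  define s' where "s' j = (case s j of Inl (k, i) \<Rightarrow> \<sigma> k i | Inr a \<Rightarrow> Inr a)" for j
  have "admissible l' A (s' j)" if "j \<in> free_vars p" for j
    using p(2) that assms(3) by (auto simp: s'_def split: sum.splits)
  moreover have "P (\<lambda>k. map (\<lambda>i. entry e (\<sigma> k i)) [0..<l k]) \<longleftrightarrow> sat M (\<lambda>j. entry e (s' j)) p"
    if "e \<in> env l'" for e
  proof -
    have "(\<lambda>k. map (\<lambda>i. entry e (\<sigma> k i)) [0..<l k]) \<in> env l"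
      using entry_universe[OF that assms(2,3)] by (auto simp: env_def tuples_def)
    then have "P (\<lambda>k. map (\<lambda>i. entry e (\<sigma> k i)) [0..<l k]) \<longleftrightarrow>
        sat M (\<lambda>j. entry (\<lambda>k. map (\<lambda>i. entry e (\<sigma> k i)) [0..<l k]) (s j)) p" using p(3) by blast
    also have "\<dots> \<longleftrightarrow> sat M (\<lambda>j. entry e (s' j)) p"
      using p(2) by (intro sat_cong) (auto simp: s'_def split: sum.splits)
    finally show ?thesis .
  qed
  ultimately show ?thesis using p(1) unfolding dfn_def by blast
qed

lemma dfn_inst:
  assumes "dfn A l P" "A \<subseteq> universe M" "set b \<subseteq> A" "length b = l k"
  shows "dfn A l (\<lambda>e. P (e(k := b)))"
proof (rule dfn_cong)
  define \<sigma> where "\<sigma> k' i = (if k' = k then Inr (b ! i) else Inl (k', i) :: nat \<times> nat + 'a)" for k' i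
  show "dfn A l (\<lambda>e. P (\<lambda>k. map (\<lambda>i. entry e (\<sigma> k i)) [0..<l k]))"
    by (rule dfn_subst[OF assms(1,2)]) (use assms(3,4) in \<open>auto simp: \<sigma>_def\<close>)
  fix e assume "e \<in> env l"
  then have "(\<lambda>k. map (\<lambda>i. entry e (\<sigma> k i)) [0..<l k]) = e(k := b)"
    using assms(4) by (auto simp: \<sigma>_def fun_eq_iff map_nth' env_length)
  then show "P (e(k := b)) \<longleftrightarrow> P (\<lambda>k. map (\<lambda>i. entry e (\<sigma> k i)) [0..<l k])" by simp
qed

lemma dfn_atom:
  assumes "definable_over L M A n X" "A \<subseteq> universe M" "\<And>i. i < n \<Longrightarrow> admissible l A (\<sigma> i)"
  shows "dfn A l (\<lambda>e. map (\<lambda>i. entry e (\<sigma> i)) [0..<n] \<in> X)"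
proof -
  obtain c p where c: "set c \<subseteq> A" and p: "p \<in> formulas L (n + length c)" and X: "X = solutions M n p c"
    using assms(1) unfolding definable_over_def by blast
  define s where "s j = (if j < n then \<sigma> j else Inr (c ! (j - n)))" for j
  have fv: "free_vars p \<subseteq> {..<n + length c}" "wf_formula L p" using p by (auto simp: formulas_def)
  have "admissible l A (s j)" if "j \<in> free_vars p" for j
    using fv that c assms(3) by (auto simp: s_def subset_iff)
  moreover have "map (\<lambda>i. entry e (\<sigma> i)) [0..<n] \<in> X \<longleftrightarrow> sat M (\<lambda>j. entry e (s j)) p" if "e \<in> env l" for e
  proof -
    have "map (\<lambda>i. entry e (\<sigma> i)) [0..<n] \<in> tuples M n"
      using entry_universe[OF that assms(2,3)] by (auto simp: tuples_def)
    then have "map (\<lambda>i. entry e (\<sigma> i)) [0..<n] \<in> X \<longleftrightarrow> holds M p (map (\<lambda>i. entry e (\<sigma> i)) [0..<n] @ c)"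
      by (simp add: X solutions_def)
    also have "\<dots> \<longleftrightarrow> sat M (\<lambda>j. entry e (s j)) p"
      unfolding holds_def using fv by (intro sat_cong) (auto simp: s_def nth_append)
    finally show ?thesis .
  qed
  ultimately show ?thesis using fv(2) unfolding dfn_def by blast
qed

lemma dfn_mem:
  assumes "definable_over L M A (l k) X" "A \<subseteq> universe M"
  shows "dfn A l (\<lambda>e. e k \<in> X)"
  by (rule dfn_cong[OF dfn_atom[OF assms, of l "\<lambda>i. Inl (k, i)"]]) (auto simp: map_nth' env_length)

lemma dfn_mem2:
  assumes "definable_over L M A (l i + l j) X" "A \<subseteq> universe M"
  shows "dfn A l (\<lambda>e. e i @ e j \<in> X)"
proof (rule dfn_cong[OF dfn_atom[OF assms, of l "\<lambda>t. if t < l i then Inl (i, t) else Inl (j, t - l i)"]])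
  fix e assume e: "e \<in> env l"
  have "map (\<lambda>t. entry e (if t < l i then Inl (i, t) else Inl (j, t - l i))) [0..<l i + l j] = e i @ e j"
    by (rule nth_equalityI) (auto simp: env_length[OF e] nth_append)
  then show "e i @ e j \<in> X \<longleftrightarrow>
      map (\<lambda>t. entry e (if t < l i then Inl (i, t) else Inl (j, t - l i))) [0..<l i + l j] \<in> X" by simp
qed auto

lemma dfn_mem3:
  assumes "definable_over L M A (l i + l j + l k) X" "A \<subseteq> universe M"
  shows "dfn A l (\<lambda>e. e i @ e j @ e k \<in> X)"
proof -
  let ?\<sigma> = "\<lambda>t. if t < l i then Inl (i, t) else if t < l i + l j then Inl (j, t - l i)
      else Inl (k, t - (l i + l j)) :: nat \<times> nat + 'a"
  have "map (\<lambda>t. entry e (?\<sigma> t)) [0..<l i + l j + l k] = e i @ e j @ e k" if e: "e \<in> env l" for e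
    by (rule nth_equalityI) (auto simp: env_length[OF e] nth_append)
  then show ?thesis
    by (intro dfn_cong[OF dfn_atom[OF assms, of l ?\<sigma>]]) auto
qed

text \<open>Block \<open>k\<close> acts as the bound variable. The last assumption says that
  \<open>P\<close> reads this block only through its second argument.\<close>

lemma dfn_bex:
  assumes "dfn A l (\<lambda>e. e k \<in> X)" "dfn A l (\<lambda>e. P e (e k))" "X \<subseteq> tuples M (l k)"
    and "\<And>e x y. P (e(k := x)) y \<longleftrightarrow> P e y"
  shows "dfn A l (\<lambda>e. \<exists>x\<in>X. P e x)"
  by (rule dfn_cong[OF dfn_ex[OF dfn_conj[OF assms(1,2)], of k]]) (use assms(3,4) in auto)

lemma dfn_ball:
  assumes "dfn A l (\<lambda>e. e k \<in> X)" "dfn A l (\<lambda>e. P e (e k))" "X \<subseteq> tuples M (l k)"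
    and "\<And>e x y. P (e(k := x)) y \<longleftrightarrow> P e y"
  shows "dfn A l (\<lambda>e. \<forall>x\<in>X. P e x)"
proof -
  have "dfn A l (\<lambda>e. \<exists>x\<in>X. \<not> P e x)"
    by (rule dfn_bex[OF assms(1) _ assms(3)]) (auto intro: dfn_neg assms(2) simp: assms(4))
  then have "dfn A l (\<lambda>e. \<not> (\<exists>x\<in>X. \<not> P e x))" by (rule dfn_neg)
  then show ?thesis by simp
qed

lemma definable_overI:
  assumes "dfn A l (\<lambda>e. e k \<in> X)" "X \<subseteq> tuples M (l k)" "A \<subseteq> universe M" "A \<noteq> {}"
  shows "definable_over L M A (l k) X"
proof -
  obtain a where a: "a \<in> A" using assms(4) by blast
  obtain p s where p: "wf_formula L p" "\<forall>j\<in>free_vars p. admissible l A (s j)"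
     "\<forall>e\<in>env l. e k \<in> X \<longleftrightarrow> sat M (\<lambda>j. entry e (s j)) p" using assms(1) unfolding dfn_def by blast
  define n where "n = l k"
  define f where "f j = (case s j of Inl (k', i) \<Rightarrow> if k' = k then i else n + j | Inr a \<Rightarrow> n + j)" for j
  obtain K where K: "free_vars p \<subseteq> {..<K}"
    using finite_nat_bounded[OF finite_free_vars] by blast
  \<comment> \<open>One parameter slot is reserved for each variable below \<open>K\<close>, so that
    \<open>n + j\<close> is the position of variable \<open>j\<close>. Slots that carry no parameter
    from \<open>A\<close> are filled with \<open>a\<close>, which is where nonemptiness of
    \<open>A\<close> enters.\<close>
  define c where "c = map (\<lambda>j. case s j of Inr b \<Rightarrow> if b \<in> A then b else a | _ \<Rightarrow> a) [0..<K]"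
  obtain q where q: "wf_formula L q" "free_vars q = f ` free_vars p" "\<And>v. sat M v q \<longleftrightarrow> sat M (\<lambda>j. v (f j)) p"
    using rename_formula[OF p(1)] by metis
  have lc: "length c = K" by (simp add: c_def)
  have c: "set c \<subseteq> A" using a by (auto simp: c_def split: sum.splits)
  have "f j < n + length c" if "j \<in> free_vars p" for j
    using subsetD[OF K that] bspec[OF p(2) that]
    by (cases "s j") (auto simp: f_def lc n_def intro: trans_less_add1)
  then have "q \<in> formulas L (n + length c)" using q by (auto simp: formulas_def)
  moreover have "x \<in> X \<longleftrightarrow> holds M q (x @ c)" if x: "x \<in> tuples M n" for x
  proof -
    define e where "e = (\<lambda>k'. if k' = k then x else replicate (l k') a)"
    have e: "e \<in> env l" using x a assms(3) by (auto simp: e_def env_def tuples_def n_def)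
    have lx: "length x = n" using x by (simp add: tuples_def)
    have "entry e (s j) = (x @ c) ! f j \<and> f j < n + length c" if "j \<in> free_vars p" for j
      using subsetD[OF K that] bspec[OF p(2) that]
      by (cases "s j") (auto simp: f_def e_def nth_append lx c_def n_def intro: trans_less_add1)
    then have "sat M (\<lambda>j. entry e (s j)) p \<longleftrightarrow> holds M q (x @ c)"
      unfolding holds_def q(3) using lx by (intro sat_cong) auto
    then show ?thesis using p(3) e by (auto simp: e_def)
  qed
  ultimately have "X = solutions M n q c" using assms(2) by (auto simp: solutions_def n_def)
  then show ?thesis using c \<open>q \<in> _\<close> unfolding definable_over_def n_def by blast
qed

lemma definable_over_subset: "definable_over L M A n X \<Longrightarrow> X \<subseteq> tuples M n"
  by (auto simp: definable_over_def solutions_def)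

lemma definable_over_mono: "definable_over L M A n X \<Longrightarrow> A \<subseteq> B \<Longrightarrow> definable_over L M B n X"
  unfolding definable_over_def by blast

context
  fixes A :: "'a set"
  assumes A: "A \<subseteq> universe M" "A \<noteq> {}"
begin

lemma definable_over_Int:
  "definable_over L M A n X \<Longrightarrow> definable_over L M A n Y \<Longrightarrow> definable_over L M A n (X \<inter> Y)"
  using definable_overI[of A "\<lambda>_. n" 0 "X \<inter> Y"] dfn_conj[OF dfn_mem[of A "\<lambda>_. n" 0 X] dfn_mem[of A "\<lambda>_. n" 0 Y]]
    definable_over_subset[of A n X] A by auto

lemma definable_over_Diff:
  "definable_over L M A n X \<Longrightarrow> definable_over L M A n Y \<Longrightarrow> definable_over L M A n (X - Y)"
  using definable_overI[of A "\<lambda>_. n" 0 "X - Y"]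
    dfn_conj[OF dfn_mem[of A "\<lambda>_. n" 0 X] dfn_neg[OF dfn_mem[of A "\<lambda>_. n" 0 Y]]]
    definable_over_subset[of A n X] A by auto

lemma definable_over_tuples: "definable_over L M A n (tuples M n)"
  by (rule definable_overI[of A "\<lambda>_. n" 0, OF dfn_cong[OF dfn_True]])
    (use A in \<open>auto simp: env_def\<close>)

lemma definable_over_empty: "definable_over L M A n {}"
  using definable_over_Diff[OF definable_over_tuples definable_over_tuples] by simp

lemma definable_over_Un:
  assumes "definable_over L M A n X" "definable_over L M A n Y"
  shows "definable_over L M A n (X \<union> Y)"
proof -
  have "X \<union> Y = tuples M n - ((tuples M n - X) \<inter> (tuples M n - Y))"
    using assms[THEN definable_over_subset] by auto
  then show ?thesis using assms by (simp add: definable_over_Diff definable_over_Int definable_over_tuples)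
qed

lemma definable_over_INT:
  "finite I \<Longrightarrow> (\<And>i. i \<in> I \<Longrightarrow> definable_over L M A n (X i)) \<Longrightarrow>
     definable_over L M A n (tuples M n \<inter> (\<Inter>i\<in>I. X i))"
proof (induction I rule: finite_induct)
  case (insert i I)
  have "tuples M n \<inter> (\<Inter>i\<in>insert i I. X i) = X i \<inter> (tuples M n \<inter> (\<Inter>i\<in>I. X i))" by auto
  then show ?case using insert by (simp add: definable_over_Int)
qed (simp add: definable_over_tuples)

end

lemma universe_nonempty: "universe M \<noteq> {}"
  using struct by (auto simp: is_struct_def)

lemmas definable_Int = definable_over_Int[OF order_refl universe_nonempty]
  and definable_Un = definable_over_Un[OF order_refl universe_nonempty]
  and definable_Diff = definable_over_Diff[OF order_refl universe_nonempty]
  and definable_tuples = definable_over_tuples[OF order_refl universe_nonempty]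
  and definable_empty = definable_over_empty[OF order_refl universe_nonempty]
  and definable_INT = definable_over_INT[OF order_refl universe_nonempty]

lemma definableI: "dfn (universe M) l (\<lambda>e. e k \<in> X) \<Longrightarrow> X \<subseteq> tuples M (l k) \<Longrightarrow> definable L M (l k) X"
  using definable_overI universe_nonempty by blast

end

section \<open>Compactness in a saturated structure\<close>

locale large_saturated_structure = fo_structure L M
  for L :: "('f, 'r) language" and M :: "('f, 'r, 'a) fo_struct" +
  assumes saturated: "saturated L M" and large: "large L M"
begin

abbreviation symbols :: "(('f + 'r) + nat) set" where
  "symbols \<equiv> (fun_symbols L <+> rel_symbols L) <+> (UNIV :: nat set)"

lemma infinite_symbols: "infinite symbols"
  by simp

lemma Pow_symbols_lesspoll: "Pow symbols \<prec> universe M"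
  using large by (simp add: large_def)

lemma symbols_lesspoll: "symbols \<prec> universe M"
  by (rule lesspoll_trans[OF lesspoll_Pow_self Pow_symbols_lesspoll])

lemma uncountable_universe: "uncountable (universe M)"
proof
  assume "countable (universe M)"
  then have "universe M \<lesssim> (UNIV :: nat set)" by (auto simp: lepoll_def countable_def)
  also have "(UNIV :: nat set) \<lesssim> symbols" using infinite_symbols unfolding infinite_le_lepoll .
  also have "symbols \<prec> universe M" by (rule symbols_lesspoll)
  finally show False by simp
qed

lemma wf_formulas_lepoll_symbols: "{p. wf_formula L p} \<lesssim> symbols"
proof (rule wf_formulas_lepoll[OF infinite_symbols])
  show "fun_symbols L \<lesssim> symbols"
    unfolding lepoll_def by (rule exI[of _ "Inl \<circ> Inl"]) (auto simp: inj_on_def)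
  show "rel_symbols L \<lesssim> symbols"
    unfolding lepoll_def by (rule exI[of _ "Inl \<circ> Inr"]) (auto simp: inj_on_def)
qed

lemmas small_Times = Times_lesspoll[OF uncountable_universe, folded small_def]
  and small_Un = Un_lesspoll[OF uncountable_universe, folded small_def]
  and small_lists = lists_lesspoll[OF uncountable_universe, folded small_def]
  and small_image = image_lesspoll[OF uncountable_universe, folded small_def]
  and small_countable = countable_lesspoll_uncountable[OF uncountable_universe, folded small_def]
  and small_UN_countable = UN_countable_lesspoll[OF uncountable_universe, folded small_def]
  and small_Fpow = Fpow_lesspoll[OF uncountable_universe, folded small_def]

lemma small_lepoll: "A \<lesssim> B \<Longrightarrow> small M B \<Longrightarrow> small M A"
  unfolding small_def by (rule lesspoll_trans1)

lemma small_definable_over: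
  assumes "small M A"
  shows "small M {X. definable_over L M A n X}"
proof -
  have "{X. definable_over L M A n X} \<subseteq> (\<lambda>(p, c). solutions M n p c) ` ({p. wf_formula L p} \<times> lists A)"
    by (auto simp: definable_over_def formulas_def image_iff)
  moreover have "small M {p. wf_formula L p}"
    unfolding small_def by (rule lesspoll_trans1[OF wf_formulas_lepoll_symbols symbols_lesspoll])
  ultimately show ?thesis
    using small_lepoll[OF subset_image_lepoll small_Times[OF _ small_lists[OF assms]]] by blast
qed

lemma realize_1:
  fixes E :: "'i \<Rightarrow> 'a list set"
  assumes J: "small M J" and E: "\<And>j. j \<in> J \<Longrightarrow> definable L M 1 (E j)"
    and fip: "\<And>F. finite F \<Longrightarrow> F \<subseteq> J \<Longrightarrow> \<exists>x\<in>universe M. \<forall>j\<in>F. [x] \<in> E j"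
  shows "\<exists>x\<in>universe M. \<forall>j\<in>J. [x] \<in> E j"
proof -
  have "\<forall>j\<in>J. \<exists>c p. set c \<subseteq> universe M \<and> p \<in> formulas L (1 + length c) \<and> E j = solutions M 1 p c"
    using E by (auto simp: definable_over_def)
  then obtain c p where cp: "\<And>j. j \<in> J \<Longrightarrow> set (c j) \<subseteq> universe M \<and> p j \<in> formulas L (1 + length (c j)) \<and>
      E j = solutions M 1 (p j) (c j)" by metis
  define \<Phi> where "\<Phi> = (\<lambda>j. (p j, c j)) ` J"
  define A where "A = (\<Union>j\<in>J. set (c j))"
  have mem: "[x] \<in> E j \<longleftrightarrow> holds M (p j) ([x] @ c j)" if "x \<in> universe M" "j \<in> J" for x j
    using cp[OF that(2)] that(1) by (auto simp: solutions_def tuples_def)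
  have "A \<subseteq> universe M" "small M A"
    unfolding A_def using cp by (blast, intro small_UN_countable J countable_finite) auto
  moreover have "partial_type L M A \<Phi>"
    unfolding partial_type_def
  proof (intro conjI allI impI)
    show "\<forall>(p, c)\<in>\<Phi>. p \<in> formulas L (1 + length c) \<and> set c \<subseteq> A"
      using cp by (auto simp: \<Phi>_def A_def)
    fix \<Psi> assume "finite \<Psi> \<and> \<Psi> \<subseteq> \<Phi>"
    then obtain F where F: "finite F" "F \<subseteq> J" "\<Psi> = (\<lambda>j. (p j, c j)) ` F"
      unfolding \<Phi>_def by (auto elim: finite_subset_image[elim_format])
    then obtain x where "x \<in> universe M" "\<forall>j\<in>F. [x] \<in> E j" using fip by blast
    then show "\<exists>x\<in>universe M. \<forall>(p, c)\<in>\<Psi>. holds M p ([x] @ c)"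
      using F mem by (intro bexI[of _ x]) auto
  qed
  ultimately obtain x where "x \<in> universe M" "\<forall>(p, c)\<in>\<Phi>. holds M p ([x] @ c)"
    using saturated unfolding saturated_def by blast
  then show ?thesis using mem by (auto simp: \<Phi>_def)
qed

lemma definable_projection:
  assumes "definable L M (Suc m) X"
  shows "definable L M 1 {[x] |x. x \<in> universe M \<and> (\<exists>ys\<in>tuples M m. x # ys \<in> X)}" (is "definable L M 1 ?Y")
proof -
  define l where "l k = (if k = 0 then 1 else m)" for k :: nat
  have "dfn (universe M) l (\<lambda>e. e 0 @ e 1 \<in> X)"
    by (rule dfn_mem2) (use assms in \<open>auto simp: l_def\<close>)
  from dfn_ex[OF this, of 1] have "dfn (universe M) l (\<lambda>e. \<exists>ys\<in>tuples M m. e 0 @ ys \<in> X)"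
    by (simp add: l_def)
  then have "dfn (universe M) l (\<lambda>e. e 0 \<in> ?Y)"
  proof (rule dfn_cong)
    fix e assume "e \<in> env l"
    then have "e 0 \<in> tuples M 1" using env_tuples[of e l 0] by (simp add: l_def)
    then obtain x where "e 0 = [x]" "x \<in> universe M" by (auto simp: tuples_def length_Suc_conv)
    then show "e 0 \<in> ?Y \<longleftrightarrow> (\<exists>ys\<in>tuples M m. e 0 @ ys \<in> X)" by auto
  qed
  moreover have "?Y \<subseteq> tuples M (l 0)" by (auto simp: l_def tuples_def)
  ultimately have "definable L M (l 0) ?Y" by (rule definableI)
  then show ?thesis by (simp add: l_def)
qed

lemma definable_fibre:
  assumes "definable L M (Suc m) X" "a \<in> universe M"
  shows "definable L M m {ys \<in> tuples M m. a # ys \<in> X}"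
proof -
  define l where "l k = (if k = 0 then 1 else m)" for k :: nat
  have "dfn (universe M) l (\<lambda>e. e 0 @ e 1 \<in> X)"
    by (rule dfn_mem2) (use assms in \<open>auto simp: l_def\<close>)
  from dfn_inst[OF this, of "[a]" 0] have "dfn (universe M) l (\<lambda>e. a # e 1 \<in> X)"
    using assms(2) by (simp add: l_def)
  then have "dfn (universe M) l (\<lambda>e. e 1 \<in> {ys \<in> tuples M m. a # ys \<in> X})"
    by (rule dfn_cong) (auto simp: env_def l_def split: if_splits)
  from definableI[OF this] show ?thesis by (auto simp: l_def)
qed

text \<open>Saturation concerns a single variable, so coordinates are chosen one at a time. The
  first has to leave fibres that again have the finite intersection property; it is therefore taken
  from the projections of all finite intersections, and a small family has only few finite
  subfamilies.\<close>

lemma compactness_indexed: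
  fixes X :: "'i \<Rightarrow> 'a list set"
  assumes "small M I" "\<And>i. i \<in> I \<Longrightarrow> definable L M m (X i)"
    and "\<And>F. finite F \<Longrightarrow> F \<subseteq> I \<Longrightarrow> tuples M m \<inter> (\<Inter>i\<in>F. X i) \<noteq> {}"
  shows "tuples M m \<inter> (\<Inter>i\<in>I. X i) \<noteq> {}"
  using assms(2,3)
proof (induction m arbitrary: X)
  case 0
  have t: "tuples M 0 = {[]}" by (auto simp: tuples_def)
  have "[] \<in> X i" if "i \<in> I" for i using "0.prems"(2)[of "{i}"] that t by auto
  then show ?case using t by auto
next
  case (Suc m)
  define Y where "Y F = tuples M (Suc m) \<inter> (\<Inter>i\<in>F. X i)" for F
  define E where "E F = {[x] |x. x \<in> universe M \<and> (\<exists>ys\<in>tuples M m. x # ys \<in> Y F)}" for F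
  define J where "J = {F. finite F \<and> F \<subseteq> I}"
  have "\<exists>x\<in>universe M. \<forall>F\<in>J. [x] \<in> E F"
  proof (rule realize_1)
    show "small M J" unfolding J_def by (rule small_Fpow[OF assms(1)])
    show "definable L M 1 (E F)" if "F \<in> J" for F
      using that Suc.prems(1) unfolding E_def Y_def J_def
      by (intro definable_projection definable_INT) auto
    fix \<F> assume F: "finite \<F>" "\<F> \<subseteq> J"
    then have "finite (\<Union>\<F>)" "\<Union>\<F> \<subseteq> I" by (auto simp: J_def)
    then have "Y (\<Union>\<F>) \<noteq> {}" unfolding Y_def by (rule Suc.prems(2))
    then obtain z where z: "z \<in> Y (\<Union>\<F>)" by blast
    then obtain x ys where "z = x # ys" "x \<in> universe M" "ys \<in> tuples M m"
      by (cases z) (auto simp: Y_def tuples_def)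
    then show "\<exists>x\<in>universe M. \<forall>F\<in>\<F>. [x] \<in> E F"
      using z by (intro bexI[of _ x]) (auto simp: E_def Y_def)
  qed
  then obtain a where a: "a \<in> universe M" "\<And>F. finite F \<Longrightarrow> F \<subseteq> I \<Longrightarrow> [a] \<in> E F"
    by (auto simp: J_def)
  have "tuples M m \<inter> (\<Inter>i\<in>I. {ys \<in> tuples M m. a # ys \<in> X i}) \<noteq> {}"
  proof (rule Suc.IH)
    show "definable L M m {ys \<in> tuples M m. a # ys \<in> X i}" if "i \<in> I" for i
      by (rule definable_fibre[OF Suc.prems(1)[OF that] a(1)])
    fix F assume "finite F" "F \<subseteq> I"
    then show "tuples M m \<inter> (\<Inter>i\<in>F. {ys \<in> tuples M m. a # ys \<in> X i}) \<noteq> {}"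
      using a(2)[of F] by (auto simp: E_def Y_def)
  qed
  then obtain ys where "ys \<in> tuples M m" "\<forall>i\<in>I. a # ys \<in> X i" by auto
  then have "a # ys \<in> tuples M (Suc m) \<inter> (\<Inter>i\<in>I. X i)" using a(1) by (auto simp: tuples_def)
  then show ?case by blast
qed

lemma finite_subcover:
  fixes X :: "'i \<Rightarrow> 'a list set"
  assumes "small M I" "\<And>i. i \<in> I \<Longrightarrow> definable L M m (X i)" "definable L M m S" "S \<subseteq> (\<Union>i\<in>I. X i)"
  obtains F where "finite F" "F \<subseteq> I" "S \<subseteq> (\<Union>i\<in>F. X i)"
proof (rule ccontr)
  assume no: "\<not> thesis"
  have "tuples M m \<inter> (\<Inter>i\<in>I. S - X i) \<noteq> {}"
  proof (rule compactness_indexed[OF assms(1)])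
    show "definable L M m (S - X i)" if "i \<in> I" for i
      by (rule definable_Diff[OF assms(3) assms(2)[OF that]])
    fix F assume "finite F" "F \<subseteq> I"
    then have "\<not> S \<subseteq> (\<Union>i\<in>F. X i)" using no that by blast
    then show "tuples M m \<inter> (\<Inter>i\<in>F. S - X i) \<noteq> {}"
      using definable_over_subset[OF assms(3)] by auto
  qed
  \<comment> \<open>If \<open>I\<close> is empty, the intersection above is the set of all tuples
    and gives no contradiction; then \<open>S\<close> is empty and the empty subcover works.\<close>
  then show False
  proof (cases "I = {}")
    case True
    then show ?thesis using no that[of "{}"] assms(4) by auto
  qed (use assms(4) in blast)
qed

lemma compactness:
  assumes "small M \<D>" "\<And>D. D \<in> \<D> \<Longrightarrow> definable L M m D" "definable L M m E" "tuples M m \<inter> \<Inter>\<D> \<subseteq> E"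
  obtains \<F> where "finite \<F>" "\<F> \<subseteq> \<D>" "tuples M m \<inter> \<Inter>\<F> \<subseteq> E"
proof -
  have "tuples M m - E \<subseteq> (\<Union>D\<in>\<D>. tuples M m - D)" using assms(4) by blast
  then obtain \<F> where "finite \<F>" "\<F> \<subseteq> \<D>" "tuples M m - E \<subseteq> (\<Union>D\<in>\<F>. tuples M m - D)"
    using finite_subcover[OF assms(1), of m "\<lambda>D. tuples M m - D" "tuples M m - E"] assms(2,3)
      definable_Diff definable_tuples by metis
  then show ?thesis by (intro that[of \<F>]) auto
qed

lemma definable_Inter: "finite \<F> \<Longrightarrow> (\<And>D. D \<in> \<F> \<Longrightarrow> definable L M m D) \<Longrightarrow> definable L M m (tuples M m \<inter> \<Inter>\<F>)"
  using definable_INT[of \<F> m "\<lambda>D. D"] by simp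

lemma type_definableE:
  assumes "type_definable L M m Y"
  obtains \<D> where "small M \<D>" "\<And>D. D \<in> \<D> \<Longrightarrow> definable L M m D" "Y = tuples M m \<inter> \<Inter>\<D>"
  using assms unfolding type_definable_over_def by blast

lemma type_definableI:
  "small M \<D> \<Longrightarrow> (\<And>D. D \<in> \<D> \<Longrightarrow> definable L M m D) \<Longrightarrow> Y = tuples M m \<inter> \<Inter>\<D> \<Longrightarrow> type_definable L M m Y"
  unfolding type_definable_over_def by blast

lemma type_definable_Un:
  assumes "type_definable L M m X" "type_definable L M m Y"
  shows "type_definable L M m (X \<union> Y)"
proof -
  obtain \<D> where D: "small M \<D>" "\<And>D. D \<in> \<D> \<Longrightarrow> definable L M m D" "X = tuples M m \<inter> \<Inter>\<D>"
    using assms(1) by (rule type_definableE) blast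
  obtain \<E> where E: "small M \<E>" "\<And>E. E \<in> \<E> \<Longrightarrow> definable L M m E" "Y = tuples M m \<inter> \<Inter>\<E>"
    using assms(2) by (rule type_definableE) blast
  show ?thesis
  proof (rule type_definableI)
    show "small M ((\<lambda>(D, E). D \<union> E) ` (\<D> \<times> \<E>))" by (rule small_image[OF small_Times[OF D(1) E(1)]])
    show "X \<union> Y = tuples M m \<inter> \<Inter>((\<lambda>(D, E). D \<union> E) ` (\<D> \<times> \<E>))"
      unfolding D(3) E(3) by auto
  qed (use D E definable_Un in auto)
qed

lemma type_definable_separate:
  assumes X: "type_definable L M m X" and Y: "type_definable L M m Y" and "X \<inter> Y = {}"
  obtains D where "definable L M m D" "X \<subseteq> D" "D \<inter> Y = {}"
proof -
  obtain \<D> where D: "small M \<D>" "\<And>D. D \<in> \<D> \<Longrightarrow> definable L M m D" "X = tuples M m \<inter> \<Inter>\<D>"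
    using X by (rule type_definableE) blast
  obtain \<E> where E: "small M \<E>" "\<And>E. E \<in> \<E> \<Longrightarrow> definable L M m E" "Y = tuples M m \<inter> \<Inter>\<E>"
    using Y by (rule type_definableE) blast
  have def: "\<And>D. D \<in> \<D> \<union> \<E> \<Longrightarrow> definable L M m D" using D(2) E(2) by blast
  have "tuples M m \<inter> \<Inter>(\<D> \<union> \<E>) \<subseteq> {}" using D(3) E(3) assms(3) by blast
  then obtain \<F> where F: "finite \<F>" "\<F> \<subseteq> \<D> \<union> \<E>" "tuples M m \<inter> \<Inter>\<F> \<subseteq> {}"
    using compactness[OF small_Un[OF D(1) E(1)] def definable_empty] by blast
  show ?thesis
  proof (rule that)
    show "definable L M m (tuples M m \<inter> \<Inter>(\<F> \<inter> \<D>))"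
      by (rule definable_Inter) (use F(1) D(2) in auto)
    show "X \<subseteq> tuples M m \<inter> \<Inter>(\<F> \<inter> \<D>)" using D(3) by blast
    show "tuples M m \<inter> \<Inter>(\<F> \<inter> \<D>) \<inter> Y = {}" using E(3) F(2,3) by blast
  qed
qed

lemma definable_if_type_definable_Diff:
  assumes "definable L M m S" "type_definable L M m Y" "type_definable L M m (S - Y)" "Y \<subseteq> S"
  shows "definable L M m Y"
proof -
  obtain D where D: "definable L M m D" "Y \<subseteq> D" "D \<inter> (S - Y) = {}"
    using type_definable_separate[OF assms(2,3)] by blast
  then have "Y = S \<inter> D" using assms(4) by blast
  then show ?thesis using definable_Int[OF assms(1) D(1)] by simp
qed

end

section \<open>Smooth measures\<close>

context set_algebra_charge
begin

definition dst :: "'a set \<Rightarrow> 'a set \<Rightarrow> real" where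
  "dst A B = \<mu> ((A - B) \<union> (B - A))"

lemma dst_nonneg: "A \<in> \<A> \<Longrightarrow> B \<in> \<A> \<Longrightarrow> 0 \<le> dst A B"
  unfolding dst_def by (intro nonneg Un Diff)

lemma dst_same: "dst A A = 0"
  by (simp add: dst_def measure_empty)

lemma dst_sym: "dst A B = dst B A"
  by (simp add: dst_def Un_commute)

lemma dst_triangle:
  assumes "A \<in> \<A>" "B \<in> \<A>" "C \<in> \<A>"
  shows "dst A C \<le> dst A B + dst B C"
proof -
  have in_alg: "A - B \<union> (B - A) \<in> \<A>" "B - C \<union> (C - B) \<in> \<A>" "A - C \<union> (C - A) \<in> \<A>"
    using assms by (auto intro: Un Diff)
  have "dst A C \<le> \<mu> ((A - B \<union> (B - A)) \<union> (B - C \<union> (C - B)))"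
    unfolding dst_def by (rule measure_mono[OF in_alg(3) Un[OF in_alg(1,2)]]) auto
  also have "\<dots> \<le> dst A B + dst B C"
    unfolding dst_def by (rule measure_Un_le[OF in_alg(1,2)])
  finally show ?thesis .
qed

lemma dst_between:
  assumes "A \<in> \<A>" "B \<in> \<A>" "U \<in> \<A>" "W \<in> \<A>" "U \<subseteq> A" "A \<subseteq> W" "U \<subseteq> B" "B \<subseteq> W"
  shows "dst A B \<le> \<mu> W - \<mu> U"
proof -
  have "dst A B \<le> \<mu> (W - U)"
    unfolding dst_def using assms by (intro measure_mono Un Diff) auto
  also have "\<dots> = \<mu> W - \<mu> U" using assms by (intro measure_Diff) auto
  finally show ?thesis .
qed

lemma dst_disjoint: "A \<in> \<A> \<Longrightarrow> B \<in> \<A> \<Longrightarrow> A \<inter> B = {} \<Longrightarrow> dst A B = \<mu> A + \<mu> B"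
  by (simp add: dst_def Diff_triv Int_commute add)

end

context large_saturated_structure
begin

lemma keisler_charge:
  assumes "keisler_measure L M n S \<mu>" "definable_over L M A n S" "A \<subseteq> universe M" "A \<noteq> {}"
  shows "set_algebra_charge S {X. definable_over L M A n X \<and> X \<subseteq> S} \<mu>"
proof -
  have def: "definable L M n X" if "definable_over L M A n X" for X
    by (rule definable_over_mono[OF that assms(3)])
  show ?thesis
    using assms def definable_over_Int[OF assms(3,4)] definable_over_Diff[OF assms(3,4)]
    unfolding keisler_measure_def by unfold_locales auto
qed

end

locale smooth_measure = large_saturated_structure L M
  for L :: "('f, 'r) language" and M :: "('f, 'r, 'a) fo_struct" +
  fixes n :: nat and S :: "'a list set" and \<mu> :: "'a list set \<Rightarrow> real"
  assumes keisler: "keisler_measure L M n S \<mu>" and smooth: "smooth L M n S \<mu>"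
begin

definition Def :: "'a list set set" where
  "Def = {X. definable L M n X \<and> X \<subseteq> S}"

lemma DefI: "definable L M n X \<Longrightarrow> X \<subseteq> S \<Longrightarrow> X \<in> Def"
  by (simp add: Def_def)

lemma DefD: "X \<in> Def \<Longrightarrow> definable L M n X" "X \<in> Def \<Longrightarrow> X \<subseteq> S"
  by (simp_all add: Def_def)

lemma small_model_exists:
  obtains M0 where "small_model L M M0" "definable_over L M (universe M0) n S"
    "\<And>\<nu> X. keisler_measure L M n S \<nu> \<Longrightarrow> (\<And>X. definable_over L M (universe M0) n X \<Longrightarrow> X \<subseteq> S \<Longrightarrow> \<nu> X = \<mu> X) \<Longrightarrow>
       X \<in> Def \<Longrightarrow> \<nu> X = \<mu> X"
  using smooth unfolding smooth_def Def_def by blast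

lemma small_model_universe:
  assumes "small_model L M M0"
  shows "universe M0 \<subseteq> universe M" "universe M0 \<noteq> {}" "small M (universe M0)"
  using assms by (auto simp: small_model_def elementary_substruct_def is_struct_def)

lemma S_definable: "definable L M n S"
  using small_model_exists definable_over_mono small_model_universe(1) by metis

lemma S_tuples: "S \<subseteq> tuples M n"
  by (rule definable_over_subset[OF S_definable])

sublocale charge: set_algebra_charge S Def \<mu>
  unfolding Def_def by (rule keisler_charge[OF keisler S_definable order_refl universe_nonempty])

text \<open>Such a family is dense in \<open>Def\<close> for \<open>dst\<close>, so it suffices to
  test stabilizing on its members. Enclosure by both sets, rather than closeness alone, is what
  compactness needs: it is a first-order condition on the enclosed set.\<close>

definition approximating :: "'a list set set \<Rightarrow> bool" where
  "approximating \<C> \<longleftrightarrow> \<C> \<subseteq> Def \<and>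
     (\<forall>X\<in>Def. \<forall>e>0. \<exists>U\<in>\<C>. \<exists>W\<in>\<C>. U \<subseteq> X \<and> X \<subseteq> W \<and> \<mu> W - \<mu> U < e)"

lemma approximatingD:
  assumes "approximating \<C>"
  shows "\<C> \<subseteq> Def" "X \<in> Def \<Longrightarrow> 0 < e \<Longrightarrow> \<exists>U\<in>\<C>. \<exists>W\<in>\<C>. U \<subseteq> X \<and> X \<subseteq> W \<and> \<mu> W - \<mu> U < e"
  using assms by (simp_all add: approximating_def)

text \<open>The extension theorem yields charges on all subsets of \<open>S\<close>. These are in
  particular Keisler measures, so smoothness fixes their values at definable sets, and
  \<open>unique_extension_sandwich\<close> applies over the small model.\<close>

lemma sandwich_base:
  obtains \<A> where "small M \<A>" "approximating \<A>"
proof -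
  obtain M0 where M0: "small_model L M M0" "definable_over L M (universe M0) n S"
    and unique: "\<And>\<nu> X. keisler_measure L M n S \<nu> \<Longrightarrow> (\<And>X. definable_over L M (universe M0) n X \<Longrightarrow> X \<subseteq> S \<Longrightarrow> \<nu> X = \<mu> X) \<Longrightarrow>
       X \<in> Def \<Longrightarrow> \<nu> X = \<mu> X"
    using small_model_exists by blast
  note U0 = small_model_universe[OF M0(1)]
  define \<A> where "\<A> = {X. definable_over L M (universe M0) n X \<and> X \<subseteq> S}"
  interpret base: set_algebra_charge S \<A> \<mu>
    unfolding \<A>_def by (rule keisler_charge[OF keisler M0(2) U0(1,2)])
  have "\<A> \<subseteq> {X. definable_over L M (universe M0) n X}" by (auto simp: \<A>_def)
  then have "small M \<A>"
    using small_lepoll[OF subset_imp_lepoll] small_definable_over[OF U0(3)] by blast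
  moreover have "\<A> \<subseteq> Def" by (auto simp: \<A>_def Def_def intro: definable_over_mono[OF _ U0(1)])
  moreover have "\<exists>U\<in>\<A>. \<exists>W\<in>\<A>. U \<subseteq> X \<and> X \<subseteq> W \<and> \<mu> W - \<mu> U < e" if X: "X \<in> Def" and e: "0 < e" for X e
  proof -
    obtain U W where "U \<in> \<A>" "W \<in> \<A>" "U \<subseteq> X" "X \<subseteq> W" "\<mu> W - \<mu> U < e"
    proof (rule base.unique_extension_sandwich[of X "\<mu> X" e])
      fix \<nu> :: "'a list set \<Rightarrow> real"
      assume \<nu>: "\<And>Y. 0 \<le> \<nu> Y" "\<nu> S = 1"
        "\<And>Y Z. Y \<subseteq> S \<Longrightarrow> Z \<subseteq> S \<Longrightarrow> Y \<inter> Z = {} \<Longrightarrow> \<nu> (Y \<union> Z) = \<nu> Y + \<nu> Z"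
        "\<And>A. A \<in> \<A> \<Longrightarrow> \<nu> A = \<mu> A"
      have keis: "keisler_measure L M n S \<nu>" using \<nu>(1-3) by (simp add: keisler_measure_def)
      have "\<nu> Y = \<mu> Y" if "Y \<in> Def" for Y
        by (rule unique[OF keis _ that]) (simp add: \<nu>(4) \<A>_def)
      then show "\<nu> X = \<mu> X \<and> \<nu> (S - X) = 1 - \<mu> X"
        using X charge.compl[OF X] charge.measure_Diff[OF X charge.top charge.sub[OF X]] charge.total by simp
    next
      show "X \<subseteq> S" by (rule DefD(2)[OF X])
    qed (use e in auto)
    then show ?thesis by blast
  qed
  ultimately show ?thesis by (intro that[of \<A>]) (auto simp: approximating_def)
qed

text \<open>That a fixed pair \<open>U\<close>, \<open>W\<close> encloses the fibre over
  \<open>b\<close> is a definable condition on \<open>b\<close>. By \<open>sandwich_base\<close> a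
  small family of such conditions covers all \<open>b\<close>, so finitely many do. Their
  definability is part of the conclusion because later proofs partition the group by them; requiring
  \<open>U\<close> and \<open>W\<close> to be in \<open>Def\<close> inside the set keeps this true
  for arbitrary pairs.\<close>

lemma uniform_sandwich:
  assumes R: "dfn (universe M) l (\<lambda>e. R (e 0) (e 1))" and l: "l 0 = n" "l 1 = m"
    and sub: "\<forall>x b. R x b \<longrightarrow> x \<in> S" and "0 < \<epsilon>"
  obtains \<P> where "finite \<P>" "\<P> \<subseteq> {(U, W). U \<in> Def \<and> W \<in> Def \<and> \<mu> W - \<mu> U < \<epsilon>}"
    "\<And>U W. definable L M m {b \<in> tuples M m. U \<in> Def \<and> W \<in> Def \<and> U \<subseteq> {x. R x b} \<and> {x. R x b} \<subseteq> W}"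
    "\<And>b. b \<in> tuples M m \<Longrightarrow> \<exists>(U, W)\<in>\<P>. U \<subseteq> {x. R x b} \<and> {x. R x b} \<subseteq> W"
proof -
  obtain \<A> where "small M \<A>" "approximating \<A>"
    by (rule sandwich_base)
  note A = this(1) approximatingD[OF this(2)]
  have fib: "{x. R x b} \<in> Def" if b: "b \<in> tuples M m" for b
  proof (rule DefI)
    have "dfn (universe M) l (\<lambda>e. R (e 0) b)"
      using dfn_inst[OF R, of b 1] b l by (auto simp: tuples_def)
    then have "dfn (universe M) l (\<lambda>e. e 0 \<in> {x. R x b})" by simp
    from definableI[OF this] show "definable L M n {x. R x b}" using sub S_tuples l by auto
    show "{x. R x b} \<subseteq> S" using sub by auto
  qed
  define C where "C U W = {b \<in> tuples M m. U \<in> Def \<and> W \<in> Def \<and> U \<subseteq> {x. R x b} \<and> {x. R x b} \<subseteq> W}" for U W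
  have C: "definable L M m (C U W)" for U W
  proof (cases "U \<in> Def \<and> W \<in> Def")
    case True
    have UW: "definable L M (l 0) U" "definable L M (l 0) W" using True l by (auto simp: Def_def)
    have "dfn (universe M) l (\<lambda>e. \<forall>x\<in>tuples M n. (x \<in> U \<longrightarrow> R x (e 1)) \<and> (R x (e 1) \<longrightarrow> x \<in> W))"
      by (rule dfn_ball[where k = 0])
        (use l definable_tuples UW R in \<open>auto intro!: dfn_mem dfn_conj dfn_imp\<close>)
    then have "dfn (universe M) l (\<lambda>e. e 1 \<in> C U W)"
    proof (rule dfn_cong)
      fix e assume "e \<in> env l"
      then have "e 1 \<in> tuples M m" using env_tuples[of e l 1] l by simp
      moreover have "U \<subseteq> tuples M n" using True S_tuples DefD(2) by blast
      ultimately show "e 1 \<in> C U W \<longleftrightarrow> (\<forall>x\<in>tuples M n. (x \<in> U \<longrightarrow> R x (e 1)) \<and> (R x (e 1) \<longrightarrow> x \<in> W))"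
        using True sub S_tuples unfolding C_def by blast
    qed
    from definableI[OF this] show ?thesis using l by (auto simp: C_def)
  next
    case False
    then have "C U W = {}" by (auto simp: C_def)
    then show ?thesis by (simp add: definable_empty)
  qed
  define I where "I = {(U, W) \<in> \<A> \<times> \<A>. \<mu> W - \<mu> U < \<epsilon>}"
  have small_I: "small M I"
    by (rule small_lepoll[OF subset_imp_lepoll small_Times[OF A(1) A(1)]]) (auto simp: I_def)
  have cover: "tuples M m \<subseteq> (\<Union>i\<in>I. case_prod C i)"
  proof
    fix b assume b: "b \<in> tuples M m"
    then obtain U W where "U \<in> \<A>" "W \<in> \<A>" "U \<subseteq> {x. R x b}" "{x. R x b} \<subseteq> W" "\<mu> W - \<mu> U < \<epsilon>"
      using A(3)[OF fib[OF b] \<open>0 < \<epsilon>\<close>] by blast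
    then show "b \<in> (\<Union>i\<in>I. case_prod C i)"
      using b A(2) unfolding I_def C_def by (intro UN_I[of "(U, W)"]) auto
  qed
  have defC: "definable L M m (case_prod C i)" for i using C by (cases i) simp
  obtain \<P> where P: "finite \<P>" "\<P> \<subseteq> I" "tuples M m \<subseteq> (\<Union>i\<in>\<P>. case_prod C i)"
    by (rule finite_subcover[OF small_I defC definable_tuples cover])
  show ?thesis
  proof (rule that[OF P(1)])
    show "\<P> \<subseteq> {(U, W). U \<in> Def \<and> W \<in> Def \<and> \<mu> W - \<mu> U < \<epsilon>}" using P(2) A(2) by (auto simp: I_def)
    show "definable L M m {b \<in> tuples M m. U \<in> Def \<and> W \<in> Def \<and> U \<subseteq> {x. R x b} \<and> {x. R x b} \<subseteq> W}" for U W
      using C[of U W] by (simp add: C_def)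
    fix b assume "b \<in> tuples M m"
    then obtain i where "i \<in> \<P>" "b \<in> case_prod C i" using P(3) by blast
    then show "\<exists>(U, W)\<in>\<P>. U \<subseteq> {x. R x b} \<and> {x. R x b} \<subseteq> W"
      by (intro bexI[of _ i]) (auto simp: C_def)
  qed
qed

text \<open>The approximating sets can be chosen from a family no larger than the language, whatever the
  size of the small model witnessing smoothness. This is what bounds the index of the
  stabilizer below.\<close>

lemma symbols_sized_base:
  obtains \<C> where "\<C> \<lesssim> symbols" "approximating \<C>"
proof -
  \<comment> \<open>An index consists of a formula, the number of its parameters and an accuracy
    \<open>1 / real (Suc k)\<close>. Finitely many sandwiches serve all parameter tuples at once, so
    only formulas are counted and not parameters.\<close>
  define I where "I = {(p, m, k :: nat). p \<in> formulas L (n + m)}"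
  define good where "good = (\<lambda>(p, m, k) \<P>. finite \<P> \<and> \<P> \<subseteq> Def \<times> Def \<and>
    (\<forall>b\<in>tuples M m. \<exists>(U, W)\<in>\<P>. U \<subseteq> solutions M n p b \<inter> S \<and> solutions M n p b \<inter> S \<subseteq> W \<and>
       \<mu> W - \<mu> U < 1 / real (Suc k)))"
  have "\<exists>\<P>. good i \<P>" if iI: "i \<in> I" for i
  proof -
    obtain p m k where i: "i = (p, m, k)" "p \<in> formulas L (n + m)" using iI by (auto simp: I_def)
    define l where "l j = (if j = 0 then n else m)" for j :: nat
    define R where "R x b \<longleftrightarrow> x \<in> S \<and> x @ b \<in> solutions M (n + m) p []" for x b
    have "definable L M (n + m) (solutions M (n + m) p [])"
      unfolding definable_over_def by (intro exI[of _ "[]"] exI[of _ p]) (use i in auto)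
    then have "dfn (universe M) l (\<lambda>e. e 0 @ e 1 \<in> solutions M (n + m) p [])"
      by (intro dfn_mem2) (auto simp: l_def)
    moreover have "dfn (universe M) l (\<lambda>e. e 0 \<in> S)"
      using S_definable by (intro dfn_mem) (auto simp: l_def)
    ultimately have Rd: "dfn (universe M) l (\<lambda>e. R (e 0) (e 1))"
      unfolding R_def by (rule dfn_conj[rotated])
    have l: "l 0 = n" "l 1 = m" and sub: "\<forall>x b. R x b \<longrightarrow> x \<in> S" by (simp_all add: l_def R_def)
    have pos: "0 < 1 / real (Suc k)" by simp
    obtain \<P> where P: "finite \<P>" "\<P> \<subseteq> {(U, W). U \<in> Def \<and> W \<in> Def \<and> \<mu> W - \<mu> U < 1 / real (Suc k)}"
      "\<And>b. b \<in> tuples M m \<Longrightarrow> \<exists>(U, W)\<in>\<P>. U \<subseteq> {x. R x b} \<and> {x. R x b} \<subseteq> W"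
      by (rule uniform_sandwich[OF Rd l sub pos]) (rule that; assumption)
    have fibre: "{x. R x b} = solutions M n p b \<inter> S" if "b \<in> tuples M m" for b
      using that S_tuples by (auto simp: R_def solutions_def tuples_def)
    have "\<exists>(U, W)\<in>\<P>. U \<subseteq> solutions M n p b \<inter> S \<and> solutions M n p b \<inter> S \<subseteq> W \<and>
        \<mu> W - \<mu> U < 1 / real (Suc k)" if b: "b \<in> tuples M m" for b
    proof -
      obtain U W where "(U, W) \<in> \<P>" "U \<subseteq> {x. R x b}" "{x. R x b} \<subseteq> W" using P(3)[OF b] by blast
      then show ?thesis using P(2) fibre[OF b] by (intro bexI[of _ "(U, W)"]) auto
    qed
    moreover have "\<P> \<subseteq> Def \<times> Def" using P(2) by auto
    ultimately have "good i \<P>" using P(1) unfolding good_def i by simp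
    then show ?thesis by blast
  qed
  then obtain \<P> where P: "\<And>i. i \<in> I \<Longrightarrow> good i (\<P> i)" by metis
  define \<C> where "\<C> = (\<Union>i\<in>I. fst ` \<P> i \<union> snd ` \<P> i)"
  have fin: "finite (\<P> i)" "\<P> i \<subseteq> Def \<times> Def" if "i \<in> I" for i
    using P[OF that] by (auto simp: good_def split: prod.splits)
  show ?thesis
  proof (rule that)
    have nat: "(UNIV :: nat set) \<lesssim> symbols" using infinite_symbols unfolding infinite_le_lepoll .
    have "I \<subseteq> {p. wf_formula L p} \<times> (UNIV \<times> UNIV)" by (auto simp: I_def formulas_def)
    moreover have "{p. wf_formula L p} \<times> ((UNIV :: nat set) \<times> (UNIV :: nat set)) \<lesssim> symbols"
      by (rule Times_lepoll_infinite[OF infinite_symbols wf_formulas_lepoll_symbols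
            Times_lepoll_infinite[OF infinite_symbols nat nat]])
    ultimately have "I \<lesssim> symbols" by (rule lepoll_trans[OF subset_imp_lepoll])
    then show "\<C> \<lesssim> symbols" unfolding \<C>_def
      by (rule UN_lepoll_infinite[OF infinite_symbols])
        (rule finite_lepoll_infinite[OF infinite_symbols], use fin in auto)
    have "\<C> \<subseteq> Def" using fin by (fastforce simp: \<C>_def)
    moreover have "\<exists>U\<in>\<C>. \<exists>W\<in>\<C>. U \<subseteq> X \<and> X \<subseteq> W \<and> \<mu> W - \<mu> U < e" if X: "X \<in> Def" and e: "0 < e" for X e
    proof -
      obtain c p where c: "set c \<subseteq> universe M" "p \<in> formulas L (n + length c)" "X = solutions M n p c"
        using DefD(1)[OF X] unfolding definable_over_def by blast
      obtain k where k: "1 / real (Suc k) < e" using nat_approx_posE[OF e] by blast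
      have i: "(p, length c, k) \<in> I" using c by (simp add: I_def)
      have "c \<in> tuples M (length c)" using c by (simp add: tuples_def)
      then obtain U W where UW: "(U, W) \<in> \<P> (p, length c, k)" "U \<subseteq> X \<inter> S" "X \<inter> S \<subseteq> W"
        "\<mu> W - \<mu> U < 1 / real (Suc k)"
        using P[OF i] unfolding good_def c(3)[symmetric] by (fastforce simp: c(3))
      have "U \<in> \<C>" unfolding \<C>_def
        by (rule UN_I[OF i], rule UnI1, rule image_eqI[OF _ UW(1)]) simp
      moreover have "W \<in> \<C>" unfolding \<C>_def
        by (rule UN_I[OF i], rule UnI2, rule image_eqI[OF _ UW(1)]) simp
      ultimately show ?thesis
        using k DefD(2)[OF X] UW by (intro bexI[of _ U] bexI[of _ W]) auto
    qed
    ultimately show "approximating \<C>" by (simp add: approximating_def)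
  qed
qed

end

no_notation subset_mset (infix \<open><#\<close> 50)

section \<open>The stabilizer of a smooth invariant measure\<close>

locale smooth_definable_group = smooth_measure L M n "carrier G" \<mu>
  for L :: "('f, 'r) language" and M :: "('f, 'r, 'a) fo_struct" and n :: nat
    and G :: "'a list monoid" (structure) and \<mu> :: "'a list set \<Rightarrow> real" +
  assumes definable_group: "definable_group L M n G"
    and left_invariant: "left_invariant L M n G \<mu>"
begin

sublocale group G
  using definable_group by (simp add: definable_group_def)

lemma mem_l_coset: "x \<in> g <# A \<longleftrightarrow> (\<exists>a\<in>A. x = g \<otimes> a)"
  by (auto simp: l_coset_def)

lemma mem_l_coset_iff:
  assumes "g \<in> carrier G" "x \<in> carrier G" "A \<subseteq> carrier G"
  shows "x \<in> g <# A \<longleftrightarrow> inv g \<otimes> x \<in> A"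
proof
  assume "inv g \<otimes> x \<in> A"
  then show "x \<in> g <# A" using assms by (auto simp: mem_l_coset m_assoc[symmetric] intro!: bexI[of _ "inv g \<otimes> x"])
qed (use assms in \<open>auto simp: mem_l_coset m_assoc[symmetric] subset_iff\<close>)

lemma l_coset_inv_cancel: "g \<in> carrier G \<Longrightarrow> A \<subseteq> carrier G \<Longrightarrow> inv g <# (g <# A) = A"
  by (simp add: lcos_m_assoc lcos_mult_one)

lemma l_coset_Un: "g <# (A \<union> B) = (g <# A) \<union> (g <# B)"
  by (auto simp: mem_l_coset)

lemma l_coset_Diff:
  "g \<in> carrier G \<Longrightarrow> A \<subseteq> carrier G \<Longrightarrow> B \<subseteq> carrier G \<Longrightarrow> g <# (A - B) = (g <# A) - (g <# B)"
  by (fastforce simp: mem_l_coset subset_iff)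

section \<open>Definability and measure of translates\<close>

lemma carrier_tuples: "carrier G \<subseteq> tuples M n"
  by (rule S_tuples)

lemma Def_subset_tuples: "A \<in> Def \<Longrightarrow> A \<subseteq> tuples M n"
  using DefD(2) carrier_tuples by blast

lemma dfn_Def: "A \<in> Def \<Longrightarrow> l k = n \<Longrightarrow> dfn (universe M) l (\<lambda>e. e k \<in> A)"
  by (rule dfn_mem) (auto simp: Def_def)

text \<open>Only the graph of multiplication on the carrier is definable; outside it
  \<open>\<otimes>\<close> may take any values. This is the origin of the membership guards in the
  predicates below.\<close>

lemma dfn_mult:
  assumes "l i = n" "l j = n" "l k = n"
  shows "dfn (universe M) l (\<lambda>e. e i \<in> carrier G \<and> e j \<in> carrier G \<and> e k = e i \<otimes> e j)"
proof (rule dfn_cong)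
  let ?X = "{x @ y @ (x \<otimes> y) | x y. x \<in> carrier G \<and> y \<in> carrier G}"
  have "definable L M (l i + l j + l k) ?X"
    using definable_group assms by (simp add: definable_group_def)
  then show "dfn (universe M) l (\<lambda>e. e i @ e j @ e k \<in> ?X)" by (rule dfn_mem3) simp
  fix e assume e: "e \<in> env l"
  have "length x = n" if "x \<in> carrier G" for x using that carrier_tuples by (auto simp: tuples_def)
  then show "e i \<in> carrier G \<and> e j \<in> carrier G \<and> e k = e i \<otimes> e j \<longleftrightarrow> e i @ e j @ e k \<in> ?X"
    using env_length[OF e] assms by (auto, metis)
qed

abbreviation blocks :: "nat \<Rightarrow> nat" where
  "blocks \<equiv> \<lambda>_. n"

lemma dfn_translate:
  assumes B: "B \<in> Def"
  shows "dfn (universe M) blocks (\<lambda>e. e 1 \<in> carrier G \<and> e 0 \<in> e 1 <# B)"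
proof -
  have "dfn (universe M) blocks (\<lambda>e. \<exists>b\<in>B. e 1 \<in> carrier G \<and> b \<in> carrier G \<and> e 0 = e 1 \<otimes> b)"
    by (rule dfn_bex[where k = 2]) (use B dfn_Def dfn_mult Def_subset_tuples in auto)
  then show ?thesis
    by (rule dfn_cong) (use DefD(2)[OF B] in \<open>auto simp: mem_l_coset\<close>)
qed

lemma dfn_inv_translate:
  assumes X: "X \<in> Def"
  shows "dfn (universe M) blocks (\<lambda>e. e 0 \<in> carrier G \<and> e 1 \<in> carrier G \<and> e 1 \<otimes> e 0 \<in> X)"
proof -
  have "dfn (universe M) blocks (\<lambda>e. \<exists>z\<in>X. e 1 \<in> carrier G \<and> e 0 \<in> carrier G \<and> z = e 1 \<otimes> e 0)"
    by (rule dfn_bex[where k = 2]) (use X dfn_Def dfn_mult Def_subset_tuples in auto)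
  then show ?thesis by (rule dfn_cong) auto
qed

lemma translate_Def:
  assumes "g \<in> carrier G" "B \<in> Def"
  shows "g <# B \<in> Def"
proof (rule DefI)
  have "dfn (universe M) blocks (\<lambda>e. g \<in> carrier G \<and> e 0 \<in> g <# B)"
    using dfn_inst[OF dfn_translate[OF assms(2)], of g 1] assms(1) carrier_tuples by (auto simp: tuples_def)
  then have d: "dfn (universe M) blocks (\<lambda>e. e 0 \<in> g <# B)" using assms(1) by simp
  show sub: "g <# B \<subseteq> carrier G" by (rule l_coset_subset_G[OF DefD(2)[OF assms(2)] assms(1)])
  show "definable L M n (g <# B)" using definableI[OF d] sub carrier_tuples by auto
qed

lemma measure_translate: "g \<in> carrier G \<Longrightarrow> B \<in> Def \<Longrightarrow> \<mu> (g <# B) = \<mu> B"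
  using left_invariant by (simp add: left_invariant_def Def_def)

lemma dst_translate:
  assumes "g \<in> carrier G" "A \<in> Def" "B \<in> Def"
  shows "charge.dst (g <# A) (g <# B) = charge.dst A B"
proof -
  have "((g <# A) - (g <# B)) \<union> ((g <# B) - (g <# A)) = g <# (A - B \<union> (B - A))"
    using assms DefD(2) by (simp add: l_coset_Un l_coset_Diff)
  then show ?thesis
    using assms by (simp add: charge.dst_def measure_translate charge.Un charge.Diff)
qed

section \<open>The stabilizer as a type-definable normal subgroup\<close>

definition stabilizer :: "'a list set" where
  "stabilizer = {g \<in> carrier G. \<forall>B\<in>Def. charge.dst (g <# B) B = 0}"

lemma stabilizerD: "g \<in> stabilizer \<Longrightarrow> B \<in> Def \<Longrightarrow> charge.dst (g <# B) B = 0"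
  by (simp add: stabilizer_def)

lemma stabilizer_subset: "stabilizer \<subseteq> carrier G"
  by (auto simp: stabilizer_def)

lemma stabilizer_mult:
  assumes g: "g \<in> stabilizer" and h: "h \<in> stabilizer"
  shows "g \<otimes> h \<in> stabilizer"
proof -
  have G: "g \<in> carrier G" "h \<in> carrier G" using assms stabilizer_subset by auto
  have "charge.dst (g \<otimes> h <# B) B = 0" if B: "B \<in> Def" for B
  proof -
    note T = translate_Def[OF G(1) translate_Def[OF G(2) B]] translate_Def[OF G(1) B]
    have "charge.dst (g <# (h <# B)) B \<le> charge.dst (g <# (h <# B)) (g <# B) + charge.dst (g <# B) B"
      by (rule charge.dst_triangle[OF T B])
    also have "charge.dst (g <# (h <# B)) (g <# B) = charge.dst (h <# B) B"
      by (rule dst_translate[OF G(1) translate_Def[OF G(2) B] B])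
    finally have "charge.dst (g <# (h <# B)) B \<le> 0"
      using stabilizerD[OF g B] stabilizerD[OF h B] by simp
    then show ?thesis
      using charge.dst_nonneg[OF T(1) B] lcos_m_assoc[OF DefD(2)[OF B] G] by simp
  qed
  then show ?thesis using G by (simp add: stabilizer_def)
qed

lemma stabilizer_inv:
  assumes g: "g \<in> stabilizer"
  shows "inv g \<in> stabilizer"
proof -
  have G: "g \<in> carrier G" using g stabilizer_subset by auto
  have "charge.dst (inv g <# B) B = 0" if B: "B \<in> Def" for B
    using dst_translate[OF inv_closed[OF G] translate_Def[OF G B] B] stabilizerD[OF g B]
      l_coset_inv_cancel[OF G DefD(2)[OF B]] by (simp add: charge.dst_sym)
  then show ?thesis using G by (simp add: stabilizer_def)
qed

lemma subgroup_stabilizer: "subgroup stabilizer G"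
proof
  show "\<one> \<in> stabilizer"
    using lcos_mult_one DefD(2) by (auto simp: stabilizer_def charge.dst_same)
qed (use stabilizer_mult stabilizer_inv stabilizer_subset in auto)

text \<open>Conjugating by \<open>x\<close> amounts to testing \<open>h\<close> on the translate of
  \<open>B\<close> by \<open>inv x\<close>, which is again in \<open>Def\<close>, and translating
  the result back.\<close>

lemma normal_stabilizer: "stabilizer \<lhd> G"
  unfolding normal_inv_iff
proof (intro conjI ballI subgroup_stabilizer)
  fix x h assume x: "x \<in> carrier G" and h: "h \<in> stabilizer"
  have H: "h \<in> carrier G" using h stabilizer_subset by auto
  have "charge.dst (x \<otimes> h \<otimes> inv x <# B) B = 0" if B: "B \<in> Def" for B
  proof -
    have C: "inv x <# B \<in> Def" by (rule translate_Def[OF inv_closed[OF x] B])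
    have "x \<otimes> h \<otimes> inv x <# B = x <# (h <# (inv x <# B))"
      using lcos_m_assoc[OF DefD(2)[OF B]] lcos_m_assoc[OF DefD(2)[OF C]] x H by (simp add: m_assoc)
    moreover have "x <# (inv x <# B) = B"
      using l_coset_inv_cancel[of "inv x" B] x DefD(2)[OF B] by simp
    ultimately show ?thesis
      using dst_translate[OF x translate_Def[OF H C] C] stabilizerD[OF h C] by simp
  qed
  then show "x \<otimes> h \<otimes> inv x \<in> stabilizer" using x H by (simp add: stabilizer_def)
qed

text \<open>The elements that move \<open>B\<close> by less than \<open>e\<close> need not form a
  definable set. The classes of elements whose translates of \<open>B\<close> share a sandwich are
  definable, finitely many cover the group, and translates within one class are closer than
  \<open>e\<close>; \<open>Q\<close> is the union of the classes that meet the stabilizer.\<close>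

lemma stabilizer_approx:
  assumes B: "B \<in> Def" and "0 < e"
  obtains Q where "Q \<in> Def" "stabilizer \<subseteq> Q" "\<And>g. g \<in> Q \<Longrightarrow> charge.dst (g <# B) B < e"
proof -
  have sub: "\<forall>x g. g \<in> carrier G \<and> x \<in> g <# B \<longrightarrow> x \<in> carrier G"
    using l_coset_subset_G[OF DefD(2)[OF B]] by blast
  obtain \<P> where P: "finite \<P>" "\<P> \<subseteq> {(U, W). U \<in> Def \<and> W \<in> Def \<and> \<mu> W - \<mu> U < e}"
    "\<And>U W. definable L M n {g \<in> tuples M n. U \<in> Def \<and> W \<in> Def \<and>
        U \<subseteq> {x. g \<in> carrier G \<and> x \<in> g <# B} \<and> {x. g \<in> carrier G \<and> x \<in> g <# B} \<subseteq> W}"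
    "\<And>g. g \<in> tuples M n \<Longrightarrow>
        \<exists>(U, W)\<in>\<P>. U \<subseteq> {x. g \<in> carrier G \<and> x \<in> g <# B} \<and> {x. g \<in> carrier G \<and> x \<in> g <# B} \<subseteq> W"
    by (rule uniform_sandwich[OF dfn_translate[OF B] refl refl sub \<open>0 < e\<close>]) (rule that; assumption)
  define C where "C = (\<lambda>(U, W). {g \<in> carrier G. U \<subseteq> g <# B \<and> g <# B \<subseteq> W})"
  have C: "C i \<in> Def" if iP: "i \<in> \<P>" for i
  proof -
    obtain U W where i: "i = (U, W)" "U \<in> Def" "W \<in> Def" using iP P(2) by auto
    have "C i = carrier G \<inter> {g \<in> tuples M n. U \<in> Def \<and> W \<in> Def \<and>
        U \<subseteq> {x. g \<in> carrier G \<and> x \<in> g <# B} \<and> {x. g \<in> carrier G \<and> x \<in> g <# B} \<subseteq> W}"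
      using i carrier_tuples by (auto simp: C_def)
    then have "definable L M n (C i)" using definable_Int[OF S_definable P(3)[of U W]] by simp
    then show ?thesis by (rule DefI) (auto simp: C_def i)
  qed
  define Q where "Q = (\<Union>i\<in>{i \<in> \<P>. C i \<inter> stabilizer \<noteq> {}}. C i)"
  show ?thesis
  proof (rule that)
    show "Q \<in> Def" unfolding Q_def using P(1) C by (intro charge.UN_in) auto
    show "stabilizer \<subseteq> Q"
    proof
      fix g assume g: "g \<in> stabilizer"
      then have gG: "g \<in> carrier G" "g \<in> tuples M n" using stabilizer_subset carrier_tuples by auto
      obtain U W where UW: "(U, W) \<in> \<P>" "U \<subseteq> {x. g \<in> carrier G \<and> x \<in> g <# B}" "{x. g \<in> carrier G \<and> x \<in> g <# B} \<subseteq> W"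
        using P(4)[OF gG(2)] by blast
      then have "g \<in> C (U, W)" using gG by (auto simp: C_def)
      then show "g \<in> Q" unfolding Q_def using g UW(1) by blast
    qed
    fix g assume "g \<in> Q"
    then obtain i where i: "i \<in> \<P>" "C i \<inter> stabilizer \<noteq> {}" "g \<in> C i" by (auto simp: Q_def)
    then obtain s where s: "s \<in> stabilizer" "s \<in> C i" by blast
    obtain U W where UW: "i = (U, W)" "U \<in> Def" "W \<in> Def" "\<mu> W - \<mu> U < e" using i(1) P(2) by auto
    have T: "g <# B \<in> Def" "s <# B \<in> Def" using i(3) s(2) B translate_Def by (auto simp: C_def UW(1))
    have "charge.dst (g <# B) (s <# B) \<le> \<mu> W - \<mu> U"
      using i(3) s(2) by (intro charge.dst_between T UW) (auto simp: C_def UW(1))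
    moreover have "charge.dst (g <# B) B \<le> charge.dst (g <# B) (s <# B) + charge.dst (s <# B) B"
      by (rule charge.dst_triangle[OF T B])
    ultimately show "charge.dst (g <# B) B < e" using stabilizerD[OF s(1) B] UW(4) by simp
  qed
qed

lemma approx_zero:
  assumes "\<And>k. (x :: real) < c / real (Suc k)" "0 < c" "0 \<le> x"
  shows "x = 0"
proof (rule ccontr)
  assume "x \<noteq> 0"
  then have "0 < x / c" using assms(2,3) by simp
  then obtain k where "1 / real (Suc k) < x / c" using nat_approx_posE by blast
  then have "c / real (Suc k) < x" using assms(2) by (simp add: field_simps)
  then show False using assms(1)[of k] by simp
qed

text \<open>A definable \<open>B\<close> is close to some \<open>U\<close> in the family, and
  translation by \<open>g\<close> preserves this distance. Passing from \<open>g B\<close> through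
  \<open>g U\<close> and \<open>U\<close> to \<open>B\<close> costs the approximation error twice,
  whence the constant 2.\<close>

lemma in_stabilizerI:
  assumes g: "g \<in> carrier G" and app: "approximating \<C>"
    and zero: "\<And>B. B \<in> \<C> \<Longrightarrow> charge.dst (g <# B) B = 0"
  shows "g \<in> stabilizer"
proof -
  note \<C> = approximatingD[OF app]
  have "charge.dst (g <# B) B = 0" if B: "B \<in> Def" for B
  proof (rule approx_zero[of _ 2])
    fix k
    have "0 < 1 / real (Suc k)" by simp
    then obtain U W where UW: "U \<in> \<C>" "W \<in> \<C>" "U \<subseteq> B" "B \<subseteq> W" "\<mu> W - \<mu> U < 1 / real (Suc k)"
      using \<C>(2)[OF B] by blast
    have D: "U \<in> Def" "W \<in> Def" using UW \<C>(1) by auto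
    have UB: "charge.dst U B < 1 / real (Suc k)"
      using charge.dst_between[OF D(1) B D order_refl _ UW(3,4)] UW(3,4,5) by (auto dest: order_trans)
    note T = translate_Def[OF g B] translate_Def[OF g D(1)]
    have "charge.dst (g <# B) B \<le> charge.dst (g <# B) (g <# U) + charge.dst (g <# U) B"
      by (rule charge.dst_triangle[OF T B])
    also have "charge.dst (g <# U) B \<le> charge.dst (g <# U) U + charge.dst U B"
      by (rule charge.dst_triangle[OF T(2) D(1) B])
    also have "charge.dst (g <# B) (g <# U) = charge.dst U B"
      using dst_translate[OF g B D(1)] by (simp add: charge.dst_sym)
    finally show "charge.dst (g <# B) B < 2 / real (Suc k)" using UB zero[OF UW(1)] by simp
  qed (use charge.dst_nonneg[OF translate_Def[OF g B] B] in auto)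
  then show ?thesis using g by (simp add: stabilizer_def)
qed

text \<open>The definable neighbourhoods from \<open>stabilizer_approx\<close> are intersected over
  an approximating family and all accuracies; whatever survives fixes the family up to measure 0.
  The family being small, the intersection is a small one.\<close>

lemma type_definable_stabilizer: "type_definable L M n stabilizer"
proof -
  obtain \<C> where app: "\<C> \<lesssim> symbols" "approximating \<C>"
    by (rule symbols_sized_base)
  note C = app(1) approximatingD[OF app(2)]
  have "\<forall>i\<in>\<C> \<times> (UNIV :: nat set). \<exists>Q. Q \<in> Def \<and> stabilizer \<subseteq> Q \<and>
      (\<forall>g\<in>Q. charge.dst (g <# fst i) (fst i) < 1 / real (Suc (snd i)))"
  proof
    fix i assume "i \<in> \<C> \<times> (UNIV :: nat set)"
    then have "fst i \<in> Def" using C(2) by auto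
    moreover have "0 < 1 / real (Suc (snd i))" by simp
    ultimately obtain Q where "Q \<in> Def" "stabilizer \<subseteq> Q" "\<And>g. g \<in> Q \<Longrightarrow> charge.dst (g <# fst i) (fst i) < 1 / real (Suc (snd i))"
      by (rule stabilizer_approx) blast
    then show "\<exists>Q. Q \<in> Def \<and> stabilizer \<subseteq> Q \<and>
      (\<forall>g\<in>Q. charge.dst (g <# fst i) (fst i) < 1 / real (Suc (snd i)))" by blast
  qed
  then obtain Q where Q: "\<And>i. i \<in> \<C> \<times> UNIV \<Longrightarrow> Q i \<in> Def \<and> stabilizer \<subseteq> Q i \<and>
      (\<forall>g\<in>Q i. charge.dst (g <# fst i) (fst i) < 1 / real (Suc (snd i)))" by metis
  define \<D> where "\<D> = insert (carrier G) (Q ` (\<C> \<times> (UNIV :: nat set)))"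
  have small_C: "small M \<C>"
    unfolding small_def by (rule lesspoll_trans1[OF C(1) symbols_lesspoll])
  have small_D: "small M \<D>"
    using small_Un[OF small_countable[of "{carrier G}"] small_image[OF small_Times[OF small_C small_countable[of "UNIV :: nat set"]], of Q]]
    by (simp add: \<D>_def)
  show ?thesis
  proof (rule type_definableI[OF small_D])
    show "definable L M n D" if "D \<in> \<D>" for D
      using that Q DefD(1) S_definable unfolding \<D>_def by blast
    show "stabilizer = tuples M n \<inter> \<Inter>\<D>"
    proof
      show "stabilizer \<subseteq> tuples M n \<inter> \<Inter>\<D>"
        using Q stabilizer_subset carrier_tuples unfolding \<D>_def by blast
      show "tuples M n \<inter> \<Inter>\<D> \<subseteq> stabilizer"
      proof
        fix g assume g: "g \<in> tuples M n \<inter> \<Inter>\<D>"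
        then have gG: "g \<in> carrier G" by (auto simp: \<D>_def)
        have zero: "charge.dst (g <# B) B = 0" if B: "B \<in> \<C>" for B
        proof (rule approx_zero[of _ 1])
          fix k
          have "g \<in> Q (B, k)" using g B by (auto simp: \<D>_def)
          then show "charge.dst (g <# B) B < 1 / real (Suc k)" using Q[of "(B, k)"] B by auto
        qed (use charge.dst_nonneg translate_Def gG B C(2) in auto)
        show "g \<in> stabilizer" by (rule in_stabilizerI[OF gG app(2) zero])
      qed
    qed
  qed
qed

section \<open>The index of the stabilizer\<close>

lemma rcosets_representatives:
  obtains r where "\<And>c. c \<in> rcosets H \<Longrightarrow> r c \<in> carrier G \<and> c = H #> r c"
proof -
  have "\<forall>c\<in>rcosets H. \<exists>g. g \<in> carrier G \<and> c = H #> g" by (auto simp: RCOSETS_def)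
  then show ?thesis using that by metis
qed

text \<open>The trace \<open>\<tau> g\<close> determines the coset of \<open>g\<close>: if the
  traces of \<open>g\<close> and \<open>g'\<close> agree, one \<open>U\<close> lies close to both
  \<open>inv g <# B\<close> and \<open>inv g' <# B\<close>, so these have distance 0, and
  translation by \<open>g'\<close> shows that \<open>g' \<otimes> inv g\<close> stabilizes
  \<open>B\<close>. Traces are subsets of a set no larger than \<open>symbols\<close>. Inverses
  appear because the cosets are right cosets.\<close>

lemma small_rcosets_stabilizer: "small M (rcosets stabilizer)"
proof -
  obtain \<C> where app: "\<C> \<lesssim> symbols" "approximating \<C>"
    by (rule symbols_sized_base)
  note C = app(1) approximatingD[OF app(2)]
  define \<tau> where "\<tau> g = {((B, U), k) \<in> (\<C> \<times> \<C>) \<times> (UNIV :: nat set).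
      charge.dst (inv g <# B) U < 1 / real (Suc k)}" for g
  have eq: "stabilizer #> g = stabilizer #> g'"
    if g: "g \<in> carrier G" and g': "g' \<in> carrier G" and \<tau>: "\<tau> g = \<tau> g'" for g g'
  proof -
    have zero: "charge.dst (g' \<otimes> inv g <# B) B = 0" if "B \<in> \<C>" for B
    proof -
      have B: "B \<in> Def" using that C(2) by blast
      note T = translate_Def[OF inv_closed[OF g] B] translate_Def[OF inv_closed[OF g'] B]
      have "charge.dst (inv g <# B) (inv g' <# B) = 0"
      proof (rule approx_zero[of _ 2])
        fix k
        have "0 < 1 / real (Suc k)" by simp
        then obtain U W where UW: "U \<in> \<C>" "W \<in> \<C>" "U \<subseteq> inv g <# B" "inv g <# B \<subseteq> W" "\<mu> W - \<mu> U < 1 / real (Suc k)"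
          using C(3)[OF T(1)] by blast
        have D: "U \<in> Def" "W \<in> Def" using UW C(2) by auto
        have near: "charge.dst (inv g <# B) U < 1 / real (Suc k)"
          using charge.dst_between[OF T(1) D(1) D UW(3,4) order_refl] UW(3,4,5) by (auto dest: order_trans)
        then have "((B, U), k) \<in> \<tau> g" using \<open>B \<in> \<C>\<close> UW by (simp add: \<tau>_def)
        then have "charge.dst (inv g' <# B) U < 1 / real (Suc k)" unfolding \<tau> by (simp add: \<tau>_def)
        moreover have "charge.dst (inv g <# B) (inv g' <# B) \<le> charge.dst (inv g <# B) U + charge.dst U (inv g' <# B)"
          by (rule charge.dst_triangle[OF T(1) D(1) T(2)])
        ultimately show "charge.dst (inv g <# B) (inv g' <# B) < 2 / real (Suc k)"
          using near charge.dst_sym[of U] by simp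
      qed (use charge.dst_nonneg[OF T] in auto)
      then have "charge.dst (g' <# (inv g <# B)) (g' <# (inv g' <# B)) = 0"
        using dst_translate[OF g' T] by simp
      then show ?thesis
        using l_coset_inv_cancel[OF inv_closed[OF g'] DefD(2)[OF B]] g' lcos_m_assoc[OF DefD(2)[OF B] g' inv_closed[OF g]]
        by simp
    qed
    have "g' \<otimes> inv g \<in> stabilizer" using g g' by (intro in_stabilizerI[OF _ app(2) zero]) auto
    then have "(g' \<otimes> inv g) \<otimes> g \<in> stabilizer #> g" by (auto simp: r_coset_def)
    then have "g' \<in> stabilizer #> g" using g g' by (simp add: m_assoc)
    then show ?thesis by (rule repr_independence[OF _ g subgroup_stabilizer])
  qed
  obtain r where r: "\<And>c. c \<in> rcosets stabilizer \<Longrightarrow> r c \<in> carrier G \<and> c = stabilizer #> r c"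
    by (rule rcosets_representatives) (rule that; assumption)
  have "inj_on (\<lambda>c. \<tau> (r c)) (rcosets stabilizer)"
  proof (rule inj_onI)
    fix c c' assume c: "c \<in> rcosets stabilizer" "c' \<in> rcosets stabilizer" "\<tau> (r c) = \<tau> (r c')"
    have "stabilizer #> r c = stabilizer #> r c'" by (rule eq) (use r c in auto)
    then show "c = c'" using r c(1,2) by metis
  qed
  then have "rcosets stabilizer \<lesssim> Pow ((\<C> \<times> \<C>) \<times> (UNIV :: nat set))"
    unfolding lepoll_def by (intro exI[of _ "\<lambda>c. \<tau> (r c)"]) (auto simp: \<tau>_def)
  also have "\<dots> \<lesssim> Pow symbols"
  proof -
    have nat: "(UNIV :: nat set) \<lesssim> symbols" using infinite_symbols unfolding infinite_le_lepoll .
    have "(\<C> \<times> \<C>) \<times> (UNIV :: nat set) \<lesssim> symbols"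
      by (rule Times_lepoll_infinite[OF infinite_symbols Times_lepoll_infinite[OF infinite_symbols C(1) C(1)] nat])
    then obtain f where "inj_on f ((\<C> \<times> \<C>) \<times> (UNIV :: nat set))" "f ` ((\<C> \<times> \<C>) \<times> UNIV) \<subseteq> symbols"
      by (auto simp: lepoll_def)
    then show ?thesis unfolding lepoll_def
      by (intro exI[of _ "image f"]) (auto simp: inj_on_image_Pow)
  qed
  also have "Pow symbols \<prec> universe M" by (rule Pow_symbols_lesspoll)
  finally show ?thesis by (simp add: small_def)
qed

end

section \<open>The stabilizer is the connected component\<close>

context group
begin

lemma rcoset_unique:
  assumes "subgroup K G" "c \<in> rcosets K" "c' \<in> rcosets K" "x \<in> c" "x \<in> c'"
  shows "c = c'"
  using rcos_disjoint[OF assms(1)] assms(2-) by (auto simp: pairwise_def disjnt_iff)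

end

context smooth_definable_group
begin

lemma union_of_cosetsI:
  assumes "subgroup H G" "Y \<subseteq> carrier G" "\<And>y. y \<in> Y \<Longrightarrow> y <# H \<subseteq> Y"
  shows "union_of_cosets G H Y"
  unfolding union_of_cosets_def
proof (intro exI[of _ Y] conjI assms(2) subset_antisym)
  show "Y \<subseteq> (\<Union>g\<in>Y. g <# H)"
  proof
    fix y assume y: "y \<in> Y"
    then have "y = y \<otimes> \<one>" using assms(2) by auto
    then show "y \<in> (\<Union>g\<in>Y. g <# H)"
      using y subgroup.one_closed[OF assms(1)] by (auto simp: l_coset_def)
  qed
qed (use assms(3) in blast)

lemma definable_pairs:
  assumes "dfn (universe M) blocks (\<lambda>e. P (e 0) (e 1))"
  shows "definable L M (n + n) {z \<in> tuples M (n + n). P (take n z) (drop n z)}" (is "definable L M _ ?Z")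
proof -
  define \<sigma> where "\<sigma> k i = (Inl (0, if k = 1 then n + i else i) :: nat \<times> nat + 'a)" for k i :: nat
  have "dfn (universe M) (\<lambda>_. n + n) (\<lambda>e. P (map (\<lambda>i. entry e (\<sigma> 0 i)) [0..<n]) (map (\<lambda>i. entry e (\<sigma> 1 i)) [0..<n]))"
    by (rule dfn_subst[OF assms order_refl, of "\<lambda>_. n + n" \<sigma>]) (auto simp: \<sigma>_def)
  then have "dfn (universe M) (\<lambda>_. n + n) (\<lambda>e. e 0 \<in> ?Z)"
  proof (rule dfn_cong)
    fix e assume e: "e \<in> env (\<lambda>_. n + n)"
    have "map (\<lambda>i. entry e (\<sigma> 0 i)) [0..<n] = take n (e 0)" "map (\<lambda>i. entry e (\<sigma> 1 i)) [0..<n] = drop n (e 0)"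
      using env_length[OF e, of 0] by (auto simp: \<sigma>_def intro!: nth_equalityI)
    then show "e 0 \<in> ?Z \<longleftrightarrow> P (map (\<lambda>i. entry e (\<sigma> 0 i)) [0..<n]) (map (\<lambda>i. entry e (\<sigma> 1 i)) [0..<n])"
      using env_tuples[OF e, of 0] by simp
  qed
  then show ?thesis using definableI[of "\<lambda>_. n + n" 0 ?Z] by auto
qed

text \<open>If every definable \<open>E \<supseteq> K\<close> inside the group contained a pair with
  quotient outside \<open>D\<close>, compactness in \<open>n + n\<close> variables would give such a
  pair in \<open>K\<close>; but its quotient lies in \<open>K \<subseteq> D\<close>.\<close>

lemma definable_root:
  assumes K: "subgroup K G" "type_definable L M n K" and D: "definable L M n D" "K \<subseteq> D"
  obtains E where "E \<in> Def" "K \<subseteq> E" "\<And>x y. x \<in> E \<Longrightarrow> y \<in> E \<Longrightarrow> x \<otimes> inv y \<in> D"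
proof (rule ccontr)
  assume no: "\<not> thesis"
  have KG: "K \<subseteq> carrier G" by (rule subgroup.subset[OF K(1)])
  obtain \<D>0 where D0: "small M \<D>0" "\<And>E. E \<in> \<D>0 \<Longrightarrow> definable L M n E" "K = tuples M n \<inter> \<Inter>\<D>0"
    using K(2) by (rule type_definableE) blast
  define \<D> where "\<D> = insert (carrier G) \<D>0"
  have small: "small M \<D>"
    using small_Un[OF small_countable[of "{carrier G}"] D0(1)] by (simp add: \<D>_def)
  have def: "definable L M n E" if "E \<in> \<D>" for E using that D0(2) S_definable by (auto simp: \<D>_def)
  have K_eq: "K = \<Inter>\<D>" using D0(3) KG carrier_tuples by (auto simp: \<D>_def)
  define D' where "D' = D \<inter> carrier G"
  have D': "D' \<in> Def" unfolding D'_def using definable_Int[OF D(1) S_definable] by (intro DefI) auto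
  \<comment> \<open>That \<open>x \<otimes> inv y\<close> is outside \<open>D\<close> is expressed
    as \<open>x\<close> not being a product \<open>d \<otimes> y\<close> with \<open>d\<close> in
    \<open>D'\<close>, which needs the graph of multiplication only.\<close>
  define P where "P E x y \<longleftrightarrow> (x \<in> E \<and> y \<in> E) \<and> \<not> (\<exists>d\<in>D'. d \<in> carrier G \<and> y \<in> carrier G \<and> x = d \<otimes> y)" for E x y
  define X where "X E = {z \<in> tuples M (n + n). P E (take n z) (drop n z)}" for E
  have "tuples M (n + n) \<inter> (\<Inter>E\<in>\<D>. X E) \<noteq> {}"
  proof (rule compactness_indexed[OF small])
    fix E assume E: "E \<in> \<D>"
    have "dfn (universe M) blocks (\<lambda>e. \<exists>d\<in>D'. d \<in> carrier G \<and> e 1 \<in> carrier G \<and> e 0 = d \<otimes> e 1)"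
      by (rule dfn_bex[where k = 2]) (use D' dfn_Def dfn_mult Def_subset_tuples in auto)
    then have "dfn (universe M) blocks (\<lambda>e. P E (e 0) (e 1))"
      unfolding P_def by (intro dfn_conj dfn_neg dfn_mem) (use def[OF E] in auto)
    then show "definable L M (n + n) (X E)" unfolding X_def by (rule definable_pairs)
  next
    fix \<F> assume F: "finite \<F>" "\<F> \<subseteq> \<D>"
    define E where "E = carrier G \<inter> (tuples M n \<inter> \<Inter>\<F>)"
    have "E \<in> Def" unfolding E_def
      by (intro DefI definable_Int S_definable definable_Inter) (use F def in auto)
    moreover have "K \<subseteq> E" using K_eq KG carrier_tuples F(2) by (auto simp: E_def)
    ultimately have "\<exists>x\<in>E. \<exists>y\<in>E. x \<otimes> inv y \<notin> D" using no that by blast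
    then obtain x y where xy: "x \<in> E" "y \<in> E" "x \<otimes> inv y \<notin> D" by blast
    have G: "x \<in> carrier G" "y \<in> carrier G" using xy by (auto simp: E_def)
    have t: "x \<in> tuples M n" "y \<in> tuples M n" using G carrier_tuples by auto
    have "x \<noteq> d \<otimes> y" if "d \<in> D'" for d using that xy(3) G by (auto simp: D'_def m_assoc)
    then have "P F x y" if "F \<in> \<F>" for F using xy(1,2) that by (auto simp: P_def E_def)
    moreover have "x @ y \<in> tuples M (n + n)" "take n (x @ y) = x" "drop n (x @ y) = y"
      using t by (auto simp: tuples_def)
    ultimately have "x @ y \<in> tuples M (n + n) \<inter> (\<Inter>F\<in>\<F>. X F)" by (simp add: X_def)
    then show "tuples M (n + n) \<inter> (\<Inter>F\<in>\<F>. X F) \<noteq> {}" by blast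
  qed
  then obtain z where z: "\<And>E. E \<in> \<D> \<Longrightarrow> P E (take n z) (drop n z)" by (auto simp: X_def)
  define x y where "x = take n z" and "y = drop n z"
  have xy: "x \<in> K" "y \<in> K" using z K_eq by (auto simp: P_def x_def y_def)
  then have "x \<otimes> inv y \<in> K" using K(1) by (simp add: subgroup.m_closed subgroup.m_inv_closed)
  then have d: "x \<otimes> inv y \<in> D'" using D(2) KG by (auto simp: D'_def)
  have G: "x \<in> carrier G" "y \<in> carrier G" using xy KG by auto
  then have "x = (x \<otimes> inv y) \<otimes> y" by (simp add: m_assoc)
  then show False using z[of "carrier G"] d G by (auto simp: P_def \<D>_def x_def[symmetric] y_def[symmetric])
qed

text \<open>Inversion turns the right cosets of \<open>K\<close> into left cosets, and each of these
  lies in a left translate of \<open>E\<close>. Bounded index means few translates, so compactness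
  leaves finitely many. In particular \<open>E\<close> cannot be null.\<close>

lemma finite_translate_cover:
  assumes K: "subgroup K G" "small M (rcosets K)" and E: "E \<in> Def" "K \<subseteq> E"
  obtains R where "finite R" "R \<subseteq> carrier G" "carrier G \<subseteq> (\<Union>r\<in>R. r <# E)"
proof -
  obtain r where r: "\<And>c. c \<in> rcosets K \<Longrightarrow> r c \<in> carrier G \<and> c = K #> r c"
    by (rule rcosets_representatives) (rule that; assumption)
  have def: "definable L M n (inv (r c) <# E)" if "c \<in> rcosets K" for c
    using r[OF that] by (intro DefD translate_Def E inv_closed) auto
  have cover: "carrier G \<subseteq> (\<Union>c\<in>rcosets K. inv (r c) <# E)"
  proof
    fix g assume g: "g \<in> carrier G"
    define c where "c = K #> inv g"
    have c: "c \<in> rcosets K" unfolding c_def using g subgroup.subset[OF K(1)] by (intro rcosetsI) auto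
    have "r c \<in> c" using r[OF c] rcos_self[OF _ K(1)] by metis
    then obtain k where k: "k \<in> K" "r c = k \<otimes> inv g" by (auto simp: c_def r_coset_def)
    have kG: "k \<in> carrier G" using k(1) subgroup.subset[OF K(1)] by blast
    have "inv (r c) \<otimes> k = g" using k(2) kG g by (simp add: inv_mult_group m_assoc)
    then have "g \<in> inv (r c) <# E" using k(1) E(2) by (auto simp: mem_l_coset)
    then show "g \<in> (\<Union>c\<in>rcosets K. inv (r c) <# E)" using c by blast
  qed
  obtain F where F: "finite F" "F \<subseteq> rcosets K" "carrier G \<subseteq> (\<Union>c\<in>F. inv (r c) <# E)"
    by (rule finite_subcover[OF K(2) def S_definable cover])
  show ?thesis
    by (rule that[of "(\<lambda>c. inv (r c)) ` F"]) (use F r in auto)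
qed

lemma positive_measure:
  assumes K: "subgroup K G" "small M (rcosets K)" and E: "E \<in> Def" "K \<subseteq> E"
  shows "0 < \<mu> E"
proof (rule ccontr)
  assume "\<not> 0 < \<mu> E"
  then have zero: "\<mu> E = 0" using charge.nonneg[OF E(1)] by simp
  obtain R where R: "finite R" "R \<subseteq> carrier G" "carrier G \<subseteq> (\<Union>r\<in>R. r <# E)"
    by (rule finite_translate_cover[OF assms])
  have T: "r <# E \<in> Def" "\<mu> (r <# E) = 0" if "r \<in> R" for r
    using that R(2) E(1) zero translate_Def measure_translate by auto
  have "\<mu> (carrier G) \<le> \<mu> (\<Union>r\<in>R. r <# E)"
    using R(1,3) T by (intro charge.measure_mono charge.top charge.UN_in) auto
  also have "\<dots> \<le> (\<Sum>r\<in>R. \<mu> (r <# E))" using R(1) T by (intro charge.measure_UN_le) auto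
  also have "\<dots> = 0" using T by simp
  finally show False using charge.total by simp
qed

lemma stabilizer_least:
  assumes K: "subgroup K G" "type_definable L M n K" "small M (rcosets K)"
  shows "stabilizer \<subseteq> K"
proof
  fix g assume g: "g \<in> stabilizer"
  then have gG: "g \<in> carrier G" using stabilizer_subset by auto
  obtain \<D> where D: "small M \<D>" "\<And>E. E \<in> \<D> \<Longrightarrow> definable L M n E" "K = tuples M n \<inter> \<Inter>\<D>"
    using K(2) by (rule type_definableE) blast
  have "g \<in> D" if DD: "D \<in> \<D>" for D
  proof -
    have "K \<subseteq> D" using D(3) DD by blast
    then obtain E where E: "E \<in> Def" "K \<subseteq> E" "\<And>x y. x \<in> E \<Longrightarrow> y \<in> E \<Longrightarrow> x \<otimes> inv y \<in> D"
      using definable_root[OF K(1,2) D(2)[OF DD]] by blast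
    have "0 < \<mu> E" by (rule positive_measure[OF K(1,3) E(1,2)])
    moreover have "\<mu> (g <# E) = \<mu> E" by (rule measure_translate[OF gG E(1)])
    \<comment> \<open>Disjoint sets would be at distance \<open>2 * \<mu> E\<close>, yet
      \<open>g\<close> moves \<open>E\<close> by distance 0. A common point exhibits
      \<open>g\<close> as a quotient of two elements of \<open>E\<close>.\<close>
    ultimately have "(g <# E) \<inter> E \<noteq> {}"
      using charge.dst_disjoint[OF translate_Def[OF gG E(1)] E(1)] stabilizerD[OF g E(1)] by auto
    then obtain a where a: "a \<in> E" "g \<otimes> a \<in> E" by (auto simp: mem_l_coset)
    have "a \<in> carrier G" using a(1) DefD(2)[OF E(1)] by blast
    then have "g = (g \<otimes> a) \<otimes> inv a" using gG by (simp add: m_assoc)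
    then show ?thesis using E(3)[OF a(2,1)] by simp
  qed
  then show "g \<in> K" using D(3) gG carrier_tuples by auto
qed

lemma G00_eq_stabilizer: "G00 L M n G = stabilizer"
  unfolding G00_def
  by (rule Least_equality)
    (simp_all add: subgroup_stabilizer type_definable_stabilizer small_rcosets_stabilizer stabilizer_least)

lemma finite_rcosets:
  assumes H: "subgroup H G" "H \<in> Def" "stabilizer \<subseteq> H"
  shows "finite (rcosets H)"
proof -
  obtain R where R: "finite R" "R \<subseteq> carrier G" "carrier G \<subseteq> (\<Union>r\<in>R. r <# H)"
    by (rule finite_translate_cover[OF subgroup_stabilizer small_rcosets_stabilizer H(2,3)])
  have HG: "H \<subseteq> carrier G" by (rule subgroup.subset[OF H(1)])
  have "rcosets H \<subseteq> (\<lambda>r. H #> inv r) ` R"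
  proof
    fix c assume "c \<in> rcosets H"
    then obtain g where g: "g \<in> carrier G" "c = H #> g" by (auto simp: RCOSETS_def)
    have "inv g \<in> (\<Union>r\<in>R. r <# H)" using R(3) inv_closed[OF g(1)] by blast
    then obtain r h where r: "r \<in> R" "h \<in> H" "inv g = r \<otimes> h" by (auto simp: mem_l_coset)
    have G: "r \<in> carrier G" "h \<in> carrier G" using r R(2) HG by auto
    have "g = inv h \<otimes> inv r" using g(1) G r(3) by (metis inv_inv inv_mult_group)
    then have "g \<in> H #> inv r" using r(2) subgroup.m_inv_closed[OF H(1)] by (auto simp: r_coset_def)
    then have "c = H #> inv r" using g(2) repr_independence[OF _ inv_closed[OF G(1)] H(1)] by simp
    then show "c \<in> (\<lambda>r. H #> inv r) ` R" using r(1) by blast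
  qed
  then show ?thesis using R(1) finite_surj by blast
qed

section \<open>The logic topology\<close>

lemma type_definable_translate:
  assumes g: "g \<in> carrier G" and Y: "type_definable L M n Y" "Y \<subseteq> carrier G"
  shows "type_definable L M n (g <# Y)"
proof -
  obtain \<D> where D: "small M \<D>" "\<And>E. E \<in> \<D> \<Longrightarrow> definable L M n E" "Y = tuples M n \<inter> \<Inter>\<D>"
    using Y(1) by (rule type_definableE) blast
  define \<E> where "\<E> = insert (carrier G) ((\<lambda>E. g <# (E \<inter> carrier G)) ` \<D>)"
  have "small M \<E>"
    using small_Un[OF small_countable[of "{carrier G}"] small_image[OF D(1), of "\<lambda>E. g <# (E \<inter> carrier G)"]]
    by (simp add: \<E>_def)
  then show ?thesis
  proof (rule type_definableI)
    have "g <# (E \<inter> carrier G) \<in> Def" if "E \<in> \<D>" for E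
      using D(2)[OF that] by (intro translate_Def[OF g] DefI definable_Int S_definable) auto
    then show "definable L M n E" if "E \<in> \<E>" for E
      using that S_definable DefD(1) by (auto simp: \<E>_def)
    show "g <# Y = tuples M n \<inter> \<Inter>\<E>"
    proof (rule Set.set_eqI)
      fix x
      show "x \<in> g <# Y \<longleftrightarrow> x \<in> tuples M n \<inter> \<Inter>\<E>"
      proof (cases "x \<in> carrier G")
        case True
        then have "inv g \<otimes> x \<in> carrier G" using g by simp
        then show ?thesis
          using True carrier_tuples Y(2) g D(3) by (auto simp: \<E>_def mem_l_coset_iff)
      next
        case False
        then show ?thesis using l_coset_subset_G[OF Y(2) g] by (auto simp: \<E>_def)
      qed
    qed
  qed
qed

lemma type_definable_rcoset:
  assumes "c \<in> rcosets stabilizer"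
  shows "type_definable L M n c"
proof -
  obtain g where g: "g \<in> carrier G" "c = stabilizer #> g" using assms by (auto simp: RCOSETS_def)
  then have "c = g <# stabilizer" using normal.coset_eq[OF normal_stabilizer] by simp
  then show ?thesis
    using type_definable_translate[OF g(1) type_definable_stabilizer stabilizer_subset] by simp
qed

lemma Union_rcosets: "\<Union>(rcosets stabilizer) = carrier G"
  by (rule rcosets_part_G[OF subgroup_stabilizer])

lemma Union_rcosets_Diff:
  assumes "U \<subseteq> rcosets stabilizer"
  shows "\<Union>(rcosets stabilizer - U) = carrier G - \<Union>U"
  using assms Union_rcosets rcoset_unique[OF subgroup_stabilizer] by blast

text \<open>A union of many open sets of cosets is open although type-definability allows only small
  intersections: each of the few cosets outside the closed set is separated from it by a
  single definable set.\<close>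

lemma istopology_logic:
  "istopology (\<lambda>U. U \<subseteq> rcosets stabilizer \<and> type_definable L M n (\<Union>(rcosets stabilizer - U)))"
  (is "istopology ?open")
  unfolding istopology_def
proof (intro conjI allI impI)
  fix U V assume "?open U" "?open V"
  moreover have "\<Union>(rcosets stabilizer - U \<inter> V) = \<Union>(rcosets stabilizer - U) \<union> \<Union>(rcosets stabilizer - V)"
    by blast
  ultimately show "U \<inter> V \<subseteq> rcosets stabilizer" "type_definable L M n (\<Union>(rcosets stabilizer - U \<inter> V))"
    by (auto intro: type_definable_Un)
next
  fix \<K> assume K: "\<forall>U\<in>\<K>. ?open U"
  then show sub: "\<Union>\<K> \<subseteq> rcosets stabilizer" by blast
  have "\<forall>c\<in>\<Union>\<K>. \<exists>D. definable L M n D \<and> carrier G - \<Union>(\<Union>\<K>) \<subseteq> D \<and> D \<inter> c = {}"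
  proof
    fix c assume "c \<in> \<Union>\<K>"
    then obtain U where U: "U \<in> \<K>" "c \<in> U" by blast
    then have "?open U" using K by blast
    then have td: "type_definable L M n (carrier G - \<Union>U)" "U \<subseteq> rcosets stabilizer"
      using Union_rcosets_Diff by auto
    have "type_definable L M n c" using U td by (intro type_definable_rcoset) auto
    moreover have "(carrier G - \<Union>U) \<inter> c = {}" using U by blast
    ultimately obtain D where "definable L M n D" "carrier G - \<Union>U \<subseteq> D" "D \<inter> c = {}"
      using type_definable_separate[OF td(1)] by blast
    then show "\<exists>D. definable L M n D \<and> carrier G - \<Union>(\<Union>\<K>) \<subseteq> D \<and> D \<inter> c = {}"
      using U by blast
  qed
  then obtain D where D: "\<And>c. c \<in> \<Union>\<K> \<Longrightarrow> definable L M n (D c) \<and> carrier G - \<Union>(\<Union>\<K>) \<subseteq> D c \<and> D c \<inter> c = {}"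
    by metis
  define \<D> where "\<D> = insert (carrier G) (D ` \<Union>\<K>)"
  have "small M (\<Union>\<K>)" by (rule small_lepoll[OF subset_imp_lepoll[OF sub] small_rcosets_stabilizer])
  then have "small M \<D>"
    using small_Un[OF small_countable[of "{carrier G}"] small_image] by (simp add: \<D>_def)
  then show "type_definable L M n (\<Union>(rcosets stabilizer - \<Union>\<K>))"
  proof (rule type_definableI)
    show "definable L M n E" if "E \<in> \<D>" for E using that D S_definable by (auto simp: \<D>_def)
    show "\<Union>(rcosets stabilizer - \<Union>\<K>) = tuples M n \<inter> \<Inter>\<D>"
      unfolding Union_rcosets_Diff[OF sub]
    proof (intro subset_antisym subsetI)
      fix x assume x: "x \<in> carrier G - \<Union>(\<Union>\<K>)"
      then have "x \<in> D c" if "c \<in> \<Union>\<K>" for c using D[OF that] by blast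
      then show "x \<in> tuples M n \<inter> \<Inter>\<D>" using x carrier_tuples by (auto simp: \<D>_def)
    next
      fix x assume "x \<in> tuples M n \<inter> \<Inter>\<D>"
      then have x: "x \<in> carrier G" "\<And>c. c \<in> \<Union>\<K> \<Longrightarrow> x \<in> D c" by (auto simp: \<D>_def)
      have "x \<notin> c" if "c \<in> \<Union>\<K>" for c using D[OF that] x(2)[OF that] by blast
      then show "x \<in> carrier G - \<Union>(\<Union>\<K>)" using x(1) by blast
    qed
  qed
qed

lemma openin_logic_topology:
  "openin (logic_topology L M n G stabilizer) U \<longleftrightarrow>
     U \<subseteq> rcosets stabilizer \<and> type_definable L M n (\<Union>(rcosets stabilizer - U))"
  unfolding logic_topology_def using istopology_logic by (simp add: FactGroup_def topology_inverse')

section \<open>Definable normal subgroups from a profinite quotient\<close>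

lemma clopen_definable:
  assumes "openin (logic_topology L M n G stabilizer) U" "closedin (logic_topology L M n G stabilizer) U"
    "topspace (logic_topology L M n G stabilizer) = rcosets stabilizer"
  shows "\<Union>U \<in> Def"
proof -
  have sub: "U \<subseteq> rcosets stabilizer" using assms(1) by (simp add: openin_logic_topology)
  then have UG: "\<Union>U \<subseteq> carrier G" using Union_rcosets by blast
  have "rcosets stabilizer - (rcosets stabilizer - U) = U" using sub by blast
  then have "type_definable L M n (\<Union>U)" "type_definable L M n (carrier G - \<Union>U)"
    using assms sub by (auto simp: closedin_def openin_logic_topology Union_rcosets_Diff)
  then show ?thesis using UG by (intro DefI definable_if_type_definable_Diff[OF S_definable])
qed

text \<open>In a compact Hausdorff space quasi-components are components, here single points, so
  each other coset is separated from the stabilizer by a clopen set. The unions of these clopen sets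
  are definable, and compactness in \<open>M\<close> finds finitely many whose intersection lies in
  \<open>D\<close>.\<close>

lemma clopen_between:
  assumes prof: "profinite_group (G Mod stabilizer) (logic_topology L M n G stabilizer)"
    and D: "D \<in> Def" "stabilizer \<subseteq> D"
  obtains V where "V \<in> Def" "stabilizer \<subseteq> V" "V \<subseteq> D"
    "\<And>x k. x \<in> carrier G \<Longrightarrow> k \<in> stabilizer \<Longrightarrow> k \<otimes> x \<in> V \<longleftrightarrow> x \<in> V"
proof -
  let ?\<tau> = "logic_topology L M n G stabilizer"
  have space: "topspace ?\<tau> = rcosets stabilizer"
    and comp: "\<And>x. x \<in> topspace ?\<tau> \<Longrightarrow> connected_component_of_set ?\<tau> x = {x}"
    and haus: "compact_space ?\<tau>" "Hausdorff_space ?\<tau>"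
    using prof by (auto simp: profinite_group_def FactGroup_def)
  have quasi: "quasi_component_of ?\<tau> x = connected_component_of ?\<tau> x" for x
    by (rule quasi_eq_connected_component_of) (use haus in blast)
  have N: "stabilizer \<in> rcosets stabilizer" by (rule subgroup.subgroup_in_rcosets[OF subgroup_stabilizer is_group])
  have "\<forall>c\<in>rcosets stabilizer - {stabilizer}. \<exists>T. stabilizer \<in> T \<and> closedin ?\<tau> T \<and> openin ?\<tau> T \<and> c \<notin> T"
  proof
    fix c assume c: "c \<in> rcosets stabilizer - {stabilizer}"
    then have "\<not> quasi_component_of ?\<tau> stabilizer c"
      using comp[of stabilizer] N space by (auto simp: quasi set_eq_iff)
    then show "\<exists>T. stabilizer \<in> T \<and> closedin ?\<tau> T \<and> openin ?\<tau> T \<and> c \<notin> T"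
      using c N space by (auto simp: quasi_component_of)
  qed
  then obtain T where T: "\<And>c. c \<in> rcosets stabilizer - {stabilizer} \<Longrightarrow>
      stabilizer \<in> T c \<and> closedin ?\<tau> (T c) \<and> openin ?\<tau> (T c) \<and> c \<notin> T c" by metis
  have TD: "\<Union>(T c) \<in> Def" "T c \<subseteq> rcosets stabilizer" if "c \<in> rcosets stabilizer - {stabilizer}" for c
    using T[OF that] clopen_definable space by (auto simp: openin_logic_topology)
  have small: "small M (rcosets stabilizer - {stabilizer})"
    by (rule small_lepoll[OF subset_imp_lepoll small_rcosets_stabilizer]) auto
  have def: "definable L M n (carrier G - \<Union>(T c))" if "c \<in> rcosets stabilizer - {stabilizer}" for c
    using TD(1)[OF that] by (intro definable_Diff S_definable DefD(1))
  have def': "definable L M n (carrier G - D)"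
    using D(1) by (intro definable_Diff S_definable DefD(1))
  have cover: "carrier G - D \<subseteq> (\<Union>c\<in>rcosets stabilizer - {stabilizer}. carrier G - \<Union>(T c))"
  proof
    fix x assume x: "x \<in> carrier G - D"
    then obtain c where c: "c \<in> rcosets stabilizer" "x \<in> c" using Union_rcosets by blast
    then have c': "c \<in> rcosets stabilizer - {stabilizer}" using x D(2) by blast
    have "x \<notin> \<Union>(T c)"
    proof
      assume "x \<in> \<Union>(T c)"
      then obtain c2 where "c2 \<in> T c" "x \<in> c2" by blast
      then show False using rcoset_unique[OF subgroup_stabilizer, of c2 c x] c TD(2)[OF c'] T[OF c'] by blast
    qed
    then show "x \<in> (\<Union>c\<in>rcosets stabilizer - {stabilizer}. carrier G - \<Union>(T c))" using c' x by blast
  qed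
  obtain F where F: "finite F" "F \<subseteq> rcosets stabilizer - {stabilizer}" "carrier G - D \<subseteq> (\<Union>c\<in>F. carrier G - \<Union>(T c))"
    by (rule finite_subcover[OF small def def' cover])
  define V where "V = carrier G \<inter> (tuples M n \<inter> (\<Inter>c\<in>F. \<Union>(T c)))"
  show ?thesis
  proof (rule that)
    show "V \<in> Def" unfolding V_def
      by (intro DefI definable_Int S_definable definable_INT F(1)) (use F(2) TD(1) DefD(1) in auto)
    show "stabilizer \<subseteq> V" using T F(2) stabilizer_subset carrier_tuples unfolding V_def by blast
    show "V \<subseteq> D" using F(3) unfolding V_def by blast
    fix x k assume x: "x \<in> carrier G" and k: "k \<in> stabilizer"
    have kx: "k \<otimes> x \<in> stabilizer #> x" using k by (auto simp: r_coset_def)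
    have xx: "x \<in> stabilizer #> x" by (rule rcos_self[OF x subgroup_stabilizer])
    have c: "stabilizer #> x \<in> rcosets stabilizer" by (rule rcosetsI[OF stabilizer_subset x])
    have "k \<otimes> x \<in> \<Union>(T c) \<longleftrightarrow> x \<in> \<Union>(T c)" if "c \<in> F" for c
    proof -
      have "T c \<subseteq> rcosets stabilizer" using TD(2) F(2) that by blast
      then have "y \<in> \<Union>(T c) \<longleftrightarrow> stabilizer #> x \<in> T c" if "y \<in> stabilizer #> x" for y
        using that rcoset_unique[OF subgroup_stabilizer _ c _ that] by blast
      then show ?thesis using kx xx by blast
    qed
    moreover have "k \<otimes> x \<in> carrier G" using x k stabilizer_subset by auto
    ultimately show "k \<otimes> x \<in> V \<longleftrightarrow> x \<in> V" using x carrier_tuples unfolding V_def by auto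
  qed
qed

lemma definable_normal_subgroup:
  assumes prof: "profinite_group (G Mod stabilizer) (logic_topology L M n G stabilizer)"
    and D: "D \<in> Def" "stabilizer \<subseteq> D"
  obtains H where "H \<lhd> G" "H \<in> Def" "finite (rcosets H)" "H \<subseteq> D"
proof -
  obtain V where V: "V \<in> Def" "stabilizer \<subseteq> V" "V \<subseteq> D"
    "\<And>x k. x \<in> carrier G \<Longrightarrow> k \<in> stabilizer \<Longrightarrow> k \<otimes> x \<in> V \<longleftrightarrow> x \<in> V"
    by (rule clopen_between[OF assms]) (rule that; assumption)
  \<comment> \<open>This is the largest normal subgroup of which \<open>V\<close> is a union of
    cosets, in a form that is visibly first-order. It contains the stabilizer, which is normal and
    leaves \<open>V\<close> invariant, and it lies in \<open>V\<close> because \<open>V\<close>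
    contains \<open>\<one>\<close>.\<close>
  define H where "H = {h \<in> carrier G. \<forall>a\<in>carrier G. \<forall>b\<in>carrier G. a \<otimes> b \<in> V \<longleftrightarrow> a \<otimes> (h \<otimes> b) \<in> V}"
  have HD: "a \<otimes> b \<in> V \<longleftrightarrow> a \<otimes> (h \<otimes> b) \<in> V" if "h \<in> H" "a \<in> carrier G" "b \<in> carrier G" for h a b
    using that by (simp add: H_def)
  have HG: "h \<in> carrier G" if "h \<in> H" for h using that by (simp add: H_def)
  have HI: "h \<in> H" if "h \<in> carrier G"
    "\<And>a b. a \<in> carrier G \<Longrightarrow> b \<in> carrier G \<Longrightarrow> a \<otimes> b \<in> V \<longleftrightarrow> a \<otimes> (h \<otimes> b) \<in> V" for h
    using that unfolding H_def by blast
  have sub: "subgroup H G"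
  proof
    show "H \<subseteq> carrier G" by (auto simp: H_def)
    show "\<one> \<in> H" by (rule HI) simp_all
    show "x \<otimes> y \<in> H" if x: "x \<in> H" and y: "y \<in> H" for x y
    proof -
      have "a \<otimes> b \<in> V \<longleftrightarrow> a \<otimes> (x \<otimes> y \<otimes> b) \<in> V" if "a \<in> carrier G" "b \<in> carrier G" for a b
        using HD[OF y that] HD[OF x that(1), of "y \<otimes> b"] HG[OF x] HG[OF y] that by (simp add: m_assoc)
      then show ?thesis by (rule HI[OF m_closed[OF HG[OF x] HG[OF y]]])
    qed
    show "inv x \<in> H" if x: "x \<in> H" for x
    proof -
      have "a \<otimes> b \<in> V \<longleftrightarrow> a \<otimes> (inv x \<otimes> b) \<in> V" if "a \<in> carrier G" "b \<in> carrier G" for a b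
        using HD[OF x that(1), of "inv x \<otimes> b"] HG[OF x] that by (simp add: m_assoc[symmetric])
      then show ?thesis by (rule HI[OF inv_closed[OF HG[OF x]]])
    qed
  qed
  have normal: "H \<lhd> G"
    unfolding normal_inv_iff
  proof (intro conjI ballI sub)
    fix x h assume x: "x \<in> carrier G" and h: "h \<in> H"
    have "a \<otimes> b \<in> V \<longleftrightarrow> a \<otimes> (x \<otimes> h \<otimes> inv x \<otimes> b) \<in> V" if "a \<in> carrier G" "b \<in> carrier G" for a b
    proof -
      have "(a \<otimes> x) \<otimes> (inv x \<otimes> b) = a \<otimes> b"
        using x that by (metis inv_closed inv_solve_left m_assoc m_closed)
      moreover have "(a \<otimes> x) \<otimes> (h \<otimes> (inv x \<otimes> b)) = a \<otimes> (x \<otimes> h \<otimes> inv x \<otimes> b)"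
        using x that HG[OF h] by (simp add: m_assoc)
      ultimately show ?thesis using HD[OF h, of "a \<otimes> x" "inv x \<otimes> b"] x that by simp
    qed
    then show "x \<otimes> h \<otimes> inv x \<in> H" by (rule HI[OF m_closed[OF m_closed[OF x HG[OF h]] inv_closed[OF x]]])
  qed
  have NH: "stabilizer \<subseteq> H"
  proof
    fix k assume k: "k \<in> stabilizer"
    then have kG: "k \<in> carrier G" using stabilizer_subset by blast
    have "a \<otimes> b \<in> V \<longleftrightarrow> a \<otimes> (k \<otimes> b) \<in> V" if "a \<in> carrier G" "b \<in> carrier G" for a b
    proof -
      have "a \<otimes> k \<otimes> inv a \<in> stabilizer" using normal.inv_op_closed2[OF normal_stabilizer that(1) k] .
      moreover have "(a \<otimes> k \<otimes> inv a) \<otimes> (a \<otimes> b) = a \<otimes> (k \<otimes> b)"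
        using that kG by (metis inv_closed inv_solve_left m_assoc m_closed)
      ultimately show ?thesis using V(4)[of "a \<otimes> b" "a \<otimes> k \<otimes> inv a"] that by simp
    qed
    then show "k \<in> H" by (rule HI[OF kG])
  qed
  have HV: "H \<subseteq> V"
  proof
    fix h assume h: "h \<in> H"
    have "\<one> \<in> V" using V(2) subgroup.one_closed[OF subgroup_stabilizer] by blast
    then show "h \<in> V" using HD[OF h one_closed one_closed] HG[OF h] by simp
  qed
  have "H \<in> Def"
  proof (rule DefI)
    have G: "dfn (universe M) blocks (\<lambda>e. e k \<in> carrier G)" for k by (rule dfn_Def[OF charge.top]) simp
    have VV: "dfn (universe M) blocks (\<lambda>e. e k \<in> V)" for k by (rule dfn_Def[OF V(1)]) simp
    note mult = dfn_mult[where l = blocks, OF refl refl refl]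
    \<comment> \<open>Blocks 0, 1 and 2 carry \<open>h\<close>, \<open>a\<close> and
      \<open>b\<close>; block 3 carries the product of \<open>h\<close> and \<open>b\<close>, and
      block 4 the product that is tested for membership in \<open>V\<close>.\<close>
    have 1: "dfn (universe M) blocks (\<lambda>e. \<exists>z\<in>V. e 1 \<in> carrier G \<and> e 2 \<in> carrier G \<and> z = e 1 \<otimes> e 2)"
      by (rule dfn_bex[where k = 4], rule VV, rule mult, rule Def_subset_tuples[OF V(1)], simp)
    have 2: "dfn (universe M) blocks (\<lambda>e. \<exists>z\<in>V. e 1 \<in> carrier G \<and> e 3 \<in> carrier G \<and> z = e 1 \<otimes> e 3)"
      by (rule dfn_bex[where k = 4], rule VV, rule mult, rule Def_subset_tuples[OF V(1)], simp)
    have 3: "dfn (universe M) blocks (\<lambda>e. \<exists>w\<in>carrier G. (e 0 \<in> carrier G \<and> e 2 \<in> carrier G \<and> w = e 0 \<otimes> e 2) \<and>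
        (\<exists>z\<in>V. e 1 \<in> carrier G \<and> w \<in> carrier G \<and> z = e 1 \<otimes> w))"
      by (rule dfn_bex[where k = 3], rule G, rule dfn_conj[OF mult 2], rule carrier_tuples, simp)
    have 4: "dfn (universe M) blocks (\<lambda>e. \<forall>b\<in>carrier G.
        (\<exists>z\<in>V. e 1 \<in> carrier G \<and> b \<in> carrier G \<and> z = e 1 \<otimes> b) \<longleftrightarrow>
        (\<exists>w\<in>carrier G. (e 0 \<in> carrier G \<and> b \<in> carrier G \<and> w = e 0 \<otimes> b) \<and>
          (\<exists>z\<in>V. e 1 \<in> carrier G \<and> w \<in> carrier G \<and> z = e 1 \<otimes> w)))"
      by (rule dfn_ball[where k = 2], rule G, rule dfn_iff[OF 1 3], rule carrier_tuples, simp)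
    have 5: "dfn (universe M) blocks (\<lambda>e. \<forall>a\<in>carrier G. \<forall>b\<in>carrier G.
        (\<exists>z\<in>V. a \<in> carrier G \<and> b \<in> carrier G \<and> z = a \<otimes> b) \<longleftrightarrow>
        (\<exists>w\<in>carrier G. (e 0 \<in> carrier G \<and> b \<in> carrier G \<and> w = e 0 \<otimes> b) \<and>
          (\<exists>z\<in>V. a \<in> carrier G \<and> w \<in> carrier G \<and> z = a \<otimes> w)))"
      by (rule dfn_ball[where k = 1], rule G, rule 4, rule carrier_tuples, simp)
    have "dfn (universe M) blocks (\<lambda>e. e 0 \<in> H)"
      by (rule dfn_cong[OF dfn_conj[OF G 5, of 0]]) (simp add: H_def cong: conj_cong ball_cong)
    then show "definable L M n H" using definableI[of blocks 0 H] HG carrier_tuples by blast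
    show "H \<subseteq> carrier G" using HG by blast
  qed
  then show ?thesis using that[OF normal _ finite_rcosets[OF sub _ NH]] HV V(3) by blast
qed

end

section \<open>Regularity\<close>

context smooth_definable_group
begin

lemma normal_coset_Def:
  assumes H: "H \<lhd> G" "H \<in> Def" and c: "c \<in> rcosets H"
  obtains g where "g \<in> carrier G" "c = g <# H" "c \<in> Def"
proof -
  obtain g where g: "g \<in> carrier G" "c = H #> g" using c by (auto simp: RCOSETS_def)
  then have "c = g <# H" using normal.coset_eq[OF H(1)] by simp
  then show ?thesis using that[OF g(1)] translate_Def[OF g(1) H(2)] by simp
qed

lemma union_of_rcosets:
  assumes H: "H \<lhd> G" "H \<in> Def" "finite (rcosets H)"
    and Y: "Y \<subseteq> carrier G" "\<And>y. y \<in> Y \<Longrightarrow> y <# H \<subseteq> Y"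
  shows "Y = \<Union>{c \<in> rcosets H. c \<subseteq> Y}" "Y \<in> Def"
proof -
  have sub: "subgroup H G" by (rule normal_imp_subgroup[OF H(1)])
  show Y_eq: "Y = \<Union>{c \<in> rcosets H. c \<subseteq> Y}"
  proof
    show "Y \<subseteq> \<Union>{c \<in> rcosets H. c \<subseteq> Y}"
    proof
      fix y assume y: "y \<in> Y"
      then have yG: "y \<in> carrier G" using Y(1) by blast
      have "H #> y \<subseteq> Y" using Y(2)[OF y] normal.coset_eq[OF H(1)] yG by simp
      moreover have "y \<in> H #> y" by (rule rcos_self[OF yG sub])
      moreover have "H #> y \<in> rcosets H" by (rule rcosetsI[OF subgroup.subset[OF sub] yG])
      ultimately show "y \<in> \<Union>{c \<in> rcosets H. c \<subseteq> Y}" by blast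
    qed
  qed auto
  have "c \<in> Def" if "c \<in> rcosets H" for c by (rule normal_coset_Def[OF H(1,2) that])
  then have "(\<Union>c\<in>{c \<in> rcosets H. c \<subseteq> Y}. c) \<in> Def" using H(3) by (intro charge.UN_in) auto
  then show "Y \<in> Def" using Y_eq by simp
qed

text \<open>Invariance forces every coset of \<open>H\<close> to have measure 1 divided by the
  index, so the value at \<open>Y\<close> only depends on the number of cosets in \<open>Y\<close>.
  This carries the bound on \<open>Z\<close> from the smooth measure to the given one.\<close>

lemma invariant_measures_agree:
  assumes H: "H \<lhd> G" "H \<in> Def" "finite (rcosets H)"
    and Y: "Y \<subseteq> carrier G" "\<And>y. y \<in> Y \<Longrightarrow> y <# H \<subseteq> Y"
    and \<nu>: "keisler_measure L M n (carrier G) \<nu>" "left_invariant L M n G \<nu>"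
  shows "\<nu> Y = \<mu> Y"
proof -
  have sub: "subgroup H G" by (rule normal_imp_subgroup[OF H(1)])
  have formula: "\<kappa> (\<Union>C) = real (card C) * \<kappa> H"
    if \<kappa>: "keisler_measure L M n (carrier G) \<kappa>" "left_invariant L M n G \<kappa>" and C: "C \<subseteq> rcosets H" for \<kappa> C
  proof -
    interpret c: set_algebra_charge "carrier G" Def \<kappa>
      unfolding Def_def by (rule keisler_charge[OF \<kappa>(1) S_definable order_refl universe_nonempty])
    have coset: "c \<in> Def" "\<kappa> c = \<kappa> H" if "c \<in> C" for c
    proof -
      have "c \<in> rcosets H" using that C by blast
      then obtain g where g: "g \<in> carrier G" "c = g <# H" "c \<in> Def"
        by (rule normal_coset_Def[OF H(1,2)])
      then show "c \<in> Def" "\<kappa> c = \<kappa> H"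
        using \<kappa>(2) H(2) by (auto simp: left_invariant_def Def_def)
    qed
    have "\<kappa> (\<Union>c\<in>C. c) = (\<Sum>c\<in>C. \<kappa> c)"
    proof (rule c.measure_UN_disjoint[OF finite_subset[OF C H(3)] coset(1)])
      show "c \<inter> c' = {}" if "c \<in> C" "c' \<in> C" "c \<noteq> c'" for c c'
        using that C rcoset_unique[OF sub, of c c'] by blast
    qed
    then show ?thesis using coset(2) by simp
  qed
  note F\<nu> = formula[OF \<nu>] and F\<mu> = formula[OF keisler left_invariant]
  have top: "\<Union>(rcosets H) = carrier G" by (rule rcosets_part_G[OF sub])
  have one: "\<nu> (carrier G) = 1" "\<mu> (carrier G) = 1" using \<nu>(1) keisler by (auto simp: keisler_measure_def)
  have "real (card (rcosets H)) * \<nu> H = 1" "real (card (rcosets H)) * \<mu> H = 1"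
    using F\<nu>[OF order_refl] F\<mu>[OF order_refl] by (simp_all add: top one)
  then have "\<nu> H = \<mu> H" by (metis mult_cancel_left mult_zero_left zero_neq_one)
  then show ?thesis
    using F\<nu>[of "{c \<in> rcosets H. c \<subseteq> Y}"] F\<mu>[of "{c \<in> rcosets H. c \<subseteq> Y}"]
    by (simp flip: union_of_rcosets(1)[OF H Y])
qed

text \<open>Two rounds of uniform approximation, first of the sets \<open>{x. g \<otimes> x \<in> X}\<close> and then of the
  translates of the resulting error sets, confine all the sets on which \<open>X\<close> and a translate of
  \<open>X\<close> by some \<open>b \<otimes> inv a\<close> with \<open>a, b \<in> B\<close> differ to one set of small measure.\<close>

lemma confined_differences:
  assumes X: "X \<in> Def" and "0 < \<epsilon>"
  obtains B W where "B \<in> Def" "0 < \<mu> B" "W \<in> Def" "\<mu> W < \<epsilon>"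
    "\<And>a b y. a \<in> B \<Longrightarrow> b \<in> B \<Longrightarrow> y \<in> carrier G \<Longrightarrow> (y \<in> X) \<noteq> (b \<otimes> inv a \<otimes> y \<in> X) \<Longrightarrow> y \<in> W"
proof -
  \<comment> \<open>For \<open>g\<close> in the group the fibre is the translate of \<open>X\<close>
    by \<open>inv g\<close>. Each of the two rounds of approximation is allowed an error of
    \<open>\<epsilon> / 2\<close>.\<close>
  define R where "R x g \<longleftrightarrow> x \<in> carrier G \<and> g \<in> carrier G \<and> g \<otimes> x \<in> X" for x g
  have half: "0 < \<epsilon> / 2" using \<open>0 < \<epsilon>\<close> by simp
  have R: "dfn (universe M) blocks (\<lambda>e. R (e 0) (e 1))" "\<forall>x g. R x g \<longrightarrow> x \<in> carrier G"
    using dfn_inv_translate[OF X] by (simp_all add: R_def)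
  obtain \<P> where P: "finite \<P>" "\<P> \<subseteq> {(U, W). U \<in> Def \<and> W \<in> Def \<and> \<mu> W - \<mu> U < \<epsilon> / 2}"
    "\<And>U W. definable L M n {g \<in> tuples M n. U \<in> Def \<and> W \<in> Def \<and> U \<subseteq> {x. R x g} \<and> {x. R x g} \<subseteq> W}"
    "\<And>g. g \<in> tuples M n \<Longrightarrow> \<exists>(U, W)\<in>\<P>. U \<subseteq> {x. R x g} \<and> {x. R x g} \<subseteq> W"
    by (rule uniform_sandwich[OF R(1) refl refl R(2) half]) (rule that; assumption)
  define T where "T D x g \<longleftrightarrow> g \<in> carrier G \<and> x \<in> g <# D" for D x g
  define good where "good D \<Q> \<longleftrightarrow> finite \<Q> \<and> \<Q> \<subseteq> {(U, W). U \<in> Def \<and> W \<in> Def \<and> \<mu> W - \<mu> U < \<epsilon> / 2} \<and>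
      (\<forall>U W. definable L M n {g \<in> tuples M n. U \<in> Def \<and> W \<in> Def \<and> U \<subseteq> {x. T D x g} \<and> {x. T D x g} \<subseteq> W}) \<and>
      (\<forall>g\<in>tuples M n. \<exists>(U, W)\<in>\<Q>. U \<subseteq> {x. T D x g} \<and> {x. T D x g} \<subseteq> W)" for D \<Q>
  have "\<exists>\<Q>. good D \<Q>" if D: "D \<in> Def" for D
  proof -
    have T: "dfn (universe M) blocks (\<lambda>e. T D (e 0) (e 1))" "\<forall>x g. T D x g \<longrightarrow> x \<in> carrier G"
      using dfn_translate[OF D] l_coset_subset_G[OF DefD(2)[OF D]] by (auto simp: T_def)
    show ?thesis unfolding good_def
      by (rule uniform_sandwich[OF T(1) refl refl T(2) half]) (intro exI conjI allI ballI; assumption)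
  qed
  then obtain \<Q> where good: "\<And>D. D \<in> Def \<Longrightarrow> good D (\<Q> D)" by metis
  have Q: "finite (\<Q> D)" "\<Q> D \<subseteq> {(U, W). U \<in> Def \<and> W \<in> Def \<and> \<mu> W - \<mu> U < \<epsilon> / 2}"
      "definable L M n {g \<in> tuples M n. U \<in> Def \<and> W \<in> Def \<and> U \<subseteq> {x. T D x g} \<and> {x. T D x g} \<subseteq> W}"
      "g \<in> tuples M n \<Longrightarrow> \<exists>(U, W)\<in>\<Q> D. U \<subseteq> {x. T D x g} \<and> {x. T D x g} \<subseteq> W" if "D \<in> Def" for D U W g
    using good[OF that] by (simp_all add: good_def)
  \<comment> \<open>For group elements sharing the sandwich \<open>U\<close>, \<open>W\<close>, the
    fibres of \<open>R\<close> can only differ inside \<open>W - U\<close>. The second round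
    approximates the translates of this set.\<close>
  define err where "err = (\<lambda>(U, W :: 'a list set). W - U)"
  have P': "err i \<in> Def" if "i \<in> \<P>" for i
    using P(2) that charge.Diff by (auto simp: err_def)
  define J where "J = (SIGMA i:\<P>. \<Q> (err i))"
  define C where "C = (\<lambda>((U, W), (U', W')). carrier G \<inter>
    ({g \<in> tuples M n. U \<in> Def \<and> W \<in> Def \<and> U \<subseteq> {x. R x g} \<and> {x. R x g} \<subseteq> W} \<inter>
     {g \<in> tuples M n. U' \<in> Def \<and> W' \<in> Def \<and> U' \<subseteq> {x. T (W - U) x g} \<and> {x. T (W - U) x g} \<subseteq> W'}))"
  have finJ: "finite J" unfolding J_def by (rule finite_SigmaI[OF P(1) Q(1)[OF P']])
  have CDef: "C j \<in> Def" if j: "j \<in> J" for j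
  proof -
    obtain U W U' W' where j': "j = ((U, W), (U', W'))" by (metis surj_pair)
    have "W - U \<in> Def" using j P' by (auto simp: j' J_def err_def)
    from Q(3)[OF this] have "definable L M n (C j)"
      unfolding j' C_def prod.case by (rule definable_Int[OF S_definable definable_Int[OF P(3)]])
    moreover have "C j \<subseteq> carrier G" by (auto simp: j' C_def)
    ultimately show ?thesis by (rule DefI)
  qed
  have cover: "carrier G \<subseteq> (\<Union>j\<in>J. C j)"
  proof
    fix g assume g: "g \<in> carrier G"
    then have gt: "g \<in> tuples M n" using carrier_tuples by blast
    obtain U W where UW: "(U, W) \<in> \<P>" "U \<subseteq> {x. R x g}" "{x. R x g} \<subseteq> W" using P(4)[OF gt] by blast
    have D: "W - U \<in> Def" using P'[OF UW(1)] by (simp add: err_def)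
    obtain U' W' where UW': "(U', W') \<in> \<Q> (W - U)" "U' \<subseteq> {x. T (W - U) x g}" "{x. T (W - U) x g} \<subseteq> W'"
      using Q(4)[OF D gt] by blast
    have "((U, W), (U', W')) \<in> J" using UW(1) UW'(1) by (simp add: J_def err_def)
    moreover have "U \<in> Def" "W \<in> Def" using UW(1) P(2) by auto
    moreover have "U' \<in> Def" "W' \<in> Def" using UW'(1) Q(2)[OF D] by auto
    ultimately show "g \<in> (\<Union>j\<in>J. C j)"
      using UW UW' g gt by (intro UN_I[of "((U, W), (U', W'))"]) (simp_all add: C_def)
  qed
  have "\<exists>j\<in>J. 0 < \<mu> (C j)"
  proof (rule ccontr)
    assume "\<not> (\<exists>j\<in>J. 0 < \<mu> (C j))"
    then have "\<mu> (C j) \<le> 0" if "j \<in> J" for j using that by (simp add: not_less)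
    then have "(\<Sum>j\<in>J. \<mu> (C j)) \<le> 0" by (intro sum_nonpos)
    moreover have "\<mu> (\<Union>j\<in>J. C j) \<le> (\<Sum>j\<in>J. \<mu> (C j))" by (rule charge.measure_UN_le[OF finJ CDef])
    moreover have "\<mu> (carrier G) \<le> \<mu> (\<Union>j\<in>J. C j)"
      by (rule charge.measure_mono[OF charge.top charge.UN_in[OF finJ CDef] cover])
    ultimately show False using charge.total by simp
  qed
  then obtain j where j: "j \<in> J" "0 < \<mu> (C j)" by blast
  obtain U W U' W' where j': "j = ((U, W), (U', W'))" by (metis surj_pair)
  have UW: "(U, W) \<in> \<P>" "(U', W') \<in> \<Q> (W - U)" using j(1) by (auto simp: j' J_def err_def)
  have D: "W - U \<in> Def" using P'[OF UW(1)] by (simp add: err_def)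
  have Def: "U \<in> Def" "W \<in> Def" "\<mu> W - \<mu> U < \<epsilon> / 2" "U' \<in> Def" "W' \<in> Def" "\<mu> W' - \<mu> U' < \<epsilon> / 2"
    using UW P(2) Q(2)[OF D] by auto
  have CD: "g \<in> carrier G" "U \<subseteq> {x. R x g}" "{x. R x g} \<subseteq> W" "U' \<subseteq> g <# (W - U)" "g <# (W - U) \<subseteq> W'"
    if "g \<in> C j" for g
    using that by (auto simp: j' C_def T_def)
  show ?thesis
  proof (rule that)
    show "C j \<in> Def" "0 < \<mu> (C j)" "W' \<in> Def" by (rule CDef[OF j(1)], rule j(2), rule Def(5))
    have "C j \<noteq> {}" using j(2) charge.measure_empty by auto
    then obtain g where g: "g \<in> C j" by blast
    \<comment> \<open>Since \<open>U'\<close> lies in a translate of \<open>W - U\<close>, its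
      measure is less than \<open>\<epsilon> / 2\<close> by the first round, and \<open>W'\<close>
      adds less than \<open>\<epsilon> / 2\<close> by the second.\<close>
    have "\<mu> U' \<le> \<mu> (W - U)"
      using charge.measure_mono[OF Def(4) translate_Def[OF CD(1)[OF g] D] CD(4)[OF g]]
        measure_translate[OF CD(1)[OF g] D] by simp
    moreover have "\<mu> (W - U) = \<mu> W - \<mu> U"
      using CD(2,3)[OF g] by (intro charge.measure_Diff Def) auto
    ultimately show "\<mu> W' < \<epsilon>" using Def(3,6) by simp
    fix a b y assume a: "a \<in> C j" and b: "b \<in> C j" and y: "y \<in> carrier G"
      and differ: "(y \<in> X) \<noteq> (b \<otimes> inv a \<otimes> y \<in> X)"
    have G: "a \<in> carrier G" "b \<in> carrier G" using CD(1) a b by auto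
    \<comment> \<open>At this point the fibres over \<open>a\<close> and \<open>b\<close> disagree:
      \<open>a \<otimes> x\<close> is \<open>y\<close>, and \<open>b \<otimes> x\<close> is its
      image under \<open>b \<otimes> inv a\<close>. Hence \<open>x\<close> lies in
      \<open>W - U\<close>, and \<open>y\<close> in the translate of that set by \<open>a\<close>,
      which \<open>W'\<close> contains.\<close>
    define x where "x = inv a \<otimes> y"
    have x: "x \<in> carrier G" "a \<otimes> x = y" "b \<otimes> x = b \<otimes> inv a \<otimes> y"
      using G y by (simp_all add: x_def m_assoc[symmetric])
    have "R x a \<longleftrightarrow> y \<in> X" "R x b \<longleftrightarrow> b \<otimes> inv a \<otimes> y \<in> X" using x G by (simp_all add: R_def)
    then have "R x a \<noteq> R x b" using differ by simp
    then have "x \<in> W - U" using CD(2,3)[OF a] CD(2,3)[OF b] by blast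
    then have "y \<in> a <# (W - U)" using x(2) by (auto simp: mem_l_coset)
    then show "y \<in> W'" using CD(5)[OF a] by blast
  qed
qed

lemma regularity:
  assumes prof: "profinite_group (G Mod stabilizer) (logic_topology L M n G stabilizer)"
    and X: "X \<in> Def" and "0 < \<epsilon>"
  obtains H Z where "H \<lhd> G" "H \<in> Def" "finite (rcosets H)" "Z \<subseteq> carrier G"
    "\<And>z. z \<in> Z \<Longrightarrow> z <# H \<subseteq> Z" "\<mu> Z < \<epsilon>" "\<And>x. x \<in> X - Z \<Longrightarrow> x <# H \<subseteq> X - Z"
    "\<And>g. g \<in> carrier G - Z \<Longrightarrow> (g <# H) \<inter> X = {} \<or> g <# H \<subseteq> X"
proof -
  obtain B W where B: "B \<in> Def" "0 < \<mu> B" and W: "W \<in> Def" "\<mu> W < \<epsilon>"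
    and BW: "\<And>a b y. a \<in> B \<Longrightarrow> b \<in> B \<Longrightarrow> y \<in> carrier G \<Longrightarrow> (y \<in> X) \<noteq> (b \<otimes> inv a \<otimes> y \<in> X) \<Longrightarrow> y \<in> W"
    by (rule confined_differences[OF X \<open>0 < \<epsilon>\<close>]) (rule that; assumption)
  \<comment> \<open>The threshold is the distance between \<open>B\<close> and a translate disjoint
    from it. Every element of \<open>Q\<close>, and so of \<open>H\<close>, is thus a quotient of
    two elements of \<open>B\<close>.\<close>
  have "0 < 2 * \<mu> B" using B(2) by simp
  then obtain Q where Q: "Q \<in> Def" "stabilizer \<subseteq> Q" "\<And>g. g \<in> Q \<Longrightarrow> charge.dst (g <# B) B < 2 * \<mu> B"
    by (rule stabilizer_approx[OF B(1)]) (rule that; assumption)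
  obtain H where H: "H \<lhd> G" "H \<in> Def" "finite (rcosets H)" "H \<subseteq> Q"
    by (rule definable_normal_subgroup[OF prof Q(1,2)])
  have sub: "subgroup H G" by (rule normal_imp_subgroup[OF H(1)])
  have HG: "H \<subseteq> carrier G" by (rule subgroup.subset[OF sub])
  have HW: "y \<in> W" if h: "h \<in> H" and y: "y \<in> carrier G" and differ: "(y \<in> X) \<noteq> (h \<otimes> y \<in> X)" for h y
  proof -
    have hG: "h \<in> carrier G" using h HG by blast
    have "(h <# B) \<inter> B \<noteq> {}"
      using Q(3)[of h] h H(4) charge.dst_disjoint[OF translate_Def[OF hG B(1)] B(1)]
        measure_translate[OF hG B(1)] by auto
    then obtain a where a: "a \<in> B" "h \<otimes> a \<in> B" by (auto simp: mem_l_coset)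
    have "a \<in> carrier G" using a(1) DefD(2)[OF B(1)] by blast
    then have "h = (h \<otimes> a) \<otimes> inv a" using hG by (simp add: m_assoc)
    then show ?thesis using BW[OF a y] differ by simp
  qed
  define Z where "Z = {x \<in> carrier G. (\<exists>y\<in>x <# H. y \<in> X) \<and> (\<exists>y\<in>x <# H. y \<notin> X)}"
  have coset: "x <# H = y <# H" "y \<in> carrier G" if "x \<in> carrier G" "y \<in> x <# H" for x y
  proof -
    have y: "y \<in> H #> x" using that normal.coset_eq[OF H(1)] by simp
    show yG: "y \<in> carrier G" using that l_coset_subset_G[OF HG] by blast
    have "H #> x = H #> y" by (rule repr_independence[OF y that(1) sub])
    then show "x <# H = y <# H" using that(1) yG normal.coset_eq[OF H(1)] by simp
  qed
  have self: "x \<in> x <# H" if "x \<in> carrier G" for x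
    using that rcos_self[OF that sub] normal.coset_eq[OF H(1)] by simp
  have ZG: "Z \<subseteq> carrier G" by (auto simp: Z_def)
  have ZH: "z <# H \<subseteq> Z" if z: "z \<in> Z" for z
  proof
    fix y assume y: "y \<in> z <# H"
    have zG: "z \<in> carrier G" using z ZG by blast
    show "y \<in> Z" using z coset[OF zG y] by (simp add: Z_def)
  qed
  have ZW: "Z \<subseteq> W"
  proof
    fix z assume z: "z \<in> Z"
    then have zG: "z \<in> carrier G" using ZG by blast
    obtain y where y: "y \<in> z <# H" "(z \<in> X) \<noteq> (y \<in> X)" using z unfolding Z_def by blast
    \<comment> \<open>Normality turns the left coset of \<open>z\<close> into the right coset, so
      that \<open>y\<close> is \<open>h \<otimes> z\<close> with \<open>h\<close> in
      \<open>H\<close>, the form to which \<open>HW\<close> applies.\<close>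
    then have "y \<in> H #> z" using zG normal.coset_eq[OF H(1)] by simp
    then obtain h where "h \<in> H" "y = h \<otimes> z" by (auto simp: r_coset_def)
    then show "z \<in> W" using HW[OF _ zG] y(2) by blast
  qed
  have dich: "(g <# H) \<inter> X = {} \<or> g <# H \<subseteq> X" if "g \<in> carrier G - Z" for g
    using that unfolding Z_def by blast
  show ?thesis
  proof (rule that[OF H(1,2,3) ZG ZH])
    have "Z \<in> Def" by (rule union_of_rcosets(2)[OF H(1,2,3) ZG ZH])
    then show "\<mu> Z < \<epsilon>" using charge.measure_mono[OF _ W(1) ZW] W(2) by simp
    show "x <# H \<subseteq> X - Z" if x: "x \<in> X - Z" for x
    proof
      have xG: "x \<in> carrier G" using x DefD(2)[OF X] by blast
      have "x <# H \<subseteq> X" using dich[of x] x xG self[OF xG] by blast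
      moreover fix y assume y: "y \<in> x <# H"
      moreover have "y \<notin> Z"
      proof
        assume "y \<in> Z"
        then have "y <# H \<subseteq> Z" by (rule ZH)
        then show False using coset(1)[OF xG y] self[OF xG] x by blast
      qed
      ultimately show "y \<in> X - Z" by blast
    qed
  qed (assumption, rule dich)
qed

end

theorem theorem6p7:
  fixes L :: "('f, 'r) language"
    and T :: "('f, 'r) formula set"
    and M :: "('f, 'r, 'a) fo_struct"
    and n :: nat
    and G :: "'a list monoid"
    and \<mu> :: "'a list set \<Rightarrow> real"
    and X :: "'a list set"
    and \<epsilon> :: real
  assumes "complete_theory TYPE('a) L T"
    and "NIP TYPE('a) L T"
    and "models L T M"
    and "saturated L M"
    and "large L M"
    and "definable_group L M n G"
    and "fsg L M n G"
    and "keisler_measure L M n (carrier G) \<mu>"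
    and "left_invariant L M n G \<mu>"
    and "smooth L M n (carrier G) \<mu> \<or> distal L T M"
    and "profinite_group (G Mod G00 L M n G) (logic_topology L M n G (G00 L M n G))"
    and "definable L M n X"
    and "X \<subseteq> carrier G"
    and "\<epsilon> > 0"
  shows "\<exists>H Z. H \<lhd> G \<and> definable L M n H \<and> finite (rcosets\<^bsub>G\<^esub> H) \<and>
           Z \<subseteq> carrier G \<and> union_of_cosets G H Z \<and> \<mu> Z < \<epsilon> \<and>
           union_of_cosets G H (X - Z) \<and>
           (\<forall>g\<in>carrier G - Z. (g <#\<^bsub>G\<^esub> H) \<inter> X = {} \<or> g <#\<^bsub>G\<^esub> H \<subseteq> X)"
proof -
  have "\<exists>\<nu>. keisler_measure L M n (carrier G) \<nu> \<and> left_invariant L M n G \<nu> \<and> smooth L M n (carrier G) \<nu>"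
    using assms(10)
  proof
    assume "smooth L M n (carrier G) \<mu>"
    then show ?thesis using assms(8,9) by blast
  next
    \<comment> \<open>Here smoothness comes from the generically stable invariant measure that
      \<open>fsg\<close> provides, and this measure takes the place of \<mu>.\<close>
    assume "distal L T M"
    then show ?thesis
      using assms(6,7) unfolding distal_def fsg_def definable_group_def by blast
  qed
  then obtain \<nu> where \<nu>: "keisler_measure L M n (carrier G) \<nu>" "left_invariant L M n G \<nu>"
    "smooth L M n (carrier G) \<nu>" by blast
  interpret smooth_definable_group L M n G \<nu>
    by unfold_locales (use assms(3-6) \<nu> in \<open>auto simp: models_def\<close>)
  have X: "X \<in> Def" using assms(12,13) by (rule DefI)
  obtain H Z where H: "H \<lhd> G" "H \<in> Def" "finite (rcosets\<^bsub>G\<^esub> H)"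
    and Z: "Z \<subseteq> carrier G" "\<And>z. z \<in> Z \<Longrightarrow> z <#\<^bsub>G\<^esub> H \<subseteq> Z" "\<nu> Z < \<epsilon>"
    and reg: "\<And>x. x \<in> X - Z \<Longrightarrow> x <#\<^bsub>G\<^esub> H \<subseteq> X - Z"
      "\<And>g. g \<in> carrier G - Z \<Longrightarrow> (g <#\<^bsub>G\<^esub> H) \<inter> X = {} \<or> g <#\<^bsub>G\<^esub> H \<subseteq> X"
    by (rule regularity[OF assms(11)[unfolded G00_eq_stabilizer] X assms(14)]) (rule that; assumption)
  have sub: "subgroup H G" by (rule normal_imp_subgroup[OF H(1)])
  have "\<mu> Z = \<nu> Z" by (rule invariant_measures_agree[OF H Z(1,2) assms(8,9)])
  moreover have "union_of_cosets G H Z" by (rule union_of_cosetsI[OF sub Z(1,2)])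
  moreover have "union_of_cosets G H (X - Z)"
    using assms(13) by (intro union_of_cosetsI[OF sub _ reg(1)]) auto
  ultimately show ?thesis using H Z reg(2) DefD(1)[OF H(2)] by (intro exI[of _ H] exI[of _ Z]) simp
qed

end
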